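(* For any inverse temperature $\beta\in(0,\infty)$, any range exponent $\alpha\in(1,\infty)$ and any $q\in(0,2)$, there exists a constant $c_\beta=c(\beta,\alpha,q)>0$ such that, for every integer $N\ge2$, $$ \begin{aligned} c_\beta &\le \mathrm{Var}^{q\text{-}\mathrm{SOS}}_{N,\beta,\alpha}[\varphi(0)] && \text{if } \alpha\in(1,2],\\ c_\beta N^{\frac{2}{q}(\alpha-2)} &\le \mathrm{Var}^{q\text{-}\mathrm{SOS}}_{N,\beta,\alpha}[\varphi(0)] && \text{if } \alpha\in\left(2,2+\tfrac q2\right),\\ c_\beta \frac{N}{(\ln N)^{2/q}} &\le \mathrm{Var}^{q\text{-}\mathrm{SOS}}_{N,\beta,\alpha}[\varphi(0)] && \text{if } \alpha=2+\tfrac q2,\\ c_\beta N &\le \mathrm{Var}^{q\text{-}\mathrm{SOS}}_{N,\beta,\alpha}[\varphi(0)] && \text{if } \alpha>2+\tfrac q2. \end{aligned} $$ Moreover, there exists a constant $C_\beta=C(\beta,\alpha,q)<\infty$ such that, for every integer $N\ge2$, $$ \mathrm{Var}^{q\text{-}\mathrm{SOS}}_{N,\beta,\alpha}[\varphi(0)]\le \begin{cases} C_\beta & \text{if } \alpha<q,\\ C_\beta\ln N & \text{if } \alpha=q,\\ C_\beta N^{\frac{2\alpha}{q}-2} & \text{if } \alpha>q. \end{cases} $$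
   Context: Discrete $q$-SOS long-range chain with Dirichlet boundary condition. For an integer $N\ge 1$, let $$\Omega_N:=\{\varphi:\mathbb{Z}\to\mathbb{Z} : \varphi(k)=0 \text{ for all } k\notin\{-N,\ldots,N\}\}.$$ For $q\in(0,2)$, $\beta\in(0,\infty)$ and $\alpha\in(1,\infty)$, $\mu^{q\text{-}\mathrm{SOS}}_{N,\beta,\alpha}$ is the probability measure on the countable set $\Omega_N$ given by $$\mu^{q\text{-}\mathrm{SOS}}_{N,\beta,\alpha}(\{\varphi\})=\frac{1}{Z^{q\text{-}\mathrm{SOS}}_{N,\beta,\alpha}}\exp\Big(-\beta\sum_{i,j\in\mathbb{Z}}\frac{|\varphi(i)-\varphi(j)|^q}{|i-j|^\alpha}\Big),\qquad \varphi\in\Omega_N,$$ where the sum runs over ordered pairs $(i,j)$ with $i\neq j$ (terms with $i=j$ are taken to be $0$) and $Z^{q\text{-}\mathrm{SOS}}_{N,\beta,\alpha}$ is the normalizing constant. $\mathrm{Var}^{q\text{-}\mathrm{SOS}}_{N,\beta,\alpha}$ denotes the variance with respect to this measure. *)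

theory Defs
  imports "HOL-Probability.Probability"
begin

definition Omega :: "nat \<Rightarrow> (int \<Rightarrow> int) set"
  where "Omega N = {\<phi>. \<forall>k. k \<notin> {- int N..int N} \<longrightarrow> \<phi> k = 0}"

text \<open>The sum runs over ordered pairs, so every unordered pair is counted twice. The real-valued
  \<open>infsum\<close> would be 0 for a divergent series; the lemma \<open>sos_energy_summable\<close> rules this out.\<close>

definition sos_energy :: "real \<Rightarrow> real \<Rightarrow> (int \<Rightarrow> int) \<Rightarrow> real"
  where "sos_energy \<alpha> q \<phi> =
    (\<Sum>\<^sub>\<infinity>(i, j)\<in>{(i, j). i \<noteq> j}. real_of_int \<bar>\<phi> i - \<phi> j\<bar> powr q / real_of_int \<bar>i - j\<bar> powr \<alpha>)"

definition sos_weight :: "real \<Rightarrow> real \<Rightarrow> real \<Rightarrow> (int \<Rightarrow> int) \<Rightarrow> real"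
  where "sos_weight \<beta> \<alpha> q \<phi> = exp (- \<beta> * sos_energy \<alpha> q \<phi>)"

definition sos_partition :: "nat \<Rightarrow> real \<Rightarrow> real \<Rightarrow> real \<Rightarrow> real"
  where "sos_partition N \<beta> \<alpha> q = (\<Sum>\<^sub>\<infinity>\<phi>\<in>Omega N. sos_weight \<beta> \<alpha> q \<phi>)"

definition sos_measure :: "nat \<Rightarrow> real \<Rightarrow> real \<Rightarrow> real \<Rightarrow> (int \<Rightarrow> int) measure"
  where "sos_measure N \<beta> \<alpha> q =
    point_measure (Omega N) (\<lambda>\<phi>. ennreal (sos_weight \<beta> \<alpha> q \<phi> / sos_partition N \<beta> \<alpha> q))"

definition sos_var :: "nat \<Rightarrow> real \<Rightarrow> real \<Rightarrow> real \<Rightarrow> ((int \<Rightarrow> int) \<Rightarrow> real) \<Rightarrow> real"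
  where "sos_var N \<beta> \<alpha> q X = prob_space.variance (sos_measure N \<beta> \<alpha> q) X"


text \<open>
  The remaining facts show that no totalised default value enters: the energy series and the
  partition function converge, \<open>sos_measure\<close> is a probability measure, and the height at the
  origin is square integrable, so that its Bochner variance is the actual variance.
\<close>

lemma even_summable_on_int:
  fixes f :: "int \<Rightarrow> real"
  assumes "summable (\<lambda>n. f (int n))" and "\<And>k. 0 \<le> f k" and "\<And>k. f (- k) = f k"
  shows "f summable_on UNIV"
proof -
  have nat: "(\<lambda>n. f (int n)) summable_on UNIV"
    using assms by (subst summable_on_UNIV_nonneg_real_iff) auto
  have "f summable_on range int"
    using nat by (subst summable_on_reindex) (auto simp: o_def)
  moreover have "f summable_on range (\<lambda>n. - int n)"
    using nat assms(3) by (subst summable_on_reindex) (auto simp: o_def inj_on_def)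
  ultimately have "f summable_on (range int \<union> range (\<lambda>n. - int n))"
    by (rule summable_on_union)
  moreover have "range int \<union> range (\<lambda>n. - int n) = UNIV"
    by (auto simp: image_iff) (metis int_cases2)
  ultimately show ?thesis by simp
qed

lemma sos_energy_summable:
  assumes "1 < \<alpha>" and "0 < q" and "\<phi> \<in> Omega N"
  shows "(\<lambda>(i, j). real_of_int \<bar>\<phi> i - \<phi> j\<bar> powr q / real_of_int \<bar>i - j\<bar> powr \<alpha>)
    summable_on {(i, j). i \<noteq> j}"
proof -
  let ?f = "\<lambda>(i, j). real_of_int \<bar>\<phi> i - \<phi> j\<bar> powr q / real_of_int \<bar>i - j\<bar> powr \<alpha>"
  let ?B = "{- int N..int N}"
  define M where "M = Max (abs ` insert 0 (\<phi> ` ?B))"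
  have M: "\<bar>\<phi> i\<bar> \<le> M" for i
  proof -
    have "\<phi> i \<in> insert 0 (\<phi> ` ?B)"
      using assms(3) by (cases "i \<in> ?B") (auto simp: Omega_def)
    then show ?thesis unfolding M_def by (intro Max_ge) auto
  qed
  have M0: "0 \<le> M" using M[of 0] by linarith
  define K where "K = real_of_int (2 * M) powr q"
  have f0: "0 \<le> ?f p" for p by (auto split: prod.split)
  have le: "?f (i, j) \<le> K * real_of_int \<bar>i - j\<bar> powr (- \<alpha>)" for i j
  proof -
    have "\<bar>\<phi> i - \<phi> j\<bar> \<le> 2 * M" using M[of i] M[of j] by linarith
    then have "real_of_int \<bar>\<phi> i - \<phi> j\<bar> \<le> real_of_int (2 * M)"
      by (simp only: of_int_le_iff)
    then have "real_of_int \<bar>\<phi> i - \<phi> j\<bar> powr q \<le> K"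
      unfolding K_def using assms(2) by (intro powr_mono2) auto
    then have "real_of_int \<bar>\<phi> i - \<phi> j\<bar> powr q * real_of_int \<bar>i - j\<bar> powr (- \<alpha>)
        \<le> K * real_of_int \<bar>i - j\<bar> powr (- \<alpha>)"
      by (intro mult_right_mono) auto
    then show ?thesis by (simp add: powr_minus divide_inverse)
  qed
  have base: "(\<lambda>k::int. K * real_of_int \<bar>k\<bar> powr (- \<alpha>)) summable_on UNIV"
  proof (intro summable_on_cmult_right even_summable_on_int)
    show "summable (\<lambda>n. real_of_int \<bar>int n\<bar> powr (- \<alpha>))"
      using assms(1) by (simp add: summable_real_powr_iff)
  qed auto
  have row: "?f summable_on ((\<lambda>j. (i, j)) ` UNIV)" for i
  proof -
    have "(\<lambda>j. K * real_of_int \<bar>i - j\<bar> powr (- \<alpha>)) summable_on UNIV"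
      using base
      by (subst summable_on_reindex_bij_witness[where i="\<lambda>k. i - k" and j="\<lambda>j. i - j"
            and T=UNIV and h="\<lambda>k::int. K * real_of_int \<bar>k\<bar> powr (- \<alpha>)"]) auto
    then have "(\<lambda>j. ?f (i, j)) summable_on UNIV"
      by (rule summable_on_comparison_test) (use le f0 in auto)
    then show ?thesis by (subst summable_on_reindex) (auto simp: o_def inj_on_def)
  qed
  have col: "?f summable_on ((\<lambda>i. (i, j)) ` UNIV)" for j
  proof -
    have "(\<lambda>i. K * real_of_int \<bar>i - j\<bar> powr (- \<alpha>)) summable_on UNIV"
      using base
      by (subst summable_on_reindex_bij_witness[where i="\<lambda>k. k + j" and j="\<lambda>i. i - j"
            and T=UNIV and h="\<lambda>k::int. K * real_of_int \<bar>k\<bar> powr (- \<alpha>)"]) auto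
    then have "(\<lambda>i. ?f (i, j)) summable_on UNIV"
      by (rule summable_on_comparison_test) (use le f0 in auto)
    then show ?thesis by (subst summable_on_reindex) (auto simp: o_def inj_on_def)
  qed
  have fin: "?f summable_on (\<Union>i\<in>F. S i)" if "finite F" "\<And>i. ?f summable_on S i"
    for F :: "int set" and S :: "int \<Rightarrow> (int \<times> int) set"
    using that(1)
  proof induction
    case (insert x F)
    then show ?case using summable_on_union[OF that(2)[of x] insert.IH] by simp
  qed simp
  let ?U = "(\<Union>i\<in>?B. (\<lambda>j. (i, j)) ` UNIV) \<union> (\<Union>j\<in>?B. (\<lambda>i. (i, j)) ` UNIV)"
  have "?f summable_on ?U"
    by (rule summable_on_union[OF fin[OF _ row] fin[OF _ col]]) auto
  moreover have "?f p = 0" if "p \<notin> ?U" for p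
  proof -
    obtain i j where p: "p = (i, j)" by (cases p)
    have "i \<notin> ?B" using that unfolding p by blast
    moreover have "j \<notin> ?B" using that unfolding p by blast
    ultimately have "\<phi> i = 0" "\<phi> j = 0" using assms(3) unfolding Omega_def by blast+
    then show ?thesis using p by simp
  qed
  ultimately have "?f summable_on UNIV"
    by (subst summable_on_cong_neutral[where T="?U" and g="?f"]) auto
  then show ?thesis by (rule summable_on_subset) auto
qed


lemma summable_on_int_exp_powr:
  assumes "0 < c" and "0 < (q::real)"
  shows "(\<lambda>x::int. (1 + (real_of_int x)\<^sup>2) * exp (- c * real_of_int \<bar>x\<bar> powr q)) summable_on UNIV"
proof (rule even_summable_on_int)
  obtain m :: nat where m: "4 / q \<le> real m" using real_arch_simple by blast
  have qm: "4 \<le> q * real m" using m assms(2) by (simp add: field_simps)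
  define D where "D = 2 * (fact m / c ^ m)"
  have bd: "(1 + (real n)\<^sup>2) * exp (- c * real n powr q) \<le> D * real n powr (-2)" if "n \<ge> 1" for n
  proof -
    have n: "1 \<le> real n" using that by simp
    have pos: "0 < c * real n powr q" using assms n by simp
    have "(c * real n powr q) ^ m / fact m \<le> exp (c * real n powr q)"
    proof -
      have "(\<Sum>k\<in>{m}. (c * real n powr q) ^ k /\<^sub>R fact k) \<le> (\<Sum>k. (c * real n powr q) ^ k /\<^sub>R fact k)"
        by (rule sum_le_suminf) (use pos summable_exp_generic[of \<open>c * real n powr q\<close>] in auto)
      then show ?thesis by (simp add: exp_def divide_inverse mult.commute)
    qed
    moreover have "c ^ m * real n powr 4 / fact m \<le> (c * real n powr q) ^ m / fact m"
    proof -
      have "real n powr 4 \<le> real n powr (q * real m)" using n qm by (intro powr_mono) auto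
      also have "\<dots> = (real n powr q) ^ m" using n by (simp add: powr_powr[symmetric] powr_realpow)
      finally show ?thesis using assms(1)
        by (simp add: power_mult_distrib divide_right_mono mult_left_mono)
    qed
    ultimately have e: "c ^ m * real n powr 4 / fact m \<le> exp (c * real n powr q)" by linarith
    have "exp (- c * real n powr q) = inverse (exp (c * real n powr q))"
      by (simp add: exp_minus)
    also have "\<dots> \<le> inverse (c ^ m * real n powr 4 / fact m)"
      using e assms n by (intro le_imp_inverse_le) auto
    also have "\<dots> = fact m / c ^ m * real n powr (-4)"
      using assms n by (simp add: powr_minus field_simps)
    finally have "(1 + (real n)\<^sup>2) * exp (- c * real n powr q)
        \<le> (2 * (real n)\<^sup>2) * (fact m / c ^ m * real n powr (-4))"
      using n assms by (intro mult_mono) (auto simp: self_le_power)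
    also have "(real n)\<^sup>2 * real n powr (-4) = real n powr (-2)"
      using n by (simp add: powr_add[symmetric] flip: powr_numeral)
    then have "(2 * (real n)\<^sup>2) * (fact m / c ^ m * real n powr (-4)) = D * real n powr (-2)"
      unfolding D_def by (simp add: mult_ac)
    finally show ?thesis .
  qed
  show "summable (\<lambda>n. (1 + (real_of_int (int n))\<^sup>2) * exp (- c * real_of_int \<bar>int n\<bar> powr q))"
    by (rule summable_comparison_test'[where N=1 and g="\<lambda>n. D * real n powr (-2)"])
      (use bd in \<open>auto simp: summable_real_powr_iff intro!: summable_mult\<close>)
qed auto

lemma sos_energy_ge:
  assumes "1 < \<alpha>" and "0 < q" and "\<phi> \<in> Omega N"
  shows "(\<Sum>i\<in>{- int N..int N}. real_of_int \<bar>\<phi> i\<bar> powr q) / (2 * real N + 1) powr \<alpha> \<le> sos_energy \<alpha> q \<phi>"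
proof -
  let ?f = "\<lambda>(i, j). real_of_int \<bar>\<phi> i - \<phi> j\<bar> powr q / real_of_int \<bar>i - j\<bar> powr \<alpha>"
  let ?B = "{- int N..int N}"
  have N1: "\<phi> (int N + 1) = 0" using assms(3) by (auto simp: Omega_def)
  have "(\<Sum>i\<in>?B. real_of_int \<bar>\<phi> i\<bar> powr q) / (2 * real N + 1) powr \<alpha>
      = (\<Sum>i\<in>?B. real_of_int \<bar>\<phi> i\<bar> powr q / (2 * real N + 1) powr \<alpha>)"
    by (rule sum_divide_distrib)
  also have "\<dots> \<le> (\<Sum>i\<in>?B. ?f (i, int N + 1))"
  proof (rule sum_mono)
    fix i assume i: "i \<in> ?B"
    have "real_of_int \<bar>i - (int N + 1)\<bar> powr \<alpha> \<le> (2 * real N + 1) powr \<alpha>"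
      using i assms by (intro powr_mono2) auto
    then show "real_of_int \<bar>\<phi> i\<bar> powr q / (2 * real N + 1) powr \<alpha> \<le> ?f (i, int N + 1)"
      using i N1 by (auto intro!: divide_left_mono)
  qed
  also have "\<dots> = sum ?f ((\<lambda>i. (i, int N + 1)) ` ?B)"
    by (subst sum.reindex) (auto simp: inj_on_def)
  also have "\<dots> \<le> sos_energy \<alpha> q \<phi>"
    unfolding sos_energy_def
    by (rule finite_sum_le_infsum[OF sos_energy_summable[OF assms]]) auto
  finally show ?thesis .
qed

lemma sos_weight_summable:
  assumes "0 < \<beta>" and "1 < \<alpha>" and "0 < q"
  shows "(\<lambda>\<phi>. (1 + (real_of_int (\<phi> 0))\<^sup>2) * sos_weight \<beta> \<alpha> q \<phi>) summable_on Omega N"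
proof -
  let ?B = "{- int N..int N}"
  define c where "c = \<beta> / (2 * real N + 1) powr \<alpha>"
  have c: "0 < c" using assms(1) by (simp add: c_def)
  define h where "h = (\<lambda>x::int. (1 + (real_of_int x)\<^sup>2) * exp (- c * real_of_int \<bar>x\<bar> powr q))"
  have h0: "0 \<le> h x" for x by (simp add: h_def)
  have "h summable_on UNIV" unfolding h_def using summable_on_int_exp_powr[OF c assms(3)] .
  then have "Infinite_Set_Sum.abs_summable_on h UNIV"
    by (simp add: abs_summable_equivalent[symmetric] h0)
  then have "Infinite_Set_Sum.abs_summable_on (\<lambda>g. \<Prod>i\<in>?B. h (g i)) (PiE ?B (\<lambda>_. UNIV))"
    by (intro abs_summable_on_prod_PiE) auto
  then have "(\<lambda>g. \<Prod>i\<in>?B. h (g i)) summable_on (PiE ?B (\<lambda>_. UNIV))"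
    by (simp add: abs_summable_equivalent[symmetric] h0 prod_nonneg)
  moreover have "(\<lambda>\<phi>. \<Prod>i\<in>?B. h (\<phi> i)) summable_on Omega N
      \<longleftrightarrow> (\<lambda>g. \<Prod>i\<in>?B. h (g i)) summable_on (PiE ?B (\<lambda>_. UNIV))"
    by (rule summable_on_reindex_bij_witness[where j="\<lambda>\<phi>. restrict \<phi> ?B"
          and i="\<lambda>g k. if k \<in> ?B then g k else 0"])
      (auto simp: Omega_def fun_eq_iff PiE_def extensional_def restrict_def)
  ultimately have "(\<lambda>\<phi>. \<Prod>i\<in>?B. h (\<phi> i)) summable_on Omega N" by simp
  then show ?thesis
  proof (rule summable_on_comparison_test)
    fix \<phi> assume \<phi>: "\<phi> \<in> Omega N"
    have "1 + (real_of_int (\<phi> 0))\<^sup>2 = (\<Prod>i\<in>{0}. 1 + (real_of_int (\<phi> i))\<^sup>2)" by simp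
    also have "\<dots> \<le> (\<Prod>i\<in>?B. 1 + (real_of_int (\<phi> i))\<^sup>2)"
      by (rule prod_mono2) auto
    finally have 1: "1 + (real_of_int (\<phi> 0))\<^sup>2 \<le> (\<Prod>i\<in>?B. 1 + (real_of_int (\<phi> i))\<^sup>2)" .
    have "\<beta> * ((\<Sum>i\<in>?B. real_of_int \<bar>\<phi> i\<bar> powr q) / (2 * real N + 1) powr \<alpha>) \<le> \<beta> * sos_energy \<alpha> q \<phi>"
      using sos_energy_ge[OF assms(2,3) \<phi>] assms(1) by (intro mult_left_mono) auto
    then have "sos_weight \<beta> \<alpha> q \<phi> \<le> exp (\<Sum>i\<in>?B. - c * real_of_int \<bar>\<phi> i\<bar> powr q)"
      by (simp add: sos_weight_def c_def sum_distrib_left sum_divide_distrib sum_negf)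
    also have "\<dots> = (\<Prod>i\<in>?B. exp (- c * real_of_int \<bar>\<phi> i\<bar> powr q))"
      by (rule exp_sum) simp
    finally have "(1 + (real_of_int (\<phi> 0))\<^sup>2) * sos_weight \<beta> \<alpha> q \<phi>
       \<le> (\<Prod>i\<in>?B. 1 + (real_of_int (\<phi> i))\<^sup>2) * (\<Prod>i\<in>?B. exp (- c * real_of_int \<bar>\<phi> i\<bar> powr q))"
      using 1 by (intro mult_mono) (auto intro!: prod_nonneg simp: sos_weight_def)
    then show "(1 + (real_of_int (\<phi> 0))\<^sup>2) * sos_weight \<beta> \<alpha> q \<phi> \<le> (\<Prod>i\<in>?B. h (\<phi> i))"
      by (simp add: h_def prod.distrib)
  qed (auto simp: sos_weight_def)
qed

lemma sos_partition_pos: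
  assumes "0 < \<beta>" and "1 < \<alpha>" and "0 < q"
  shows "sos_weight \<beta> \<alpha> q summable_on Omega N" and "0 < sos_partition N \<beta> \<alpha> q"
proof -
  show s: "sos_weight \<beta> \<alpha> q summable_on Omega N"
    by (rule summable_on_comparison_test[OF sos_weight_summable[OF assms]])
      (auto simp: sos_weight_def)
  have "0 < sum (sos_weight \<beta> \<alpha> q) {\<lambda>_. 0}" by (simp add: sos_weight_def)
  also have "\<dots> \<le> sos_partition N \<beta> \<alpha> q"
    unfolding sos_partition_def
    by (rule finite_sum_le_infsum[OF s]) (auto simp: Omega_def sos_weight_def)
  finally show "0 < sos_partition N \<beta> \<alpha> q" .
qed

lemma prob_space_sos_measure:
  assumes "0 < \<beta>" and "1 < \<alpha>" and "0 < q"
  shows "prob_space (sos_measure N \<beta> \<alpha> q)"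
proof
  let ?w = "\<lambda>\<phi>. sos_weight \<beta> \<alpha> q \<phi> / sos_partition N \<beta> \<alpha> q"
  note Z = sos_partition_pos[OF assms, of N]
  have w0: "0 \<le> ?w \<phi>" for \<phi> using Z(2) by (simp add: sos_weight_def)
  have s: "?w summable_on Omega N"
    using summable_on_cmult_left[OF Z(1)] by (simp add: divide_inverse)
  then have a: "Infinite_Set_Sum.abs_summable_on ?w (Omega N)"
    using Z(2) by (simp add: abs_summable_equivalent[symmetric] sos_weight_def)
  have "emeasure (sos_measure N \<beta> \<alpha> q) (space (sos_measure N \<beta> \<alpha> q))
      = (\<integral>\<^sup>+\<phi>. ennreal (?w \<phi>) \<partial>count_space (Omega N))"
    by (auto simp: sos_measure_def point_measure_def emeasure_density intro!: nn_integral_cong)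
  also have "\<dots> = ennreal (integral\<^sup>L (count_space (Omega N)) ?w)"
    using a w0 by (intro nn_integral_eq_integral) (auto simp: abs_summable_on_def)
  also have "integral\<^sup>L (count_space (Omega N)) ?w = infsum ?w (Omega N)"
    using infsetsum_infsum[OF a] by (simp add: infsetsum_def)
  also have "infsum ?w (Omega N) = 1"
    using infsum_cmult_left'[of "sos_weight \<beta> \<alpha> q" "inverse (sos_partition N \<beta> \<alpha> q)" "Omega N"] Z(2)
    by (simp add: divide_inverse sos_partition_def[symmetric])
  finally show "emeasure (sos_measure N \<beta> \<alpha> q) (space (sos_measure N \<beta> \<alpha> q)) = 1" by simp
qed

lemma integrable_sos_square:
  assumes "0 < \<beta>" and "1 < \<alpha>" and "0 < q"
  shows "integrable (sos_measure N \<beta> \<alpha> q) (\<lambda>\<phi>. (real_of_int (\<phi> 0))\<^sup>2)"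
proof -
  let ?w = "\<lambda>\<phi>. sos_weight \<beta> \<alpha> q \<phi> / sos_partition N \<beta> \<alpha> q"
  note Z = sos_partition_pos[OF assms, of N]
  have w0: "0 \<le> ?w \<phi>" for \<phi> using Z(2) by (simp add: sos_weight_def)
  have "(\<lambda>\<phi>. (real_of_int (\<phi> 0))\<^sup>2 * sos_weight \<beta> \<alpha> q \<phi>) summable_on Omega N"
    by (rule summable_on_comparison_test[OF sos_weight_summable[OF assms]])
      (auto simp: sos_weight_def)
  then have "(\<lambda>\<phi>. ?w \<phi> * (real_of_int (\<phi> 0))\<^sup>2) summable_on Omega N"
    using summable_on_cmult_left[of "\<lambda>\<phi>. (real_of_int (\<phi> 0))\<^sup>2 * sos_weight \<beta> \<alpha> q \<phi>" "Omega N"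
        "inverse (sos_partition N \<beta> \<alpha> q)"]
    by (simp add: divide_inverse mult_ac)
  then have "Infinite_Set_Sum.abs_summable_on (\<lambda>\<phi>. ?w \<phi> * (real_of_int (\<phi> 0))\<^sup>2) (Omega N)"
    using Z(2) by (simp add: abs_summable_equivalent[symmetric] abs_mult sos_weight_def)
  then show ?thesis
    unfolding sos_measure_def point_measure_def
    using w0 by (subst integrable_density) (auto simp: abs_summable_on_def)
qed

end

theory Submission
  imports Defs "HOL-Real_Asymp.Real_Asymp"
begin

text \<open>
  Let \<open>a = q / 2 < 1\<close>. Since all heights outside the box vanish, the energy is a finite sum
  \<open>\<Sum>e. b e * \<bar>x e\<bar> powr q\<close> over edges, where \<open>x e\<close> is the height difference along \<open>e\<close> and the exterior counts as
  one site. The function \<open>exp (- b * s powr a)\<close> of \<open>s \<ge> 0\<close> is completely monotone, so \<open>exp (- b * \<bar>x\<bar> powr q)\<close>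
  is a mixture of Gaussians \<open>exp (- \<kappa> * x\<^sup>2)\<close>, and the chain is a mixture of integer-valued Gaussian chains
  with random conductances \<open>\<kappa>\<close>. This is made explicit through discrete mixtures that come from the Taylor
  coefficients of \<open>1 - (1 - w) powr a\<close> (\<open>stable_approx\<close>). An inequality for Gaussian chains passes to the chain
  when it is linear in each edge factor, or when averaging over the conductances goes in its favour
  (\<open>mixing_principle\<close>). By the symmetry under \<open>\<phi> \<mapsto> - \<phi>\<close>, the variance is the second moment of \<open>\<phi> 0\<close>.

  Upper bound. In a Gaussian chain, real shifts of the edge increments cannot increase the partition
  function (\<open>shifted_gauss_le_gauss\<close>). To second order this says that \<open>\<Sum>e. \<theta> e * x e\<close> has second moment at
  most \<open>(\<Sum>e. (\<theta> e)\<^sup>2 / \<kappa> e) / 2\<close>, the energy of the flow \<open>\<theta>\<close> in a resistor network. Averaging over the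
  mixture turns \<open>1 / \<kappa> e\<close> into a quantity of order \<open>b e powr (- 1 / a)\<close> plus a sublinear function of
  \<open>(x e)\<^sup>2\<close>. Applied to a single edge, the bound then controls its own correction term, so that every edge has
  an effective resistance \<open>b e powr (- 2 / q)\<close> (\<open>flow_bound\<close>), which is of order \<open>r powr (2 * \<alpha> / q)\<close> at length \<open>r\<close>. A
  unit flow from the origin through dyadic blocks dissipates an energy of order \<open>2 powr (k * (2 * \<alpha> / q - 2))\<close> at scale \<open>2 ^ k\<close>; summing over the
  scales up to \<open>N\<close> gives the three cases (\<open>variance_upper\<close>).

  Lower bound. In a Gaussian chain, additional couplings and constraints reduce the second moment of
  \<open>\<phi> 0\<close> (\<open>gauss_correlation\<close>). Choose cuts of spacing \<open>l\<close>, force the heights to be constant between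
  consecutive cuts and symmetric about the origin, and bound the square of a sum of \<open>n\<close> jumps by \<open>n\<close> times
  the sum of their squares. This leaves independent discrete Gaussian jumps, and each contributes at least
  two thirds of \<open>exp (- K)\<close>, where \<open>K\<close> is a sum over the edges that cross the cut (\<open>gauss_cut_bound\<close>). As \<open>exp (- K)\<close>
  is a product over edges, averaging over the conductances replaces \<open>K\<close> by \<open>\<Sum>e. b e * n e powr a\<close>, with \<open>n e\<close> the number
  of cuts that \<open>e\<close> crosses (\<open>cut_bound\<close>). For \<open>\<alpha> > 2\<close> this is bounded as soon as \<open>l powr a\<close> exceeds
  \<open>\<Sum>r. r powr (1 - \<alpha>) * min r N powr a\<close>. That sum is bounded for \<open>\<alpha> > 2 + q / 2\<close>, of order \<open>ln N\<close> for
  \<open>\<alpha> = 2 + q / 2\<close>, and of order \<open>N powr (2 + q / 2 - \<alpha>)\<close> below; the variance is at least of the order \<open>N / l\<close> of the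
  number of cuts (\<open>variance_lower\<close>). For \<open>\<alpha> \<le> 2\<close> a single cut suffices.
\<close>

section \<open>Height configurations and Gaussian chains\<close>

lemma Omega_outside: "\<phi> \<in> Omega N \<Longrightarrow> k \<notin> {- int N..int N} \<Longrightarrow> \<phi> k = 0"
  by (auto simp: Omega_def)

lemma Omega_add: "\<phi> \<in> Omega N \<Longrightarrow> \<psi> \<in> Omega N \<Longrightarrow> (\<lambda>k. \<phi> k + \<psi> k) \<in> Omega N"
  by (auto simp: Omega_def)

lemma Omega_zero: "(\<lambda>_. 0) \<in> Omega N"
  by (auto simp: Omega_def)

lemma bij_betw_Omega_PiE:
  "bij_betw (\<lambda>\<phi>. restrict \<phi> {- int N..int N}) (Omega N) (PiE {- int N..int N} (\<lambda>_. UNIV))"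
  by (rule bij_betwI[where g = "\<lambda>g k. if k \<in> {- int N..int N} then g k else 0"])
    (auto simp: Omega_def fun_eq_iff PiE_def extensional_def restrict_def)

lemma countable_Omega [simp]: "countable (Omega N)"
proof -
  have "countable (PiE {- int N..int N} (\<lambda>_. UNIV :: int set))"
    by (intro countable_PiE) auto
  then show ?thesis
    using bij_betw_Omega_PiE[of N] countable_image_inj_on[of "\<lambda>\<phi>. restrict \<phi> {- int N..int N}" "Omega N"]
    by (simp add: bij_betw_def)
qed

lemma bij_betw_Omega_translate:
  "\<psi> \<in> Omega N \<Longrightarrow> bij_betw (\<lambda>\<phi> k. \<phi> k + \<psi> k) (Omega N) (Omega N)"
  by (rule bij_betwI[where g = "\<lambda>\<phi> k. \<phi> k - \<psi> k"]) (auto simp: Omega_def fun_eq_iff)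

lemma bij_betw_Omega_uminus: "bij_betw (\<lambda>\<phi> k. - \<phi> k) (Omega N) (Omega N)"
  by (rule bij_betwI[where g = "\<lambda>\<phi> k. - \<phi> k"]) (auto simp: Omega_def fun_eq_iff)

lemma integrable_prod_Omega:
  fixes h :: "int \<Rightarrow> real"
  assumes "h summable_on UNIV" and h0: "\<And>x. 0 \<le> h x"
  shows "integrable (count_space (Omega N)) (\<lambda>\<phi>. \<Prod>i\<in>{- int N..int N}. h (\<phi> i))"
proof -
  let ?B = "{- int N..int N}"
  have "Infinite_Set_Sum.abs_summable_on h UNIV"
    using assms by (simp add: abs_summable_equivalent[symmetric])
  then have "Infinite_Set_Sum.abs_summable_on (\<lambda>g. \<Prod>i\<in>?B. h (g i)) (PiE ?B (\<lambda>_. UNIV))"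
    by (intro abs_summable_on_prod_PiE) auto
  then have "Infinite_Set_Sum.abs_summable_on (\<lambda>\<phi>. \<Prod>i\<in>?B. h (restrict \<phi> ?B i)) (Omega N)"
    using abs_summable_on_reindex_bij_betw[OF bij_betw_Omega_PiE[of N],
        of "\<lambda>g. \<Prod>i\<in>?B. h (g i)"] by simp
  then show ?thesis
    by (simp add: abs_summable_on_def)
qed

text \<open>A polynomial that dominates all second moments of the heights at once, and is still summable
  against every weight below.\<close>
definition moment_bound :: "nat \<Rightarrow> (int \<Rightarrow> int) \<Rightarrow> real"
  where "moment_bound N \<phi> = (\<Prod>i\<in>{- int N..int N}. 1 + (real_of_int (\<phi> i))\<^sup>2)"

lemma moment_bound_ge1: "1 \<le> moment_bound N \<phi>"
  unfolding moment_bound_def by (intro prod_ge_1) auto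

lemma moment_bound_ge:
  assumes "\<phi> \<in> Omega N"
  shows "1 + (real_of_int (\<phi> i))\<^sup>2 \<le> moment_bound N \<phi>"
proof (cases "i \<in> {- int N..int N}")
  case True
  have "(\<Prod>j\<in>{i}. 1 + (real_of_int (\<phi> j))\<^sup>2) \<le> moment_bound N \<phi>"
    unfolding moment_bound_def using True by (intro prod_mono2) auto
  then show ?thesis by simp
next
  case False
  then show ?thesis using Omega_outside[OF assms False] moment_bound_ge1[of N \<phi>] by simp
qed

lemma integrable_moment_bound_exp:
  assumes "0 < c" and "0 < q"
  shows "integrable (count_space (Omega N))
    (\<lambda>\<phi>. moment_bound N \<phi> * exp (- c * (\<Sum>i\<in>{- int N..int N}. real_of_int \<bar>\<phi> i\<bar> powr q)))"
proof -
  have "integrable (count_space (Omega N)) (\<lambda>\<phi>. \<Prod>i\<in>{- int N..int N}.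
      (1 + (real_of_int (\<phi> i))\<^sup>2) * exp (- c * real_of_int \<bar>\<phi> i\<bar> powr q))"
    by (rule integrable_prod_Omega[OF summable_on_int_exp_powr[OF assms]]) auto
  then show ?thesis
    unfolding prod.distrib moment_bound_def
    by (simp add: exp_sum[symmetric] sum_distrib_left sum_negf)
qed

text \<open>The site \<open>N + 1\<close> stands for the whole region outside the box, where the height is \<open>0\<close>. Two sites of
  the box are joined by two parallel edges, one for each order, exactly as in the energy.\<close>
definition edges :: "nat \<Rightarrow> (int \<times> int) set"
  where "edges N = {(i, j). i \<in> {- int N..int N} \<and> j \<in> {- int N..int N + 1} \<and> i \<noteq> j}"

definition grad :: "(int \<Rightarrow> int) \<Rightarrow> int \<times> int \<Rightarrow> real"
  where "grad \<phi> e = real_of_int (\<phi> (fst e) - \<phi> (snd e))"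

lemma finite_edges [simp]: "finite (edges N)"
proof (rule finite_subset)
  show "edges N \<subseteq> {- int N..int N} \<times> {- int N..int N + 1}" by (auto simp: edges_def)
qed auto

lemma boundary_edge: "i \<in> {- int N..int N} \<Longrightarrow> (i, int N + 1) \<in> edges N"
  by (auto simp: edges_def)

lemma grad_boundary: "\<phi> \<in> Omega N \<Longrightarrow> grad \<phi> (i, int N + 1) = real_of_int (\<phi> i)"
  by (simp add: grad_def Omega_def)

lemma sum_boundary_le_sum_edges:
  fixes f :: "int \<times> int \<Rightarrow> real"
  assumes "\<And>e. e \<in> edges N \<Longrightarrow> 0 \<le> f e"
  shows "(\<Sum>i\<in>{- int N..int N}. f (i, int N + 1)) \<le> (\<Sum>e\<in>edges N. f e)"
proof -
  have "(\<Sum>i\<in>{- int N..int N}. f (i, int N + 1)) = sum f ((\<lambda>i. (i, int N + 1)) ` {- int N..int N})"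
    by (subst sum.reindex) (auto simp: inj_on_def)
  also have "\<dots> \<le> sum f (edges N)"
    using assms boundary_edge by (intro sum_mono2) auto
  finally show ?thesis .
qed

lemma grad_sq_le_moment_bound:
  assumes "\<phi> \<in> Omega N"
  shows "(grad \<phi> e)\<^sup>2 \<le> 4 * moment_bound N \<phi>"
proof -
  let ?x = "real_of_int (\<phi> (fst e))" and ?y = "real_of_int (\<phi> (snd e))"
  have "(?x - ?y)\<^sup>2 \<le> 2 * (1 + ?x\<^sup>2) + 2 * (1 + ?y\<^sup>2)"
    using zero_le_power2[of "?x + ?y"] by (simp add: power2_eq_square algebra_simps)
  then show ?thesis
    using moment_bound_ge[OF assms, of "fst e"] moment_bound_ge[OF assms, of "snd e"]
    by (simp add: grad_def)
qed

text \<open>The weight of a Gaussian chain with conductances \<open>\<kappa>\<close> in which edge \<open>e\<close> prefers the increment \<open>s e\<close>.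
  The shifts are arbitrary reals on the edges and need not come from a shift of the heights.\<close>
definition shifted_gauss :: "nat \<Rightarrow> (int \<times> int \<Rightarrow> real) \<Rightarrow> (int \<times> int \<Rightarrow> real) \<Rightarrow> (int \<Rightarrow> int) \<Rightarrow> real"
  where "shifted_gauss N \<kappa> s \<phi> = exp (- (\<Sum>e\<in>edges N. \<kappa> e * (grad \<phi> e - s e)\<^sup>2))"

abbreviation gauss :: "nat \<Rightarrow> (int \<times> int \<Rightarrow> real) \<Rightarrow> (int \<Rightarrow> int) \<Rightarrow> real"
  where "gauss N \<kappa> \<equiv> shifted_gauss N \<kappa> (\<lambda>_. 0)"

text \<open>Only the edges to the exterior are kept; they pin every height to a prescribed real value.\<close>
lemma shifted_gauss_le:
  assumes "\<forall>e\<in>edges N. 0 < \<kappa> e"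
  shows "\<exists>c>0. \<forall>s. \<forall>\<phi>\<in>Omega N. shifted_gauss N \<kappa> s \<phi>
    \<le> exp (- c * (\<Sum>i\<in>{- int N..int N}. (real_of_int (\<phi> i) - s (i, int N + 1))\<^sup>2))"
proof (intro exI conjI allI ballI)
  let ?B = "{- int N..int N}"
  define c where "c = Min ((\<lambda>i. \<kappa> (i, int N + 1)) ` ?B)"
  show "0 < c" unfolding c_def using assms boundary_edge by (subst Min_gr_iff) auto
  have c: "c \<le> \<kappa> (i, int N + 1)" if "i \<in> ?B" for i
    unfolding c_def using that by (intro Min_le) auto
  fix s \<phi> assume \<phi>: "\<phi> \<in> Omega N"
  have "c * (\<Sum>i\<in>?B. (real_of_int (\<phi> i) - s (i, int N + 1))\<^sup>2)
      \<le> (\<Sum>i\<in>?B. \<kappa> (i, int N + 1) * (grad \<phi> (i, int N + 1) - s (i, int N + 1))\<^sup>2)"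
    unfolding sum_distrib_left grad_boundary[OF \<phi>] by (intro sum_mono mult_right_mono c) auto
  also have "\<dots> \<le> (\<Sum>e\<in>edges N. \<kappa> e * (grad \<phi> e - s e)\<^sup>2)"
    using assms by (intro sum_boundary_le_sum_edges mult_nonneg_nonneg) (auto intro: less_imp_le)
  finally show "shifted_gauss N \<kappa> s \<phi>
      \<le> exp (- c * (\<Sum>i\<in>?B. (real_of_int (\<phi> i) - s (i, int N + 1))\<^sup>2))"
    by (simp add: shifted_gauss_def)
qed

lemma integrable_moment_bound_gauss:
  assumes "\<forall>e\<in>edges N. 0 < \<kappa> e"
  shows "integrable (count_space (Omega N)) (\<lambda>\<phi>. moment_bound N \<phi> * gauss N \<kappa> \<phi>)"
proof -
  obtain c where "0 < c" and c: "\<And>s \<phi>. \<phi> \<in> Omega N \<Longrightarrow> shifted_gauss N \<kappa> s \<phi>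
      \<le> exp (- c * (\<Sum>i\<in>{- int N..int N}. (real_of_int (\<phi> i) - s (i, int N + 1))\<^sup>2))"
    using shifted_gauss_le[OF assms] by blast
  show ?thesis
  proof (rule Bochner_Integration.integrable_bound[OF integrable_moment_bound_exp[of c 2 N]])
    show "AE \<phi> in count_space (Omega N). norm (moment_bound N \<phi> * gauss N \<kappa> \<phi>)
        \<le> norm (moment_bound N \<phi> * exp (- c * (\<Sum>i\<in>{- int N..int N}. real_of_int \<bar>\<phi> i\<bar> powr 2)))"
    proof (rule AE_I2, simp)
      fix \<phi> assume "\<phi> \<in> Omega N"
      from c[OF this, of "\<lambda>_. 0"]
      show "\<bar>moment_bound N \<phi> * gauss N \<kappa> \<phi>\<bar>
        \<le> \<bar>moment_bound N \<phi> * exp (- (c * (\<Sum>i = - int N..int N. (real_of_int (\<phi> i))\<^sup>2)))\<bar>"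
        using moment_bound_ge1[of N \<phi>] by (simp add: abs_mult mult_left_mono shifted_gauss_def)
    qed
  qed (use \<open>0 < c\<close> in auto)
qed

lemma integrable_gauss_times:
  assumes "\<forall>e\<in>edges N. 0 < \<kappa> e"
    and "\<And>\<phi>. \<phi> \<in> Omega N \<Longrightarrow> \<bar>f \<phi>\<bar> \<le> C * moment_bound N \<phi>"
  shows "integrable (count_space (Omega N)) (\<lambda>\<phi>. f \<phi> * gauss N \<kappa> \<phi>)"
proof (rule Bochner_Integration.integrable_bound)
  show "integrable (count_space (Omega N)) (\<lambda>\<phi>. C * (moment_bound N \<phi> * gauss N \<kappa> \<phi>))"
    using integrable_moment_bound_gauss[OF assms(1)] by simp
  show "AE \<phi> in count_space (Omega N).
      norm (f \<phi> * gauss N \<kappa> \<phi>) \<le> norm (C * (moment_bound N \<phi> * gauss N \<kappa> \<phi>))"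
  proof (rule AE_I2, simp)
    fix \<phi> assume "\<phi> \<in> Omega N"
    from assms(2)[OF this] have "\<bar>f \<phi>\<bar> \<le> \<bar>C * moment_bound N \<phi>\<bar>" by linarith
    then show "\<bar>f \<phi> * gauss N \<kappa> \<phi>\<bar> \<le> \<bar>C * (moment_bound N \<phi> * gauss N \<kappa> \<phi>)\<bar>"
      by (simp add: abs_mult mult.assoc[symmetric] mult_right_mono shifted_gauss_def)
  qed
qed auto

lemma integrable_gauss:
  assumes "\<forall>e\<in>edges N. 0 < \<kappa> e"
  shows "integrable (count_space (Omega N)) (gauss N \<kappa>)"
proof -
  have "integrable (count_space (Omega N)) (\<lambda>\<phi>. 1 * gauss N \<kappa> \<phi>)"
    by (rule integrable_gauss_times[OF assms, where C = 1]) (use moment_bound_ge1 in auto)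
  then show ?thesis by (simp only: mult_1)
qed

text \<open>Uniformity in \<open>s\<close> holds because the integer parts of the boundary shifts can be absorbed by a
  translation of the heights, after which every site is pinned to a value in \<open>[0, 1)\<close>.\<close>
lemma shifted_gauss_bounded:
  assumes "\<forall>e\<in>edges N. 0 < \<kappa> e"
  obtains B where "\<And>s. integrable (count_space (Omega N)) (shifted_gauss N \<kappa> s)"
    and "\<And>s. (LINT \<phi>|count_space (Omega N). shifted_gauss N \<kappa> s \<phi>) \<le> B"
proof -
  let ?B = "{- int N..int N}"
  obtain c where "0 < c" and c: "\<And>s \<phi>. \<phi> \<in> Omega N \<Longrightarrow> shifted_gauss N \<kappa> s \<phi>
      \<le> exp (- c * (\<Sum>i\<in>?B. (real_of_int (\<phi> i) - s (i, int N + 1))\<^sup>2))"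
    using shifted_gauss_le[OF assms] by blast
  define K where "K = exp (c * real (card ?B))"
  define g where "g = (\<lambda>\<phi>. exp (- (c / 2) * (\<Sum>i\<in>?B. real_of_int \<bar>\<phi> i\<bar> powr 2)))"
  have g: "integrable (count_space (Omega N)) g"
  proof (rule Bochner_Integration.integrable_bound[OF integrable_moment_bound_exp[of "c/2" 2 N]])
    show "AE \<phi> in count_space (Omega N). norm (g \<phi>)
        \<le> norm (moment_bound N \<phi> * exp (- (c / 2) * (\<Sum>i\<in>?B. real_of_int \<bar>\<phi> i\<bar> powr 2)))"
    proof (rule AE_I2)
      fix \<phi>
      have "1 * g \<phi> \<le> moment_bound N \<phi> * g \<phi>"
        using moment_bound_ge1[of N \<phi>] by (intro mult_right_mono) (auto simp: g_def)
      then show "norm (g \<phi>)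
          \<le> norm (moment_bound N \<phi> * exp (- (c / 2) * (\<Sum>i\<in>?B. real_of_int \<bar>\<phi> i\<bar> powr 2)))"
        by (simp add: g_def)
    qed
  qed (use \<open>0 < c\<close> in auto)
  have both: "integrable (count_space (Omega N)) (shifted_gauss N \<kappa> s) \<and>
      (LINT \<phi>|count_space (Omega N). shifted_gauss N \<kappa> s \<phi>)
        \<le> (LINT \<phi>|count_space (Omega N). K * g \<phi>)" for s
  proof -
    define \<psi> where "\<psi> = (\<lambda>i. if i \<in> ?B then \<lfloor>s (i, int N + 1)\<rfloor> else 0)"
    have \<psi>: "\<psi> \<in> Omega N" by (simp add: \<psi>_def Omega_def)
    have le: "shifted_gauss N \<kappa> s (\<lambda>k. \<phi> k + \<psi> k) \<le> K * g \<phi>" if \<phi>: "\<phi> \<in> Omega N" for \<phi>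
    proof -
      have "shifted_gauss N \<kappa> s (\<lambda>k. \<phi> k + \<psi> k)
          \<le> exp (- c * (\<Sum>i\<in>?B. (real_of_int (\<phi> i + \<psi> i) - s (i, int N + 1))\<^sup>2))"
        by (rule c[OF Omega_add[OF \<phi> \<psi>]])
      also have "\<dots> \<le> exp (- c * (\<Sum>i\<in>?B. (real_of_int (\<phi> i))\<^sup>2 / 2 - 1))"
      proof -
        have "(\<Sum>i\<in>?B. (real_of_int (\<phi> i))\<^sup>2 / 2 - 1)
            \<le> (\<Sum>i\<in>?B. (real_of_int (\<phi> i + \<psi> i) - s (i, int N + 1))\<^sup>2)"
        proof (rule sum_mono)
          fix i assume i: "i \<in> ?B"
          define f where "f = s (i, int N + 1) - real_of_int (\<psi> i)"
          have f: "0 \<le> f" "f \<le> 1" using i by (auto simp: f_def \<psi>_def) linarith+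
          have f2: "f\<^sup>2 \<le> 1" using f by (simp add: power_le_one)
          have "(x::real)\<^sup>2 / 2 - 1 \<le> (x - f)\<^sup>2" for x
            using f2 zero_le_power2[of "x - 2 * f"] by (simp add: power2_eq_square algebra_simps)
          from this[of "real_of_int (\<phi> i)"]
          show "(real_of_int (\<phi> i))\<^sup>2 / 2 - 1 \<le> (real_of_int (\<phi> i + \<psi> i) - s (i, int N + 1))\<^sup>2"
            by (simp add: f_def algebra_simps)
        qed
        then show ?thesis using \<open>0 < c\<close> by simp
      qed
      also have "\<dots> = K * g \<phi>"
        by (simp add: K_def g_def exp_add[symmetric] sum_subtractf algebra_simps
            sum_divide_distrib[symmetric])
      finally show ?thesis .
    qed
    have "integrable (count_space (Omega N)) (\<lambda>\<phi>. shifted_gauss N \<kappa> s (\<lambda>k. \<phi> k + \<psi> k))"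
    proof (rule Bochner_Integration.integrable_bound[where f="\<lambda>\<phi>. K * g \<phi>"])
      show "AE \<phi> in count_space (Omega N).
          norm (shifted_gauss N \<kappa> s (\<lambda>k. \<phi> k + \<psi> k)) \<le> norm (K * g \<phi>)"
        using le by (intro AE_I2) (auto simp: shifted_gauss_def intro: order_trans[OF _ abs_ge_self])
    qed (use g in auto)
    moreover have "(LINT \<phi>|count_space (Omega N). shifted_gauss N \<kappa> s (\<lambda>k. \<phi> k + \<psi> k))
        \<le> (LINT \<phi>|count_space (Omega N). K * g \<phi>)"
      using le g calculation by (intro integral_mono) auto
    ultimately show ?thesis
      using integral_bij_count_space[OF bij_betw_Omega_translate[OF \<psi>], of "shifted_gauss N \<kappa> s"]
        integrable_bij_count_space[OF bij_betw_Omega_translate[OF \<psi>], of "shifted_gauss N \<kappa> s"]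
      by simp
  qed
  show thesis
    by (rule that[of "LINT \<phi>|count_space (Omega N). K * g \<phi>"]) (use both in auto)
qed

section \<open>Gaussian domination\<close>

lemma integrable_count_space_product:
  fixes f :: "'a \<Rightarrow> real" and g :: "'b \<Rightarrow> real"
  assumes [simp]: "countable A" "countable B"
    and f: "integrable (count_space A) f" and g: "integrable (count_space B) g"
  shows "integrable (count_space (A \<times> B)) (\<lambda>(x, y). f x * g y)"
    and "(LINT p|count_space (A \<times> B). (case p of (x, y) \<Rightarrow> f x * g y))
      = (LINT x|count_space A. f x) * (LINT y|count_space B. g y)"
proof -
  have "Infinite_Set_Sum.abs_summable_on (\<lambda>(x, y). f x * g y) (A \<times> B)"
    using f g by (subst abs_summable_on_Sigma_iff)
      (auto simp: abs_summable_on_def infsetsum_def abs_mult)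
  then show "integrable (count_space (A \<times> B)) (\<lambda>(x, y). f x * g y)"
    and "(LINT p|count_space (A \<times> B). (case p of (x, y) \<Rightarrow> f x * g y))
      = (LINT x|count_space A. f x) * (LINT y|count_space B. g y)"
    using infsetsum_Times'[of A B "\<lambda>x y. f x * g y"]
    by (auto simp: abs_summable_on_def infsetsum_def)
qed

text \<open>The classes of configurations modulo \<open>2\<close>.\<close>
definition parities :: "nat \<Rightarrow> (int \<Rightarrow> int) set"
  where "parities N = {c \<in> Omega N. \<forall>k. c k \<in> {0, 1}}"

lemma finite_parities [simp]: "finite (parities N)"
proof (rule finite_subset)
  show "parities N \<subseteq> (\<lambda>S k. if k \<in> S then 1 else 0) ` Pow {- int N..int N}"
  proof
    fix c assume "c \<in> parities N"
    then have c: "c k \<in> {0, 1}" "k \<notin> {- int N..int N} \<Longrightarrow> c k = 0" for k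
      by (auto simp: parities_def Omega_def)
    have "c = (\<lambda>k. if k \<in> {k. c k = 1} then 1 else 0)" by (intro ext) (use c(1) in fastforce)
    moreover have "{k. c k = 1} \<in> Pow {- int N..int N}" using c(2) by fastforce
    ultimately show "c \<in> (\<lambda>S k. if k \<in> S then 1 else 0) ` Pow {- int N..int N}" by blast
  qed
qed simp

text \<open>The map \<open>(u, v) \<mapsto> (u + v, u - v)\<close> is a bijection from pairs of configurations onto pairs of
  the same parity: \<open>u + v = 2 x + c\<close> and \<open>u - v = 2 y + c\<close>.\<close>
lemma bij_betw_parities:
  "bij_betw (\<lambda>(c, x, y). ((\<lambda>k. x k + y k + c k), (\<lambda>k. x k - y k)))
    (parities N \<times> Omega N \<times> Omega N) (Omega N \<times> Omega N)"
proof (rule bij_betwI[where g = "\<lambda>(u, v). ((\<lambda>k. (u k + v k) mod 2),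
      (\<lambda>k. (u k + v k) div 2), (\<lambda>k. (u k - v k) div 2))"])
  have *: "x + y + c + (x - y) = c + 2 * x" "x + y + c - (x - y) = c + 2 * y" for x y c :: int
    by simp_all
  have c: "(c::int) \<in> {0, 1} \<Longrightarrow> c mod 2 = c \<and> c div 2 = 0" for c by auto
  show "(\<lambda>(u, v). ((\<lambda>k. (u k + v k) mod 2), (\<lambda>k. (u k + v k) div 2), (\<lambda>k. (u k - v k) div 2)))
      ((\<lambda>(c, x, y). ((\<lambda>k. x k + y k + c k), (\<lambda>k. x k - y k))) p) = p"
    if "p \<in> parities N \<times> Omega N \<times> Omega N" for p
    using that c unfolding parities_def by (auto simp: * fun_eq_iff)
  have "(u + v) div 2 + (u - v) div 2 + (u + v) mod 2 = (u::int)"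
    and "(u + v) div 2 - (u - v) div 2 = (v::int)" for u v
    by presburger+
  then show "(\<lambda>(c, x, y). ((\<lambda>k. x k + y k + c k), (\<lambda>k. x k - y k :: int)))
      ((\<lambda>(u, v). ((\<lambda>k. (u k + v k) mod 2), (\<lambda>k. (u k + v k) div 2), (\<lambda>k. (u k - v k) div 2))) p) = p"
    for p by (cases p) simp
qed (auto simp: parities_def Omega_def)

lemma integrable_parity_class:
  fixes F :: "(int \<Rightarrow> int) \<Rightarrow> real"
  assumes "integrable (count_space (Omega N)) F" and c: "c \<in> Omega N"
  shows "integrable (count_space (Omega N)) (\<lambda>z. F (\<lambda>k. 2 * z k + c k))"
proof -
  let ?g = "\<lambda>z k. 2 * z k + c k"
  have "?g ` Omega N \<subseteq> Omega N" using c by (auto simp: Omega_def)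
  then have "Infinite_Set_Sum.abs_summable_on F (?g ` Omega N)"
    using assms(1) abs_summable_on_subset[of F "Omega N" "?g ` Omega N"]
    unfolding abs_summable_on_def[symmetric] by blast
  moreover have "inj_on ?g (Omega N)" by (auto simp: inj_on_def fun_eq_iff)
  ultimately show ?thesis
    by (simp add: abs_summable_on_reindex_iff[symmetric] abs_summable_on_def[symmetric])
qed

text \<open>If \<open>F = H\<close>, the right-hand side is a sum of squares. This is the source of all positivity used for
  Gaussian chains.\<close>
lemma sum_rotate_pair:
  fixes F H :: "(int \<Rightarrow> int) \<Rightarrow> real"
  assumes F: "integrable (count_space (Omega N)) F" and H: "integrable (count_space (Omega N)) H"
  shows "(LINT p|count_space (Omega N \<times> Omega N).
      (case p of (x, y) \<Rightarrow> F (\<lambda>k. x k + y k) * H (\<lambda>k. x k - y k)))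
    = (\<Sum>c\<in>parities N. (LINT z|count_space (Omega N). F (\<lambda>k. 2 * z k + c k))
        * (LINT z|count_space (Omega N). H (\<lambda>k. 2 * z k + c k)))"
proof -
  let ?O = "Omega N" and ?P = "parities N"
  let ?g = "\<lambda>(c, x, y). ((\<lambda>k. x k + y k + c k), (\<lambda>k. x k - y k :: int))"
  let ?f = "\<lambda>(x, y). F (\<lambda>k. x k + y k) * H (\<lambda>k. x k - y k)"
  let ?h = "\<lambda>c (x, y). F (\<lambda>k. 2 * x k + c k) * H (\<lambda>k. 2 * y k + c k)"
  have fg: "?f (?g (c, p)) = ?h c p" for c p
    by (auto split: prod.split intro!: arg_cong2[where f = "(*)"] arg_cong[where f = F] arg_cong[where f = H])
  have cO: "c \<in> ?O" if "c \<in> ?P" for c using that by (simp add: parities_def)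
  note int = integrable_count_space_product[OF countable_Omega countable_Omega
      integrable_parity_class[OF F cO] integrable_parity_class[OF H cO]]
  have "(LINT p|count_space (?O \<times> ?O). ?f p) = (LINT p|count_space (?P \<times> ?O \<times> ?O). ?f (?g p))"
    by (rule integral_bij_count_space[OF bij_betw_parities, symmetric])
  also have "\<dots> = infsetsum (\<lambda>(c, p). ?h c p) (?P \<times> (?O \<times> ?O))"
    unfolding infsetsum_def by (intro Bochner_Integration.integral_cong) (auto simp: fg[simplified])
  also have "\<dots> = infsetsum (\<lambda>c. infsetsum (?h c) (?O \<times> ?O)) ?P"
  proof (rule infsetsum_Times'[symmetric])
    show "Infinite_Set_Sum.abs_summable_on (\<lambda>(c, p). ?h c p) (?P \<times> (?O \<times> ?O))"
      by (subst abs_summable_on_Sigma_iff)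
        (auto simp: abs_summable_on_def countable_finite int(1) intro!: integrable_count_space)
  qed (auto simp: countable_finite)
  also have "\<dots> = (\<Sum>c\<in>?P. (LINT z|count_space ?O. F (\<lambda>k. 2 * z k + c k))
      * (LINT z|count_space ?O. H (\<lambda>k. 2 * z k + c k)))"
    unfolding infsetsum_finite[OF finite_parities]
    by (intro sum.cong refl) (simp add: infsetsum_def int(2))
  finally show ?thesis .
qed

lemma grad_double: "grad (\<lambda>k. 2 * z k + c k) e = 2 * grad z e + grad c e"
  by (simp add: grad_def)

text \<open>The parallelogram identity on each edge,
  \<open>(x - p)\<^sup>2 + (y - r)\<^sup>2 = ((x + y) - (p + r))\<^sup>2 / 2 + ((x - y) - (p - r))\<^sup>2 / 2\<close>.\<close>
lemma shifted_gauss_mult: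
  assumes pos: "\<forall>e\<in>edges N. 0 < \<kappa> e"
    and \<Theta>_def: "\<And>s. \<Theta> s = (LINT \<phi>|count_space (Omega N). shifted_gauss N \<kappa> s \<phi>)"
    and T_def: "\<And>s. T s = (LINT \<phi>|count_space (Omega N). shifted_gauss N (\<lambda>e. 2 * \<kappa> e) s \<phi>)"
  shows "\<Theta> p * \<Theta> r = (\<Sum>c\<in>parities N. T (\<lambda>e. (p e + r e - grad c e) / 2) * T (\<lambda>e. (p e - r e - grad c e) / 2))"
proof -
  have intg: "integrable (count_space (Omega N)) (shifted_gauss N \<kappa>' s)"
    if "\<forall>e\<in>edges N. 0 < \<kappa>' e" for \<kappa>' s
    using shifted_gauss_bounded[OF that] by metis
  let ?h = "\<lambda>e. \<kappa> e / 2"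
  have hpos: "\<forall>e\<in>edges N. 0 < ?h e" using pos by simp
  have sq: "shifted_gauss N \<kappa> p x * shifted_gauss N \<kappa> r y
      = shifted_gauss N ?h (\<lambda>e. p e + r e) (\<lambda>k. x k + y k) * shifted_gauss N ?h (\<lambda>e. p e - r e) (\<lambda>k. x k - y k)" for x y
    unfolding shifted_gauss_def exp_add[symmetric] minus_add_distrib[symmetric] sum.distrib[symmetric]
    by (intro arg_cong[where f = exp] arg_cong[where f = uminus] sum.cong refl)
      (simp add: grad_def power2_eq_square algebra_simps)
  have half: "shifted_gauss N ?h s (\<lambda>k. 2 * z k + c k)
      = shifted_gauss N (\<lambda>e. 2 * \<kappa> e) (\<lambda>e. (s e - grad c e) / 2) z" for s c z
    unfolding shifted_gauss_def grad_double
    by (intro arg_cong[where f = exp] arg_cong[where f = uminus] sum.cong refl)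
      (simp add: power2_eq_square field_simps)
  have "\<Theta> p * \<Theta> r = (LINT q|count_space (Omega N \<times> Omega N).
      (case q of (x, y) \<Rightarrow> shifted_gauss N \<kappa> p x * shifted_gauss N \<kappa> r y))"
    unfolding \<Theta>_def by (rule integrable_count_space_product(2)[symmetric]) (auto intro: intg[OF pos])
  also have "\<dots> = (\<Sum>c\<in>parities N. T (\<lambda>e. (p e + r e - grad c e) / 2) * T (\<lambda>e. (p e - r e - grad c e) / 2))"
    unfolding sq by (subst sum_rotate_pair[OF intg[OF hpos] intg[OF hpos]]) (simp add: half T_def)
  finally show ?thesis .
qed

lemma shifted_gauss_pos:
  assumes "\<forall>e\<in>edges N. 0 < \<kappa> e"
  shows "0 < (LINT \<phi>|count_space (Omega N). gauss N \<kappa> \<phi>)"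
proof -
  have "0 \<le> (LINT \<phi>|count_space (Omega N). gauss N \<kappa> \<phi>)"
    by (rule integral_nonneg_AE) (auto simp: shifted_gauss_def)
  moreover have "(LINT \<phi>|count_space (Omega N). gauss N \<kappa> \<phi>) \<noteq> 0"
  proof
    assume "(LINT \<phi>|count_space (Omega N). gauss N \<kappa> \<phi>) = 0"
    then have "AE \<phi> in count_space (Omega N). gauss N \<kappa> \<phi> = 0"
      by (subst (asm) integral_nonneg_eq_0_iff_AE[OF integrable_gauss[OF assms]])
        (auto simp: shifted_gauss_def)
    then have "gauss N \<kappa> (\<lambda>_. 0) = 0" using Omega_zero by (auto simp only: AE_count_space)
    then show False by (simp add: shifted_gauss_def)
  qed
  ultimately show ?thesis by simp
qed

text \<open>Gaussian domination. Applied to \<open>(s, s)\<close>, the product formula writes \<open>\<Theta>(s)\<^sup>2\<close> as a scalar product of two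
  vectors whose squared norms are \<open>\<Theta>(2 s) \<Theta>(0)\<close> and \<open>\<Theta>(0)\<^sup>2\<close>. So the ratio \<open>r = \<Theta> / \<Theta>(0)\<close> satisfies
  \<open>r(s)\<^sup>4 \<le> r(2 s)\<close>, and a bounded function with this property cannot exceed \<open>1\<close>.\<close>
theorem shifted_gauss_le_gauss:
  assumes pos: "\<forall>e\<in>edges N. 0 < \<kappa> e"
  shows "(LINT \<phi>|count_space (Omega N). shifted_gauss N \<kappa> s \<phi>)
    \<le> (LINT \<phi>|count_space (Omega N). gauss N \<kappa> \<phi>)"
proof -
  define \<Theta> where "\<Theta> = (\<lambda>s. LINT \<phi>|count_space (Omega N). shifted_gauss N \<kappa> s \<phi>)"
  define T where "T = (\<lambda>s. LINT \<phi>|count_space (Omega N). shifted_gauss N (\<lambda>e. 2 * \<kappa> e) s \<phi>)"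
  define r where "r = (\<lambda>s. \<Theta> s / \<Theta> (\<lambda>_. 0))"
  have \<Theta>0: "0 < \<Theta> (\<lambda>_. 0)" unfolding \<Theta>_def by (rule shifted_gauss_pos[OF pos])
  have \<Theta>_nonneg: "0 \<le> \<Theta> s" for s
    unfolding \<Theta>_def by (rule integral_nonneg_AE) (auto simp: shifted_gauss_def)
  have r_nonneg: "0 \<le> r s" for s using \<Theta>_nonneg \<Theta>0 by (simp add: r_def)
  have mult: "\<Theta> p * \<Theta> q = (\<Sum>c\<in>parities N. T (\<lambda>e. (p e + q e - grad c e) / 2) * T (\<lambda>e. (p e - q e - grad c e) / 2))" for p q
    by (rule shifted_gauss_mult[OF pos]) (simp_all add: \<Theta>_def T_def)
  have double: "r s ^ 4 \<le> r (\<lambda>e. 2 * s e)" for s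
  proof -
    have "(\<Theta> s * \<Theta> s)\<^sup>2 = (\<Sum>c\<in>parities N. T (\<lambda>e. s e - grad c e / 2) * T (\<lambda>e. - grad c e / 2))\<^sup>2"
      unfolding mult[of s s] by (simp add: diff_divide_distrib)
    also have "\<dots> \<le> (\<Sum>c\<in>parities N. (T (\<lambda>e. s e - grad c e / 2))\<^sup>2)
        * (\<Sum>c\<in>parities N. (T (\<lambda>e. - grad c e / 2))\<^sup>2)"
      by (rule Cauchy_Schwarz_ineq_sum)
    also have "(\<Sum>c\<in>parities N. (T (\<lambda>e. s e - grad c e / 2))\<^sup>2) = \<Theta> (\<lambda>e. 2 * s e) * \<Theta> (\<lambda>_. 0)"
      unfolding mult[of "\<lambda>e. 2 * s e" "\<lambda>_. 0"] by (simp add: diff_divide_distrib power2_eq_square)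
    also have "(\<Sum>c\<in>parities N. (T (\<lambda>e. - grad c e / 2))\<^sup>2) = \<Theta> (\<lambda>_. 0) * \<Theta> (\<lambda>_. 0)"
      unfolding mult[of "\<lambda>_. 0" "\<lambda>_. 0"] by (simp add: power2_eq_square)
    finally have "\<Theta> s ^ 4 \<le> \<Theta> (\<lambda>e. 2 * s e) * \<Theta> (\<lambda>_. 0) ^ 3"
      by (simp add: power2_eq_square power3_eq_cube power4_eq_xxxx mult_ac)
    then show ?thesis using \<Theta>0 unfolding r_def
      by (simp add: power_divide divide_simps power3_eq_cube power4_eq_xxxx mult_ac)
  qed
  have iter: "r s ^ (4 ^ k) \<le> r (\<lambda>e. 2 ^ k * s e)" for k
  proof (induction k)
    case (Suc k)
    have "r s ^ (4 ^ Suc k) = (r s ^ (4 ^ k)) ^ 4" by (simp add: power_mult[symmetric] mult.commute)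
    also have "\<dots> \<le> r (\<lambda>e. 2 ^ k * s e) ^ 4" using Suc r_nonneg by (intro power_mono) auto
    also have "\<dots> \<le> r (\<lambda>e. 2 ^ Suc k * s e)" using double[of "\<lambda>e. 2 ^ k * s e"] by (simp add: mult.assoc)
    finally show ?case .
  qed simp
  obtain B where B: "\<Theta> s \<le> B" for s
    using shifted_gauss_bounded[OF pos] unfolding \<Theta>_def by metis
  have "r s \<le> 1"
  proof (rule ccontr)
    assume "\<not> r s \<le> 1"
    then have r1: "1 < r s" by simp
    obtain k where k: "B / \<Theta> (\<lambda>_. 0) < r s ^ k" using real_arch_pow[OF r1] by blast
    have "k \<le> 4 ^ k" by (rule less_imp_le[OF power_gt_expt]) simp
    then have "r s ^ k \<le> r s ^ (4 ^ k)" using r1 by (intro power_increasing) auto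
    also have "\<dots> \<le> B / \<Theta> (\<lambda>_. 0)"
      using order_trans[OF iter, of k "B / \<Theta> (\<lambda>_. 0)"] B \<Theta>0 by (simp add: r_def divide_right_mono)
    finally show False using k by simp
  qed
  then show ?thesis using \<Theta>0 by (simp add: r_def \<Theta>_def)
qed

lemma linear_grad_sq_le_moment_bound:
  assumes "\<phi> \<in> Omega N"
  shows "\<bar>(\<Sum>e\<in>edges N. \<theta> e * grad \<phi> e)\<^sup>2\<bar> \<le> (\<Sum>e\<in>edges N. (\<theta> e)\<^sup>2) * (4 * real (card (edges N))) * moment_bound N \<phi>"
proof -
  have "(\<Sum>e\<in>edges N. (grad \<phi> e)\<^sup>2) \<le> (\<Sum>e\<in>edges N. 4 * moment_bound N \<phi>)"
    by (intro sum_mono grad_sq_le_moment_bound[OF assms])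
  then have "(\<Sum>e\<in>edges N. (\<theta> e)\<^sup>2) * (\<Sum>e\<in>edges N. (grad \<phi> e)\<^sup>2)
      \<le> (\<Sum>e\<in>edges N. (\<theta> e)\<^sup>2) * (4 * real (card (edges N)) * moment_bound N \<phi>)"
    by (intro mult_left_mono sum_nonneg) (auto simp: mult_ac)
  then show ?thesis
    using Cauchy_Schwarz_ineq_sum[of \<theta> "grad \<phi>" "edges N"] by (simp add: mult.assoc)
qed

lemma exp_plus_exp_minus_ge: "2 + y\<^sup>2 \<le> exp y + exp (- y)" for y :: real
proof -
  \<comment> \<open>With \<open>h = y / 2\<close> the claim is \<open>exp h - exp (- h) \<ge> 2 h\<close>, and \<open>t - 1 / t\<close> is increasing in \<open>t\<close>.\<close>
  have nonneg: "2 + y\<^sup>2 \<le> exp y + exp (- y)" if "0 \<le> y" for y :: real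
  proof -
    define h where "h = y / 2"
    define t where "t = 1 + h + h\<^sup>2 / 2"
    have h: "0 \<le> h" using that by (simp add: h_def)
    then have t: "0 < t" by (simp add: t_def add_pos_nonneg)
    have "t * t - 2 * h * t - 1 = h ^ 4 / 4"
      by (simp add: t_def power2_eq_square power4_eq_xxxx field_simps)
    moreover have "0 \<le> h ^ 4 / 4" using h by simp
    ultimately have "2 * h * t + 1 \<le> t * t" by linarith
    then have "2 * h \<le> t - 1 / t" using t by (simp add: field_simps)
    also have "t \<le> exp h" unfolding t_def using h by (rule exp_lower_Taylor_quadratic)
    then have "t - 1 / t \<le> exp h - exp (- h)"
      using t by (intro diff_mono) (auto simp: exp_minus divide_inverse)
    finally have "(2 * h)\<^sup>2 \<le> (exp h - exp (- h))\<^sup>2" using h by (intro power_mono) auto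
    also have "\<dots> = exp y + exp (- y) - 2"
      by (simp add: h_def power2_diff exp_double[symmetric] exp_add[symmetric])
    finally show ?thesis by (simp add: h_def)
  qed
  show ?thesis using nonneg[of y] nonneg[of "- y"] by (cases "0 \<le> y") auto
qed

text \<open>The second-order form of Gaussian domination, with shift \<open>t * \<theta> e / \<kappa> e\<close> and \<open>t\<close> tending to \<open>0\<close>. The right-hand
  side is half the energy dissipated by the flow \<open>\<theta>\<close> in the resistor network with conductances \<open>\<kappa>\<close>, so any
  flow gives an upper bound, as in the easy half of the principle of Thomson.\<close>
theorem gauss_second_moment:
  assumes pos: "\<forall>e\<in>edges N. 0 < \<kappa> e"
  shows "(LINT \<phi>|count_space (Omega N). (\<Sum>e\<in>edges N. \<theta> e * grad \<phi> e)\<^sup>2 * gauss N \<kappa> \<phi>)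
    \<le> (\<Sum>e\<in>edges N. (\<theta> e)\<^sup>2 / \<kappa> e) / 2 * (LINT \<phi>|count_space (Omega N). gauss N \<kappa> \<phi>)"
proof -
  let ?M = "count_space (Omega N)"
  define X where "X = (\<lambda>\<phi>. \<Sum>e\<in>edges N. \<theta> e * grad \<phi> e)"
  define V where "V = (\<Sum>e\<in>edges N. (\<theta> e)\<^sup>2 / \<kappa> e)"
  define I where "I = (LINT \<phi>|?M. (X \<phi>)\<^sup>2 * gauss N \<kappa> \<phi>)"
  define Z where "Z = (LINT \<phi>|?M. gauss N \<kappa> \<phi>)"
  have intg: "integrable ?M (shifted_gauss N \<kappa> s)" for s
    using shifted_gauss_bounded[OF pos] by metis
  have intX: "integrable ?M (\<lambda>\<phi>. (X \<phi>)\<^sup>2 * gauss N \<kappa> \<phi>)"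
    unfolding X_def using linear_grad_sq_le_moment_bound by (rule integrable_gauss_times[OF pos])
  have shift: "shifted_gauss N \<kappa> (\<lambda>e. t * \<theta> e / \<kappa> e) \<phi> = exp (- t\<^sup>2 * V) * (exp (2 * t * X \<phi>) * gauss N \<kappa> \<phi>)" for t \<phi>
  proof -
    have "- (\<Sum>e\<in>edges N. \<kappa> e * (grad \<phi> e - t * \<theta> e / \<kappa> e)\<^sup>2)
        = - t\<^sup>2 * V + 2 * t * X \<phi> - (\<Sum>e\<in>edges N. \<kappa> e * (grad \<phi> e)\<^sup>2)"
      unfolding V_def X_def sum_distrib_left sum_negf[symmetric] sum.distrib[symmetric] sum_subtractf[symmetric]
    proof (intro sum.cong refl)
      fix e assume "e \<in> edges N"
      then have "\<kappa> e \<noteq> 0" using pos by force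
      then show "- (\<kappa> e * (grad \<phi> e - t * \<theta> e / \<kappa> e)\<^sup>2)
          = - t\<^sup>2 * ((\<theta> e)\<^sup>2 / \<kappa> e) + 2 * t * (\<theta> e * grad \<phi> e) - \<kappa> e * (grad \<phi> e)\<^sup>2"
        by (simp add: power2_eq_square field_simps)
    qed
    then show ?thesis by (simp add: shifted_gauss_def exp_add exp_diff exp_minus divide_inverse)
  qed
  have le: "2 * I \<le> (exp (t\<^sup>2 * V) - 1) / t\<^sup>2 * Z" if t: "0 < t" for t
  proof -
    have int1: "integrable ?M (\<lambda>\<phi>. exp (2 * u * X \<phi>) * gauss N \<kappa> \<phi>)" for u
      using intg[of "\<lambda>e. u * \<theta> e / \<kappa> e"] unfolding shift by simp
    have le1: "(LINT \<phi>|?M. exp (2 * u * X \<phi>) * gauss N \<kappa> \<phi>) \<le> exp (u\<^sup>2 * V) * Z" for u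
      using shifted_gauss_le_gauss[OF pos, of "\<lambda>e. u * \<theta> e / \<kappa> e"] unfolding shift Z_def
      by (simp add: exp_minus field_simps)
    note ch = exp_plus_exp_minus_ge
    have "2 * Z + 4 * t\<^sup>2 * I = (LINT \<phi>|?M. 2 * gauss N \<kappa> \<phi> + 4 * t\<^sup>2 * ((X \<phi>)\<^sup>2 * gauss N \<kappa> \<phi>))"
      unfolding Z_def I_def by (subst Bochner_Integration.integral_add) (use intX intg in auto)
    also have "\<dots> \<le> (LINT \<phi>|?M. exp (2 * t * X \<phi>) * gauss N \<kappa> \<phi> + exp (2 * (- t) * X \<phi>) * gauss N \<kappa> \<phi>)"
    proof (rule integral_mono)
      show "integrable ?M (\<lambda>\<phi>. exp (2 * t * X \<phi>) * gauss N \<kappa> \<phi> + exp (2 * (- t) * X \<phi>) * gauss N \<kappa> \<phi>)"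
        by (intro Bochner_Integration.integrable_add int1)
      fix \<phi>
      have "(2 + (2 * t * X \<phi>)\<^sup>2) * gauss N \<kappa> \<phi> \<le> (exp (2 * t * X \<phi>) + exp (- (2 * t * X \<phi>))) * gauss N \<kappa> \<phi>"
        by (intro mult_right_mono ch) (simp add: shifted_gauss_def)
      then show "2 * gauss N \<kappa> \<phi> + 4 * t\<^sup>2 * ((X \<phi>)\<^sup>2 * gauss N \<kappa> \<phi>)
          \<le> exp (2 * t * X \<phi>) * gauss N \<kappa> \<phi> + exp (2 * (- t) * X \<phi>) * gauss N \<kappa> \<phi>"
        by (simp add: power_mult_distrib algebra_simps)
    qed (use intX intg in auto)
    also have "\<dots> = (LINT \<phi>|?M. exp (2 * t * X \<phi>) * gauss N \<kappa> \<phi>) + (LINT \<phi>|?M. exp (2 * (- t) * X \<phi>) * gauss N \<kappa> \<phi>)"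
      by (rule Bochner_Integration.integral_add[OF int1 int1])
    also have "\<dots> \<le> 2 * (exp (t\<^sup>2 * V) * Z)"
      using le1[of t] le1[of "- t"] by simp
    finally show ?thesis using t by (simp add: field_simps)
  qed
  have "((\<lambda>t::real. (exp (t\<^sup>2 * V) - 1) / t\<^sup>2 * Z) \<longlongrightarrow> V * Z) (at_right 0)"
    by (intro tendsto_mult tendsto_const) real_asymp
  moreover have "\<forall>\<^sub>F t in at_right 0. 2 * I \<le> (exp (t\<^sup>2 * V) - 1) / t\<^sup>2 * Z"
    by (rule eventually_mono[OF eventually_at_right_less]) (rule le)
  ultimately have "2 * I \<le> V * Z"
    by (rule tendsto_lowerbound) simp
  then show ?thesis by (simp add: I_def X_def V_def Z_def)
qed

section \<open>A correlation inequality of Ginibre type\<close>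

definition additive_fun :: "((int \<Rightarrow> int) \<Rightarrow> real) \<Rightarrow> bool"
  where "additive_fun L \<longleftrightarrow> (\<forall>\<phi> \<psi>. L (\<lambda>k. \<phi> k + \<psi> k) = L \<phi> + L \<psi>)"

lemma additive_fun_lincomb:
  "additive_fun L \<Longrightarrow> additive_fun L' \<Longrightarrow> additive_fun (\<lambda>\<phi>. a * L \<phi> + b * L' \<phi>)"
  by (simp add: additive_fun_def algebra_simps)

lemma additive_fun_diff: "additive_fun L \<Longrightarrow> L (\<lambda>k. \<phi> k - \<psi> k) = L \<phi> - L \<psi>"
proof -
  assume "additive_fun L"
  from this[unfolded additive_fun_def, rule_format, of "\<lambda>k. \<phi> k - \<psi> k" \<psi>]
  show ?thesis by simp
qed

text \<open>Limits of convex combinations of characters. They include Gaussians of linear functionals and indicators of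
  their kernels; the inductive form makes closure under products a plain induction.\<close>
inductive pd :: "((int \<Rightarrow> int) \<Rightarrow> real) \<Rightarrow> bool" where
  pd_cos: "additive_fun L \<Longrightarrow> pd (\<lambda>\<phi>. cos (L \<phi>))"
| pd_mid: "pd f \<Longrightarrow> pd g \<Longrightarrow> pd (\<lambda>\<phi>. (f \<phi> + g \<phi>) / 2)"
| pd_lim: "(\<And>n. pd (F n)) \<Longrightarrow> (\<And>\<phi>. (\<lambda>n. F n \<phi>) \<longlonglongrightarrow> g \<phi>) \<Longrightarrow> pd g"

lemma pd_mult_cos:
  assumes "pd g" and L: "additive_fun L"
  shows "pd (\<lambda>\<phi>. cos (L \<phi>) * g \<phi>)"
  using assms(1)
proof induction
  case (pd_cos L')
  have "pd (\<lambda>\<phi>. (cos (1 * L \<phi> + (- 1) * L' \<phi>) + cos (1 * L \<phi> + 1 * L' \<phi>)) / 2)"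
    using pd_cos L by (intro pd.pd_mid pd.pd_cos additive_fun_lincomb)
  then show ?case by (simp add: cos_times_cos)
next
  case (pd_mid f g)
  show ?case using pd.pd_mid[OF pd_mid.IH] by (simp add: algebra_simps)
next
  case (pd_lim F g)
  show ?case by (rule pd.pd_lim[where F = "\<lambda>n \<phi>. cos (L \<phi>) * F n \<phi>", OF pd_lim.IH]) (intro tendsto_intros pd_lim)
qed

lemma pd_mult: "pd f \<Longrightarrow> pd g \<Longrightarrow> pd (\<lambda>\<phi>. f \<phi> * g \<phi>)"
proof (induction rule: pd.induct)
  case (pd_cos L)
  then show ?case by (rule pd_mult_cos[rotated])
next
  case (pd_mid f f')
  show ?case using pd.pd_mid[OF pd_mid.IH(1,2)[OF pd_mid.prems]] by (simp add: algebra_simps)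
next
  case (pd_lim F f)
  show ?case
    by (rule pd.pd_lim[where F = "\<lambda>n \<phi>. F n \<phi> * g \<phi>", OF pd_lim.IH[OF pd_lim.prems]]) (intro tendsto_intros pd_lim)
qed

lemma pd_one: "pd (\<lambda>_. 1)"
  using pd_cos[of "\<lambda>_. 0"] by (simp add: additive_fun_def)

lemma pd_power: "pd f \<Longrightarrow> pd (\<lambda>\<phi>. f \<phi> ^ n)"
  by (induction n) (simp_all add: pd_one pd_mult)

lemma pd_prod: "(\<And>i. i \<in> I \<Longrightarrow> pd (f i)) \<Longrightarrow> pd (\<lambda>\<phi>. \<Prod>i\<in>I. f i \<phi>)"
  by (induction I rule: infinite_finite_induct) (simp_all add: pd_one pd_mult)

lemma abs_pd_le_1: "pd f \<Longrightarrow> \<bar>f \<phi>\<bar> \<le> 1"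
proof (induction rule: pd.induct)
  case (pd_lim F g)
  then show ?case
    by (intro LIMSEQ_le_const2[OF tendsto_rabs[OF pd_lim(2)]]) auto
qed auto

text \<open>The central limit theorem for a fair sign: \<open>cos (c / \<surd>n) ^ n\<close> tends to \<open>exp (- c\<^sup>2 / 2)\<close>.\<close>
lemma pd_gauss:
  assumes "additive_fun L" and "0 \<le> a"
  shows "pd (\<lambda>\<phi>. exp (- a * (L \<phi>)\<^sup>2))"
proof (rule pd_lim)
  show "pd (\<lambda>\<phi>. cos (sqrt (2 * a / real n) * L \<phi>) ^ n)" for n
    using assms(1) by (intro pd_power pd_cos) (simp add: additive_fun_def algebra_simps)
  show "(\<lambda>n. cos (sqrt (2 * a / real n) * L \<phi>) ^ n) \<longlonglongrightarrow> exp (- a * (L \<phi>)\<^sup>2)" for \<phi>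
  proof -
    define c where "c = sqrt (2 * a) * L \<phi>"
    have "(\<lambda>n::nat. cos (c / sqrt n) ^ n) \<longlonglongrightarrow> exp (- (c * c / 2))"
      by real_asymp
    moreover have "c * c / 2 = a * (L \<phi>)\<^sup>2"
      using assms(2) by (simp add: c_def power2_eq_square)
    ultimately show ?thesis using assms(2)
      by (simp add: c_def real_sqrt_divide power_mult_distrib mult.commute)
  qed
qed

text \<open>An infinitely strong Gaussian coupling.\<close>
lemma pd_kernel:
  assumes "additive_fun L"
  shows "pd (\<lambda>\<phi>. of_bool (L \<phi> = 0))"
proof (rule pd_lim)
  show "pd (\<lambda>\<phi>. exp (- real n * (L \<phi>)\<^sup>2))" for n
    by (rule pd_gauss[OF assms]) simp
  show "(\<lambda>n. exp (- real n * (L \<phi>)\<^sup>2)) \<longlonglongrightarrow> of_bool (L \<phi> = 0)" for \<phi>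
  proof (cases "L \<phi> = 0")
    case False
    define c where "c = (L \<phi>)\<^sup>2"
    have "0 < c" using False by (simp add: c_def)
    then have "(\<lambda>n. exp (- (real n * c))) \<longlonglongrightarrow> 0" by real_asymp
    then show ?thesis using False by (simp add: c_def)
  qed simp
qed

lemma gauss_rotate:
  "gauss N \<kappa> x * gauss N \<kappa> y
    = gauss N (\<lambda>e. \<kappa> e / 2) (\<lambda>k. x k + y k) * gauss N (\<lambda>e. \<kappa> e / 2) (\<lambda>k. x k - y k)"
  unfolding shifted_gauss_def exp_add[symmetric] minus_add_distrib[symmetric] sum.distrib[symmetric]
  by (intro arg_cong[where f = exp] arg_cong[where f = uminus] sum.cong refl)
    (simp add: grad_def power2_eq_square algebra_simps)

lemma height_sq_le_moment_bound:
  "\<phi> \<in> Omega N \<Longrightarrow> (real_of_int (\<phi> k))\<^sup>2 \<le> moment_bound N \<phi>"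
  using moment_bound_ge[of \<phi> N k] by simp

lemma integrable_pd_gauss:
  assumes pos: "\<forall>e\<in>edges N. 0 < \<kappa> e" and G: "\<And>\<phi>. \<bar>G \<phi>\<bar> \<le> 1"
  shows "integrable (count_space (Omega N)) (\<lambda>\<phi>. G \<phi> * gauss N \<kappa> \<phi>)"
    and "integrable (count_space (Omega N)) (\<lambda>\<phi>. (real_of_int (\<phi> 0))\<^sup>2 * G \<phi> * gauss N \<kappa> \<phi>)"
proof -
  show "integrable (count_space (Omega N)) (\<lambda>\<phi>. G \<phi> * gauss N \<kappa> \<phi>)"
    using G moment_bound_ge1 order_trans
    by (intro integrable_gauss_times[OF pos, where C = 1]) fastforce
  show "integrable (count_space (Omega N)) (\<lambda>\<phi>. (real_of_int (\<phi> 0))\<^sup>2 * G \<phi> * gauss N \<kappa> \<phi>)"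
  proof (rule integrable_gauss_times[OF pos, where C = 1])
    fix \<phi> assume "\<phi> \<in> Omega N"
    have "\<bar>(real_of_int (\<phi> 0))\<^sup>2 * G \<phi>\<bar> \<le> (real_of_int (\<phi> 0))\<^sup>2 * 1"
      unfolding abs_mult using G[of \<phi>] by (intro mult_mono) auto
    then show "\<bar>(real_of_int (\<phi> 0))\<^sup>2 * G \<phi>\<bar> \<le> 1 * moment_bound N \<phi>"
      using height_sq_le_moment_bound[OF \<open>\<phi> \<in> Omega N\<close>, of 0] by simp
  qed
qed

text \<open>Ginibre's duplication. For two independent copies \<open>x\<close>, \<open>y\<close>, both \<open>x(0)\<^sup>2 - y(0)\<^sup>2\<close> and
  \<open>cos (L x) - cos (L y)\<close> factor in the variables \<open>x + y\<close> and \<open>x - y\<close>, with the same function of each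
  up to the factor \<open>- 2\<close>. The covariance is therefore minus a sum of squares.\<close>
lemma gauss_correlation_cos:
  assumes pos: "\<forall>e\<in>edges N. 0 < \<kappa> e" and L: "additive_fun L"
  shows "(LINT \<phi>|count_space (Omega N). (real_of_int (\<phi> 0))\<^sup>2 * cos (L \<phi>) * gauss N \<kappa> \<phi>)
      * (LINT \<phi>|count_space (Omega N). gauss N \<kappa> \<phi>)
    \<le> (LINT \<phi>|count_space (Omega N). (real_of_int (\<phi> 0))\<^sup>2 * gauss N \<kappa> \<phi>)
      * (LINT \<phi>|count_space (Omega N). cos (L \<phi>) * gauss N \<kappa> \<phi>)"
proof -
  let ?M = "count_space (Omega N)" and ?M2 = "count_space (Omega N \<times> Omega N)"
  let ?\<rho> = "gauss N \<kappa>" and ?t = "\<lambda>\<phi>. real_of_int (\<phi> 0)"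
  define A where "A = (\<lambda>\<phi>. (?t \<phi>)\<^sup>2 * cos (L \<phi>) * ?\<rho> \<phi>)"
  define I where "I = (\<lambda>\<phi>. (?t \<phi>)\<^sup>2 * ?\<rho> \<phi>)"
  define C where "C = (\<lambda>\<phi>. cos (L \<phi>) * ?\<rho> \<phi>)"
  define a where "a = (\<lambda>u. ?t u * sin (L u / 2) * gauss N (\<lambda>e. \<kappa> e / 2) u)"
  have intA: "integrable ?M A" and intC: "integrable ?M C"
    unfolding A_def C_def by (rule integrable_pd_gauss[OF pos]; simp)+
  have intI: "integrable ?M I"
    using integrable_pd_gauss(2)[OF pos, of "\<lambda>_. 1"] by (simp add: I_def)
  have int\<rho>: "integrable ?M ?\<rho>" by (rule integrable_gauss[OF pos])
  have inta: "integrable ?M a"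
    unfolding a_def
  proof (rule integrable_gauss_times[where C = 1])
    fix \<phi> assume "\<phi> \<in> Omega N"
    have "\<bar>?t \<phi> * sin (L \<phi> / 2)\<bar> \<le> \<bar>?t \<phi>\<bar> * 1"
      unfolding abs_mult by (intro mult_mono) auto
    also have "\<bar>?t \<phi>\<bar> \<le> 1 + (?t \<phi>)\<^sup>2"
      using zero_le_power2[of "\<bar>?t \<phi>\<bar> - 1"] by (simp add: power2_diff)
    finally show "\<bar>?t \<phi> * sin (L \<phi> / 2)\<bar> \<le> 1 * moment_bound N \<phi>"
      using moment_bound_ge[OF \<open>\<phi> \<in> Omega N\<close>, of 0] by simp
  qed (use pos in auto)
  have split: "A x * ?\<rho> y - I x * C y - (C x * I y - ?\<rho> x * A y)
      = - 2 * (a (\<lambda>k. x k + y k) * a (\<lambda>k. x k - y k))" for x y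
  proof -
    have "A x * ?\<rho> y - I x * C y - (C x * I y - ?\<rho> x * A y)
        = (?\<rho> x * ?\<rho> y) * (((?t x)\<^sup>2 - (?t y)\<^sup>2) * (cos (L x) - cos (L y)))"
      by (simp add: A_def I_def C_def algebra_simps)
    also have "(?t x)\<^sup>2 - (?t y)\<^sup>2 = ?t (\<lambda>k. x k + y k) * ?t (\<lambda>k. x k - y k)"
      by (simp add: power2_eq_square algebra_simps)
    also have "cos (L x) - cos (L y)
        = - 2 * (sin (L (\<lambda>k. x k + y k) / 2) * sin (L (\<lambda>k. x k - y k) / 2))"
    proof -
      have "sin ((L y - L x) / 2) = - sin ((L x - L y) / 2)"
        using sin_minus[of "(L x - L y) / 2"] by (simp add: minus_divide_left)
      then show ?thesis using L additive_fun_diff[OF L, of x y]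
        by (simp add: cos_diff_cos additive_fun_def)
    qed
    finally show ?thesis unfolding gauss_rotate[of N \<kappa> x y] a_def by (simp add: mult_ac)
  qed
  note prod = integrable_count_space_product[OF countable_Omega countable_Omega]
  have "2 * ((LINT x|?M. A x) * (LINT x|?M. ?\<rho> x) - (LINT x|?M. I x) * (LINT x|?M. C x))
      = (LINT p|?M2. (case p of (x, y) \<Rightarrow> A x * ?\<rho> y)) - (LINT p|?M2. (case p of (x, y) \<Rightarrow> I x * C y))
        - ((LINT p|?M2. (case p of (x, y) \<Rightarrow> C x * I y)) - (LINT p|?M2. (case p of (x, y) \<Rightarrow> ?\<rho> x * A y)))"
    by (simp add: prod(2) intA intI intC int\<rho>)
  also have "\<dots> = (LINT p|?M2. (case p of (x, y) \<Rightarrow> A x * ?\<rho> y) - (case p of (x, y) \<Rightarrow> I x * C y)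
        - ((case p of (x, y) \<Rightarrow> C x * I y) - (case p of (x, y) \<Rightarrow> ?\<rho> x * A y)))"
    by (simp only: Bochner_Integration.integral_diff Bochner_Integration.integrable_diff
        prod(1)[OF intA int\<rho>] prod(1)[OF intI intC] prod(1)[OF intC intI] prod(1)[OF int\<rho> intA])
  also have "\<dots> = (LINT p|?M2. - 2 * (case p of (x, y) \<Rightarrow> a (\<lambda>k. x k + y k) * a (\<lambda>k. x k - y k)))"
    by (intro Bochner_Integration.integral_cong refl) (auto simp: split)
  also have "\<dots> = - 2 * (\<Sum>c\<in>parities N. (LINT z|?M. a (\<lambda>k. 2 * z k + c k)) * (LINT z|?M. a (\<lambda>k. 2 * z k + c k)))"
    by (subst integral_mult_right_zero) (simp only: sum_rotate_pair[OF inta inta])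
  also have "\<dots> \<le> 0"
    by (simp add: sum_nonneg)
  finally show ?thesis by (simp add: A_def I_def C_def)
qed

text \<open>The squared height at the origin and a positive definite function are negatively correlated: extra
  couplings and constraints only reduce fluctuations.\<close>
theorem gauss_correlation:
  assumes pos: "\<forall>e\<in>edges N. 0 < \<kappa> e" and "pd G"
  shows "(LINT \<phi>|count_space (Omega N). (real_of_int (\<phi> 0))\<^sup>2 * G \<phi> * gauss N \<kappa> \<phi>)
      * (LINT \<phi>|count_space (Omega N). gauss N \<kappa> \<phi>)
    \<le> (LINT \<phi>|count_space (Omega N). (real_of_int (\<phi> 0))\<^sup>2 * gauss N \<kappa> \<phi>)
      * (LINT \<phi>|count_space (Omega N). G \<phi> * gauss N \<kappa> \<phi>)"
  using assms(2)
proof induction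
  case (pd_cos L)
  then show ?case by (rule gauss_correlation_cos[OF pos])
next
  case (pd_mid f g)
  note f = integrable_pd_gauss[OF pos abs_pd_le_1[OF pd_mid.hyps(1)]]
  note g = integrable_pd_gauss[OF pos abs_pd_le_1[OF pd_mid.hyps(2)]]
  have 1: "(LINT \<phi>|count_space (Omega N). (real_of_int (\<phi> 0))\<^sup>2 * ((f \<phi> + g \<phi>) / 2) * gauss N \<kappa> \<phi>)
      = ((LINT \<phi>|count_space (Omega N). (real_of_int (\<phi> 0))\<^sup>2 * f \<phi> * gauss N \<kappa> \<phi>)
        + (LINT \<phi>|count_space (Omega N). (real_of_int (\<phi> 0))\<^sup>2 * g \<phi> * gauss N \<kappa> \<phi>)) / 2"
    unfolding Bochner_Integration.integral_add[OF f(2) g(2), symmetric] integral_divide_zero[symmetric]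
    by (intro Bochner_Integration.integral_cong refl) (simp add: algebra_simps add_divide_distrib)
  have 2: "(LINT \<phi>|count_space (Omega N). ((f \<phi> + g \<phi>) / 2) * gauss N \<kappa> \<phi>)
      = ((LINT \<phi>|count_space (Omega N). f \<phi> * gauss N \<kappa> \<phi>)
        + (LINT \<phi>|count_space (Omega N). g \<phi> * gauss N \<kappa> \<phi>)) / 2"
    unfolding Bochner_Integration.integral_add[OF f(1) g(1), symmetric] integral_divide_zero[symmetric]
    by (intro Bochner_Integration.integral_cong refl) (simp add: algebra_simps add_divide_distrib)
  show ?case unfolding 1 2 using pd_mid.IH by (simp add: algebra_simps)
next
  case (pd_lim F g)
  let ?M = "count_space (Omega N)"
  have b: "\<bar>F n \<phi>\<bar> \<le> 1" for n \<phi> by (rule abs_pd_le_1[OF pd_lim.hyps(1)])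
  have i2: "integrable ?M (\<lambda>\<phi>. (real_of_int (\<phi> 0))\<^sup>2 * gauss N \<kappa> \<phi>)"
    using integrable_pd_gauss(2)[OF pos, of "\<lambda>_. 1"] by simp
  have "(\<lambda>n. LINT \<phi>|?M. F n \<phi> * gauss N \<kappa> \<phi>) \<longlonglongrightarrow> (LINT \<phi>|?M. g \<phi> * gauss N \<kappa> \<phi>)"
  proof (rule integral_dominated_convergence[OF _ _ integrable_gauss[OF pos]])
    show "AE \<phi> in ?M. norm (F n \<phi> * gauss N \<kappa> \<phi>) \<le> gauss N \<kappa> \<phi>" for n
      using b by (intro AE_I2) (auto simp: abs_mult shifted_gauss_def mult_left_le_one_le)
  qed (auto intro!: AE_I2 tendsto_intros pd_lim.hyps)
  moreover have "(\<lambda>n. LINT \<phi>|?M. (real_of_int (\<phi> 0))\<^sup>2 * F n \<phi> * gauss N \<kappa> \<phi>)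
      \<longlonglongrightarrow> (LINT \<phi>|?M. (real_of_int (\<phi> 0))\<^sup>2 * g \<phi> * gauss N \<kappa> \<phi>)"
  proof (rule integral_dominated_convergence[OF _ _ i2])
    show "AE \<phi> in ?M. norm ((real_of_int (\<phi> 0))\<^sup>2 * F n \<phi> * gauss N \<kappa> \<phi>) \<le> (real_of_int (\<phi> 0))\<^sup>2 * gauss N \<kappa> \<phi>" for n
    proof (rule AE_I2)
      fix \<phi>
      have "(real_of_int (\<phi> 0))\<^sup>2 * \<bar>F n \<phi>\<bar> * gauss N \<kappa> \<phi> \<le> (real_of_int (\<phi> 0))\<^sup>2 * 1 * gauss N \<kappa> \<phi>"
        using b by (intro mult_right_mono mult_left_mono) (auto simp: shifted_gauss_def)
      then show "norm ((real_of_int (\<phi> 0))\<^sup>2 * F n \<phi> * gauss N \<kappa> \<phi>) \<le> (real_of_int (\<phi> 0))\<^sup>2 * gauss N \<kappa> \<phi>"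
        by (simp add: abs_mult shifted_gauss_def)
    qed
  qed (auto intro!: AE_I2 tendsto_intros pd_lim.hyps)
  ultimately show ?case
    by (intro LIMSEQ_le[OF tendsto_mult[OF _ tendsto_const] tendsto_mult[OF tendsto_const]])
      (use pd_lim.IH in auto)
qed

section \<open>Independent jumps across cuts\<close>

text \<open>A family of elementary moves \<open>h i\<close>, each raising the origin by one, with dual coordinates \<open>n i\<close>. In the
  application \<open>h i\<close> raises an interval around the origin and \<open>n i\<close> reads off the jump at its end.\<close>
locale cut_system =
  fixes N :: nat and I :: "'i set" and h :: "'i \<Rightarrow> int \<Rightarrow> int" and n :: "'i \<Rightarrow> (int \<Rightarrow> int) \<Rightarrow> int"
  assumes finite_I [simp]: "finite I"
    and h_Omega: "i \<in> I \<Longrightarrow> h i \<in> Omega N"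
    and h_origin: "i \<in> I \<Longrightarrow> h i 0 = 1"
    and n_add: "n i (\<lambda>k. \<phi> k + m * \<psi> k) = n i \<phi> + m * n i \<psi>"
    and n_h: "i \<in> I \<Longrightarrow> j \<in> I \<Longrightarrow> n i (h j) = of_bool (i = j)"
begin

definition span_cuts :: "(int \<Rightarrow> int) set"
  where "span_cuts = {\<phi> \<in> Omega N. \<forall>k. \<phi> k = (\<Sum>i\<in>I. n i \<phi> * h i k)}"

text \<open>The comparison chain: the heights are integer combinations of the moves, and the coordinates \<open>n i\<close> are
  independent discrete Gaussians.\<close>
definition cut_weight :: "('i \<Rightarrow> real) \<Rightarrow> (int \<Rightarrow> int) \<Rightarrow> real"
  where "cut_weight K \<phi> = of_bool (\<phi> \<in> span_cuts) * exp (- (\<Sum>i\<in>I. K i * (real_of_int (n i \<phi>))\<^sup>2))"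

lemma cut_weight_nonneg [simp]: "0 \<le> cut_weight K \<phi>"
  by (simp add: cut_weight_def)

lemma n_shift: "j \<in> I \<Longrightarrow> i \<in> I \<Longrightarrow> n i (\<lambda>k. \<phi> k + m * h j k) = n i \<phi> + m * of_bool (i = j)"
  by (simp add: n_add n_h)

lemma shift_Omega: "j \<in> I \<Longrightarrow> \<phi> \<in> Omega N \<Longrightarrow> (\<lambda>k. \<phi> k + m * h j k) \<in> Omega N"
  using h_Omega[of j] by (auto simp: Omega_def)

lemma shift_span_aux:
  assumes "j \<in> I" and "\<phi> \<in> span_cuts"
  shows "(\<lambda>k. \<phi> k + m * h j k) \<in> span_cuts"
proof -
  have "\<phi> k + m * h j k = (\<Sum>i\<in>I. n i (\<lambda>k. \<phi> k + m * h j k) * h i k)" for k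
  proof -
    have "(\<Sum>i\<in>I. n i (\<lambda>k. \<phi> k + m * h j k) * h i k) = (\<Sum>i\<in>I. n i \<phi> * h i k + (if i = j then m * h i k else 0))"
      using assms(1) by (intro sum.cong refl) (auto simp: n_shift algebra_simps)
    also have "\<dots> = \<phi> k + m * h j k"
      using assms by (simp add: sum.distrib span_cuts_def)
    finally show ?thesis by simp
  qed
  moreover have "\<phi> \<in> Omega N" using assms(2) by (simp add: span_cuts_def)
  ultimately show ?thesis
    unfolding span_cuts_def mem_Collect_eq using shift_Omega[OF assms(1)] by blast
qed

lemma shift_span:
  assumes "j \<in> I"
  shows "(\<lambda>k. \<phi> k + m * h j k) \<in> span_cuts \<longleftrightarrow> \<phi> \<in> span_cuts"
  using shift_span_aux[OF assms, of \<phi> m]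
    shift_span_aux[OF assms, of "\<lambda>k. \<phi> k + m * h j k" "- m"] by auto

lemma bij_betw_flip:
  assumes "j \<in> I"
  shows "bij_betw (\<lambda>\<phi> k. \<phi> k + (- 2 * n j \<phi>) * h j k) (Omega N) (Omega N)"
proof (rule bij_betwI[where g = "\<lambda>\<phi> k. \<phi> k + (- 2 * n j \<phi>) * h j k"])
  show "(\<lambda>k. (\<lambda>k. \<phi> k + (- 2 * n j \<phi>) * h j k) k + (- 2 * n j (\<lambda>k. \<phi> k + (- 2 * n j \<phi>) * h j k)) * h j k) = \<phi>" for \<phi>
    unfolding n_shift[OF assms assms] by (auto simp: fun_eq_iff)
  then show "(\<lambda>k. (\<lambda>k. \<phi> k + (- 2 * n j \<phi>) * h j k) k + (- 2 * n j (\<lambda>k. \<phi> k + (- 2 * n j \<phi>) * h j k)) * h j k) = \<phi>" for \<phi> .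
  have "(\<lambda>k. \<phi> k + (- 2 * n j \<phi>) * h j k) \<in> Omega N" if "\<phi> \<in> Omega N" for \<phi>
    by (rule shift_Omega[OF assms that])
  then show "(\<lambda>\<phi> k. \<phi> k + (- 2 * n j \<phi>) * h j k) \<in> Omega N \<rightarrow> Omega N"
    and "(\<lambda>\<phi> k. \<phi> k + (- 2 * n j \<phi>) * h j k) \<in> Omega N \<rightarrow> Omega N" by blast+
qed

lemma n_flip:
  "j \<in> I \<Longrightarrow> i \<in> I \<Longrightarrow>
    n i (\<lambda>k. \<phi> k + (- 2 * n j \<phi>) * h j k) = (if i = j then - n i \<phi> else n i \<phi>)"
  unfolding n_shift by auto

lemma cut_weight_flip:
  assumes "j \<in> I"
  shows "cut_weight K (\<lambda>k. \<phi> k + (- 2 * n j \<phi>) * h j k) = cut_weight K \<phi>"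
proof -
  have "(\<Sum>i\<in>I. K i * (real_of_int (n i (\<lambda>k. \<phi> k + (- 2 * n j \<phi>) * h j k)))\<^sup>2)
      = (\<Sum>i\<in>I. K i * (real_of_int (n i \<phi>))\<^sup>2)"
    by (intro sum.cong refl) (simp only: n_flip[OF assms] if_distrib of_int_minus power2_minus cong: if_cong, simp)
  then show ?thesis unfolding cut_weight_def shift_span[OF assms] by simp
qed

text \<open>Flipping the sign of one coordinate preserves the weight, so mixed moments vanish.\<close>
lemma cut_weight_cross_terms:
  assumes "S \<subseteq> I"
  shows "(\<integral>\<^sup>+\<phi>. ennreal ((real_of_int (\<Sum>i\<in>S. n i \<phi>))\<^sup>2 * cut_weight K \<phi>) \<partial>count_space (Omega N))
    = (\<Sum>i\<in>S. \<integral>\<^sup>+\<phi>. ennreal ((real_of_int (n i \<phi>))\<^sup>2 * cut_weight K \<phi>) \<partial>count_space (Omega N))"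
  using finite_subset[OF assms finite_I] assms
proof (induction S rule: finite_induct)
  case (insert j S)
  let ?M = "count_space (Omega N)"
  let ?A = "\<lambda>\<phi>. real_of_int (\<Sum>i\<in>S. n i \<phi>)" and ?b = "\<lambda>\<phi>. real_of_int (n j \<phi>)"
  let ?W = "cut_weight K"
  have j: "j \<in> I" and S: "S \<subseteq> I" using insert.prems by auto
  have A: "?A (\<lambda>k. \<phi> k + (- 2 * n j \<phi>) * h j k) = ?A \<phi>" for \<phi>
  proof (intro arg_cong[where f = real_of_int] sum.cong refl)
    fix i assume "i \<in> S"
    then have "i \<in> I" "i \<noteq> j" using S insert.hyps(2) by auto
    then show "n i (\<lambda>k. \<phi> k + (- 2 * n j \<phi>) * h j k) = n i \<phi>"
      by (simp only: n_flip[OF j] if_False)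
  qed
  have "(\<integral>\<^sup>+\<phi>. ennreal ((?b \<phi> + ?A \<phi>)\<^sup>2 * ?W \<phi>) \<partial>?M)
      = (\<integral>\<^sup>+\<phi>. ennreal ((- ?b \<phi> + ?A \<phi>)\<^sup>2 * ?W \<phi>) \<partial>?M)"
    unfolding nn_integral_bij_count_space[OF bij_betw_flip[OF j], of "\<lambda>\<phi>. ennreal ((?b \<phi> + ?A \<phi>)\<^sup>2 * ?W \<phi>)", symmetric]
      cut_weight_flip[OF j] A n_shift[OF j j]
    by simp
  then have "2 * (\<integral>\<^sup>+\<phi>. ennreal ((?b \<phi> + ?A \<phi>)\<^sup>2 * ?W \<phi>) \<partial>?M)
      = (\<integral>\<^sup>+\<phi>. ennreal ((?b \<phi> + ?A \<phi>)\<^sup>2 * ?W \<phi>) \<partial>?M) + (\<integral>\<^sup>+\<phi>. ennreal ((- ?b \<phi> + ?A \<phi>)\<^sup>2 * ?W \<phi>) \<partial>?M)"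
    by (simp only: mult_2)
  also have "\<dots> = (\<integral>\<^sup>+\<phi>. ennreal ((?b \<phi> + ?A \<phi>)\<^sup>2 * ?W \<phi>) + ennreal ((- ?b \<phi> + ?A \<phi>)\<^sup>2 * ?W \<phi>) \<partial>?M)"
    by (rule nn_integral_add[symmetric]) auto
  also have "\<dots> = (\<integral>\<^sup>+\<phi>. 2 * (ennreal ((?b \<phi>)\<^sup>2 * ?W \<phi>) + ennreal ((?A \<phi>)\<^sup>2 * ?W \<phi>)) \<partial>?M)"
  proof (intro nn_integral_cong)
    fix \<phi>
    have "(?b \<phi> + ?A \<phi>)\<^sup>2 * ?W \<phi> + (- ?b \<phi> + ?A \<phi>)\<^sup>2 * ?W \<phi> = 2 * ((?b \<phi>)\<^sup>2 * ?W \<phi> + (?A \<phi>)\<^sup>2 * ?W \<phi>)"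
      by (simp add: power2_eq_square algebra_simps)
    then show "ennreal ((?b \<phi> + ?A \<phi>)\<^sup>2 * ?W \<phi>) + ennreal ((- ?b \<phi> + ?A \<phi>)\<^sup>2 * ?W \<phi>)
        = 2 * (ennreal ((?b \<phi>)\<^sup>2 * ?W \<phi>) + ennreal ((?A \<phi>)\<^sup>2 * ?W \<phi>))"
      by (simp add: ennreal_plus[symmetric] ennreal_mult'[symmetric] ennreal_numeral[symmetric]
          del: ennreal_plus ennreal_numeral)
  qed
  also have "\<dots> = 2 * ((\<integral>\<^sup>+\<phi>. ennreal ((?b \<phi>)\<^sup>2 * ?W \<phi>) \<partial>?M) + (\<integral>\<^sup>+\<phi>. ennreal ((?A \<phi>)\<^sup>2 * ?W \<phi>) \<partial>?M))"
    by (subst nn_integral_cmult, simp) (subst nn_integral_add, auto)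
  finally have "(\<integral>\<^sup>+\<phi>. ennreal ((?b \<phi> + ?A \<phi>)\<^sup>2 * ?W \<phi>) \<partial>?M)
      = (\<integral>\<^sup>+\<phi>. ennreal ((?b \<phi>)\<^sup>2 * ?W \<phi>) \<partial>?M) + (\<integral>\<^sup>+\<phi>. ennreal ((?A \<phi>)\<^sup>2 * ?W \<phi>) \<partial>?M)"
    by (subst (asm) ennreal_mult_cancel_left) auto
  then show ?case using insert.IH[OF S] insert.hyps by simp
qed simp

text \<open>For a single coordinate, \<open>E n\<^sup>2 \<ge> P(n \<noteq> 0)\<close> and \<open>P(n = 1) = P(n = - 1) = e P(n = 0)\<close> with \<open>e = exp (- K)\<close>.
  Hence \<open>P(n \<noteq> 0) \<ge> 2 e / (1 + 2 e) \<ge> 2 e / 3\<close>.\<close>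
lemma cut_weight_marginal:
  assumes j: "j \<in> I" and K: "0 \<le> K j"
    and fin: "(\<integral>\<^sup>+\<phi>. ennreal (cut_weight K \<phi>) \<partial>count_space (Omega N)) < \<infinity>"
  shows "ennreal (2 / 3 * exp (- K j)) * (\<integral>\<^sup>+\<phi>. ennreal (cut_weight K \<phi>) \<partial>count_space (Omega N))
    \<le> (\<integral>\<^sup>+\<phi>. ennreal ((real_of_int (n j \<phi>))\<^sup>2 * cut_weight K \<phi>) \<partial>count_space (Omega N))"
proof -
  let ?M = "count_space (Omega N)" and ?W = "cut_weight K"
  \<comment> \<open>The mass of the event that coordinate \<open>j\<close> takes its value in \<open>S\<close>.\<close>
  define U where "U = (\<lambda>S. \<integral>\<^sup>+\<phi>. ennreal (of_bool (n j \<phi> \<in> S) * ?W \<phi>) \<partial>?M)"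
  have U_add: "U (S \<union> T) = U S + U T" if "S \<inter> T = {}" for S T
    unfolding U_def using that
    by (subst nn_integral_add[symmetric]) (auto intro!: nn_integral_cong simp: of_bool_def)
  have U_mono: "U S \<le> U T" if "S \<subseteq> T" for S T
    unfolding U_def using that by (intro nn_integral_mono) (auto simp: of_bool_def)
  have U_UNIV: "U UNIV = (\<integral>\<^sup>+\<phi>. ennreal (?W \<phi>) \<partial>?M)" by (simp add: U_def)
  have one: "U {s} = ennreal (exp (- K j)) * U {0}" if s: "s\<^sup>2 = 1" for s :: int
  proof -
    have bij: "bij_betw (\<lambda>\<phi> k. \<phi> k + s * h j k) (Omega N) (Omega N)"
      by (rule bij_betw_Omega_translate) (use h_Omega[OF j] in \<open>auto simp: Omega_def\<close>)
    have W: "?W (\<lambda>k. \<phi> k + s * h j k) = exp (- K j) * ?W \<phi>" if n0: "n j \<phi> = 0" for \<phi>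
    proof -
      have "(\<Sum>i\<in>I. K i * (real_of_int (n i (\<lambda>k. \<phi> k + s * h j k)))\<^sup>2)
          = (\<Sum>i\<in>I. K i * (real_of_int (n i \<phi>))\<^sup>2 + (if i = j then K i else 0))"
        using n0 s by (intro sum.cong refl) (auto simp: n_shift[OF j] of_int_power[symmetric] simp del: of_int_power)
      then have "(\<Sum>i\<in>I. K i * (real_of_int (n i (\<lambda>k. \<phi> k + s * h j k)))\<^sup>2)
          = (\<Sum>i\<in>I. K i * (real_of_int (n i \<phi>))\<^sup>2) + K j"
        using j by (simp add: sum.distrib)
      then show ?thesis unfolding cut_weight_def shift_span[OF j] by (simp add: exp_add[symmetric] exp_diff exp_minus divide_inverse)
    qed
    have "U {s} = (\<integral>\<^sup>+\<phi>. ennreal (of_bool (n j (\<lambda>k. \<phi> k + s * h j k) \<in> {s}) * ?W (\<lambda>k. \<phi> k + s * h j k)) \<partial>?M)"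
      unfolding U_def by (rule nn_integral_bij_count_space[OF bij, symmetric])
    also have "\<dots> = (\<integral>\<^sup>+\<phi>. ennreal (exp (- K j)) * ennreal (of_bool (n j \<phi> \<in> {0}) * ?W \<phi>) \<partial>?M)"
      by (intro nn_integral_cong) (auto simp: n_shift[OF j j] W of_bool_def ennreal_mult')
    also have "\<dots> = ennreal (exp (- K j)) * U {0}"
      unfolding U_def by (rule nn_integral_cmult) simp
    finally show ?thesis .
  qed
  have "U {1} + U {-1} \<le> U (- {0})"
    by (subst U_add[symmetric]) (auto intro!: U_mono)
  then have two: "2 * (ennreal (exp (- K j)) * U {0}) \<le> U (- {0})"
    using one[of 1] one[of "-1"] by (simp add: mult_2)
  have total: "U UNIV = U {0} + U (- {0})" using U_add[of "{0}" "- {0}"] by simp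
  obtain u v where u: "U {0} = ennreal u" "0 \<le> u" and v: "U (- {0}) = ennreal v" "0 \<le> v"
    using fin U_mono[of "{0}" UNIV] U_mono[of "- {0}" UNIV] unfolding U_UNIV[symmetric]
    by (metis subset_UNIV ennreal_cases infinity_ennreal_def order.strict_trans1 top.not_eq_extremum)
  have "2 * (exp (- K j) * u) \<le> v"
    using two u v by (simp add: ennreal_mult'[symmetric] ennreal_numeral[symmetric] del: ennreal_numeral)
  moreover have "exp (- K j) * v \<le> v" using K v by (simp add: mult_left_le_one_le)
  ultimately have "2 / 3 * exp (- K j) * (u + v) \<le> v" by (simp add: algebra_simps)
  then have "ennreal (2 / 3 * exp (- K j)) * U UNIV \<le> U (- {0})"
    unfolding total u v using u v by (simp add: ennreal_mult'[symmetric] ennreal_plus[symmetric] del: ennreal_plus)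
  also have "U (- {0}) \<le> (\<integral>\<^sup>+\<phi>. ennreal ((real_of_int (n j \<phi>))\<^sup>2 * ?W \<phi>) \<partial>?M)"
    unfolding U_def
  proof (intro nn_integral_mono ennreal_leI mult_right_mono)
    fix \<phi>
    show "of_bool (n j \<phi> \<in> - {0}) \<le> (real_of_int (n j \<phi>))\<^sup>2"
    proof (cases "n j \<phi> = 0")
      case False
      then have "1 \<le> (n j \<phi>)\<^sup>2" by (simp add: int_one_le_iff_zero_less)
      then have "real_of_int 1 \<le> real_of_int ((n j \<phi>)\<^sup>2)" by (simp only: of_int_le_iff)
      then show ?thesis using False by simp
    qed simp
  qed simp
  finally show ?thesis by (simp add: U_UNIV)
qed

text \<open>If all increments of the moves across \<open>e\<close> are \<open>0\<close> or \<open>\<plusminus>1\<close>, this is the number of moves that see the edge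
  \<open>e\<close>, provided that \<open>h i\<close> is one of them, and \<open>0\<close> otherwise. It comes from
  \<open>(\<Sum>i. g i * x i)\<^sup>2 \<le> (\<Sum>j. \<bar>g j\<bar>) * (\<Sum>i. \<bar>g i\<bar> * x i\<^sup>2)\<close>.\<close>
definition cut_cost :: "int \<times> int \<Rightarrow> 'i \<Rightarrow> real"
  where "cut_cost e i = \<bar>grad (h i) e\<bar> * (\<Sum>j\<in>I. \<bar>grad (h j) e\<bar>)"

lemma cut_cost_nonneg: "0 \<le> cut_cost e i"
  by (simp add: cut_cost_def sum_nonneg)

text \<open>The density of the comparison chain with respect to the Gaussian chain. The first factor supplies the
  difference of the two sides in the inequality for \<open>cut_cost\<close>, which is a sum of squares and so
  gives a positive definite function; the second factor restricts to the span of the moves.\<close>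
definition cut_comparison :: "(int \<times> int \<Rightarrow> real) \<Rightarrow> (int \<Rightarrow> int) \<Rightarrow> real"
  where "cut_comparison \<kappa> \<phi> =
    (\<Prod>e\<in>edges N. \<Prod>i\<in>I. \<Prod>j\<in>I. exp (- (\<kappa> e * \<bar>grad (h i) e\<bar> * \<bar>grad (h j) e\<bar> / 2)
        * (sgn (grad (h i) e) * real_of_int (n i \<phi>) + (- sgn (grad (h j) e)) * real_of_int (n j \<phi>))\<^sup>2))
    * (\<Prod>k\<in>{- int N..int N}. of_bool (real_of_int (\<phi> k - (\<Sum>i\<in>I. n i \<phi> * h i k)) = 0))"

lemma additive_n: "additive_fun (\<lambda>\<phi>. real_of_int (n i \<phi>))"
  using n_add[of i _ 1] by (simp add: additive_fun_def)

lemma pd_cut_comparison: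
  assumes "\<forall>e\<in>edges N. 0 < \<kappa> e"
  shows "pd (cut_comparison \<kappa>)"
  unfolding cut_comparison_def
proof (intro pd_mult pd_prod pd_gauss pd_kernel additive_fun_lincomb additive_n)
  show "additive_fun (\<lambda>\<phi>. real_of_int (\<phi> k - (\<Sum>i\<in>I. n i \<phi> * h i k)))" for k
    using n_add[of _ _ 1] by (simp add: additive_fun_def sum.distrib algebra_simps)
  show "0 \<le> \<kappa> e * \<bar>grad (h i) e\<bar> * \<bar>grad (h j) e\<bar> / 2" if "e \<in> edges N" for e i j
    using assms that by (simp add: less_imp_le)
qed

text \<open>Lagrange's identity: the defect in the Cauchy-Schwarz inequality with weights \<open>\<bar>g i\<bar>\<close> as a sum of squares.\<close>
lemma square_sum_plus_variance:
  fixes g x :: "'i \<Rightarrow> real"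
  shows "(\<Sum>i\<in>I. x i * g i)\<^sup>2
      + (\<Sum>i\<in>I. \<Sum>j\<in>I. \<bar>g i\<bar> * \<bar>g j\<bar> / 2 * (sgn (g i) * x i + (- sgn (g j)) * x j)\<^sup>2)
    = (\<Sum>i\<in>I. \<bar>g i\<bar> * (\<Sum>j\<in>I. \<bar>g j\<bar>) * (x i)\<^sup>2)"
proof -
  have "\<bar>a\<bar> * \<bar>b\<bar> / 2 * (sgn a * y + (- sgn b) * z)\<^sup>2
      = \<bar>a\<bar> * \<bar>b\<bar> * y\<^sup>2 / 2 + \<bar>a\<bar> * \<bar>b\<bar> * z\<^sup>2 / 2 - (y * a) * (z * b)" for a b y z :: real
    by (cases a "0::real" rule: linorder_cases; cases b "0::real" rule: linorder_cases)
      (auto simp: power2_eq_square field_simps)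
  then have "(\<Sum>i\<in>I. \<Sum>j\<in>I. \<bar>g i\<bar> * \<bar>g j\<bar> / 2 * (sgn (g i) * x i + (- sgn (g j)) * x j)\<^sup>2)
      = (\<Sum>i\<in>I. \<Sum>j\<in>I. \<bar>g i\<bar> * \<bar>g j\<bar> * (x i)\<^sup>2 / 2) + (\<Sum>i\<in>I. \<Sum>j\<in>I. \<bar>g i\<bar> * \<bar>g j\<bar> * (x j)\<^sup>2 / 2)
        - (\<Sum>i\<in>I. \<Sum>j\<in>I. (x i * g i) * (x j * g j))"
    by (simp only: sum.distrib sum_subtractf)
  also have "(\<Sum>i\<in>I. \<Sum>j\<in>I. \<bar>g i\<bar> * \<bar>g j\<bar> * (x j)\<^sup>2 / 2) = (\<Sum>i\<in>I. \<Sum>j\<in>I. \<bar>g i\<bar> * \<bar>g j\<bar> * (x i)\<^sup>2 / 2)"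
    by (subst sum.swap) (simp add: mult_ac)
  also have "(\<Sum>i\<in>I. \<Sum>j\<in>I. (x i * g i) * (x j * g j)) = (\<Sum>i\<in>I. x i * g i)\<^sup>2"
    by (simp add: power2_eq_square sum_product)
  finally show ?thesis
    by (simp add: sum.distrib[symmetric] sum_distrib_left sum_distrib_right mult_ac)
qed

lemma gauss_cut_comparison:
  assumes \<phi>: "\<phi> \<in> Omega N"
  shows "cut_comparison \<kappa> \<phi> * gauss N \<kappa> \<phi>
    = cut_weight (\<lambda>i. \<Sum>e\<in>edges N. \<kappa> e * cut_cost e i) \<phi>"
proof (cases "\<phi> \<in> span_cuts")
  case True
  let ?x = "\<lambda>i. real_of_int (n i \<phi>)" and ?g = "\<lambda>e i. grad (h i) e"
  have grad: "grad \<phi> e = (\<Sum>i\<in>I. ?x i * ?g e i)" for e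
  proof -
    have "\<phi> (fst e) = (\<Sum>i\<in>I. n i \<phi> * h i (fst e))" "\<phi> (snd e) = (\<Sum>i\<in>I. n i \<phi> * h i (snd e))"
      using True by (simp_all add: span_cuts_def)
    then show ?thesis by (simp add: grad_def sum_subtractf algebra_simps)
  qed
  have ind: "(\<Prod>k\<in>{- int N..int N}. of_bool (real_of_int (\<phi> k - (\<Sum>i\<in>I. n i \<phi> * h i k)) = 0)) = (1::real)"
    using True by (intro prod.neutral) (simp add: span_cuts_def)
  have exponents: "(\<Sum>e\<in>edges N. \<Sum>i\<in>I. \<Sum>j\<in>I. - (\<kappa> e * \<bar>?g e i\<bar> * \<bar>?g e j\<bar> / 2)
        * (sgn (?g e i) * ?x i + (- sgn (?g e j)) * ?x j)\<^sup>2)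
      + - (\<Sum>e\<in>edges N. \<kappa> e * (grad \<phi> e - 0)\<^sup>2)
    = - (\<Sum>i\<in>I. (\<Sum>e\<in>edges N. \<kappa> e * cut_cost e i) * (?x i)\<^sup>2)"
  proof -
    have "(\<Sum>i\<in>I. \<Sum>j\<in>I. - (\<kappa> e * \<bar>?g e i\<bar> * \<bar>?g e j\<bar> / 2)
        * (sgn (?g e i) * ?x i + (- sgn (?g e j)) * ?x j)\<^sup>2) + - (\<kappa> e * (grad \<phi> e - 0)\<^sup>2)
      = - (\<kappa> e * (\<Sum>i\<in>I. cut_cost e i * (?x i)\<^sup>2))" for e
      unfolding cut_cost_def square_sum_plus_variance[of ?x "?g e", symmetric] grad
      by (simp add: distrib_left sum_distrib_left sum_negf mult_ac)
    then have "(\<Sum>e\<in>edges N. \<Sum>i\<in>I. \<Sum>j\<in>I. - (\<kappa> e * \<bar>?g e i\<bar> * \<bar>?g e j\<bar> / 2)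
        * (sgn (?g e i) * ?x i + (- sgn (?g e j)) * ?x j)\<^sup>2)
      + - (\<Sum>e\<in>edges N. \<kappa> e * (grad \<phi> e - 0)\<^sup>2)
      = (\<Sum>e\<in>edges N. - (\<kappa> e * (\<Sum>i\<in>I. cut_cost e i * (?x i)\<^sup>2)))"
      unfolding sum_negf[symmetric] sum.distrib[symmetric] by simp
    also have "\<dots> = - (\<Sum>i\<in>I. (\<Sum>e\<in>edges N. \<kappa> e * cut_cost e i) * (?x i)\<^sup>2)"
      by (simp add: sum_negf sum_distrib_left sum_distrib_right mult.assoc) (rule sum.swap)
    finally show ?thesis .
  qed
  show ?thesis
    unfolding cut_comparison_def ind cut_weight_def shifted_gauss_def exponents[symmetric] exp_add
    using True by (simp add: exp_sum)
next
  case False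
  then obtain k where k: "\<phi> k \<noteq> (\<Sum>i\<in>I. n i \<phi> * h i k)" using \<phi> by (auto simp: span_cuts_def)
  have "k \<in> {- int N..int N}"
  proof (rule ccontr)
    assume "k \<notin> {- int N..int N}"
    then have "\<phi> k = 0" "\<And>i. i \<in> I \<Longrightarrow> h i k = 0"
      using Omega_outside[OF \<phi>] Omega_outside[OF h_Omega] by blast+
    then show False using k by simp
  qed
  then have "(\<Prod>k\<in>{- int N..int N}. of_bool (real_of_int (\<phi> k - (\<Sum>i\<in>I. n i \<phi> * h i k)) = 0)) = (0::real)"
    using k by (intro prod_zero bexI[of _ k]) (simp_all only: of_int_eq_0_iff right_minus_eq of_bool_def if_False finite_atLeastAtMost_int)
  then show ?thesis using False by (simp add: cut_comparison_def cut_weight_def)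
qed

text \<open>The comparison chain fluctuates less than the Gaussian chain, and its variance is a sum over the
  independent coordinates. What matters for the later averaging over \<open>\<kappa>\<close> is that the bound is a sum of products
  of functions of the single conductances.\<close>
theorem gauss_cut_bound:
  assumes pos: "\<forall>e\<in>edges N. 0 < \<kappa> e"
  shows "2 / 3 * (\<Sum>i\<in>I. exp (- (\<Sum>e\<in>edges N. \<kappa> e * cut_cost e i)))
      * (LINT \<phi>|count_space (Omega N). gauss N \<kappa> \<phi>)
    \<le> (LINT \<phi>|count_space (Omega N). (real_of_int (\<phi> 0))\<^sup>2 * gauss N \<kappa> \<phi>)"
proof -
  let ?M = "count_space (Omega N)"
  define K where "K = (\<lambda>i. \<Sum>e\<in>edges N. \<kappa> e * cut_cost e i)"
  define G where "G = cut_comparison \<kappa>"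
  have K: "0 \<le> K i" for i
    unfolding K_def using pos cut_cost_nonneg by (intro sum_nonneg mult_nonneg_nonneg) (auto intro: less_imp_le)
  have pd: "pd G" unfolding G_def by (rule pd_cut_comparison[OF pos])
  have W: "G \<phi> * gauss N \<kappa> \<phi> = cut_weight K \<phi>" if "\<phi> \<in> Omega N" for \<phi>
    unfolding G_def K_def by (rule gauss_cut_comparison[OF that])
  note intG = integrable_pd_gauss[OF pos abs_pd_le_1[OF pd]]
  have int1: "integrable ?M (cut_weight K)"
    using intG(1) Bochner_Integration.integrable_cong[of ?M ?M "\<lambda>\<phi>. G \<phi> * gauss N \<kappa> \<phi>" "cut_weight K"]
    by (simp add: W)
  have int2: "integrable ?M (\<lambda>\<phi>. (real_of_int (\<phi> 0))\<^sup>2 * cut_weight K \<phi>)"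
    using intG(2) Bochner_Integration.integrable_cong[of ?M ?M "\<lambda>\<phi>. (real_of_int (\<phi> 0))\<^sup>2 * G \<phi> * gauss N \<kappa> \<phi>"
        "\<lambda>\<phi>. (real_of_int (\<phi> 0))\<^sup>2 * cut_weight K \<phi>"]
    by (simp add: W mult.assoc)
  define w where "w = (LINT \<phi>|?M. cut_weight K \<phi>)"
  define s where "s = (LINT \<phi>|?M. (real_of_int (\<phi> 0))\<^sup>2 * cut_weight K \<phi>)"
  have nw: "(\<integral>\<^sup>+\<phi>. ennreal (cut_weight K \<phi>) \<partial>?M) = ennreal w"
    unfolding w_def by (rule nn_integral_eq_integral[OF int1]) simp
  have ns: "(\<integral>\<^sup>+\<phi>. ennreal ((real_of_int (\<phi> 0))\<^sup>2 * cut_weight K \<phi>) \<partial>?M) = ennreal s"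
    unfolding s_def by (rule nn_integral_eq_integral[OF int2]) simp
  have w0: "0 \<le> w" unfolding w_def by (rule integral_nonneg_AE) simp
  have s0: "0 \<le> s" unfolding s_def by (rule integral_nonneg_AE) simp
  have "ennreal (2 / 3 * (\<Sum>i\<in>I. exp (- K i)) * w) = (\<Sum>i\<in>I. ennreal (2 / 3 * exp (- K i)) * ennreal w)"
    using w0 by (simp add: ennreal_mult'[symmetric] sum_ennreal sum_distrib_left sum_distrib_right)
  also have "\<dots> \<le> (\<Sum>i\<in>I. \<integral>\<^sup>+\<phi>. ennreal ((real_of_int (n i \<phi>))\<^sup>2 * cut_weight K \<phi>) \<partial>?M)"
    unfolding nw[symmetric] by (intro sum_mono cut_weight_marginal K) (simp_all add: nw)
  also have "\<dots> = (\<integral>\<^sup>+\<phi>. ennreal ((real_of_int (\<Sum>i\<in>I. n i \<phi>))\<^sup>2 * cut_weight K \<phi>) \<partial>?M)"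
    by (rule cut_weight_cross_terms[symmetric]) simp
  also have "\<dots> = ennreal s"
    unfolding ns[symmetric]
  proof (intro nn_integral_cong arg_cong[where f = ennreal])
    fix \<phi>
    show "(real_of_int (\<Sum>i\<in>I. n i \<phi>))\<^sup>2 * cut_weight K \<phi> = (real_of_int (\<phi> 0))\<^sup>2 * cut_weight K \<phi>"
    proof (cases "\<phi> \<in> span_cuts")
      case True
      then have "\<phi> 0 = (\<Sum>i\<in>I. n i \<phi> * h i 0)" unfolding span_cuts_def by blast
      also have "\<dots> = (\<Sum>i\<in>I. n i \<phi>)" using h_origin by simp
      finally show ?thesis by simp
    qed (simp add: cut_weight_def)
  qed
  finally have main: "2 / 3 * (\<Sum>i\<in>I. exp (- K i)) * w \<le> s" using s0 by simp
  have "(LINT \<phi>|?M. G \<phi> * gauss N \<kappa> \<phi>) = w"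
    unfolding w_def by (intro Bochner_Integration.integral_cong) (auto simp: W)
  moreover have "(LINT \<phi>|?M. (real_of_int (\<phi> 0))\<^sup>2 * G \<phi> * gauss N \<kappa> \<phi>) = s"
    unfolding s_def by (intro Bochner_Integration.integral_cong) (auto simp: W mult.assoc)
  ultimately have corr: "s * (LINT \<phi>|?M. gauss N \<kappa> \<phi>)
      \<le> (LINT \<phi>|?M. (real_of_int (\<phi> 0))\<^sup>2 * gauss N \<kappa> \<phi>) * w"
    using gauss_correlation[OF pos pd] by simp
  have "0 < w"
  proof -
    have n0: "n i (\<lambda>_. 0) = 0" for i using n_add[of i "\<lambda>_. 0" 1 "\<lambda>_. 0"] by simp
    have "0 < cut_weight K (\<lambda>_. 0)" by (simp add: cut_weight_def span_cuts_def Omega_zero n0)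
    moreover have "w \<noteq> 0"
    proof
      assume "w = 0"
      then have "AE \<phi> in ?M. cut_weight K \<phi> = 0"
        unfolding w_def by (subst (asm) integral_nonneg_eq_0_iff_AE[OF int1]) auto
      then have "cut_weight K (\<lambda>_. 0) = 0" using Omega_zero by (auto simp only: AE_count_space)
      then show False using calculation by simp
    qed
    ultimately show ?thesis using w0 by simp
  qed
  have "(2 / 3 * (\<Sum>i\<in>I. exp (- K i)) * (LINT \<phi>|?M. gauss N \<kappa> \<phi>)) * w
      \<le> s * (LINT \<phi>|?M. gauss N \<kappa> \<phi>)"
    using mult_right_mono[OF main less_imp_le[OF shifted_gauss_pos[OF pos]]] by (simp add: mult_ac)
  also note corr
  finally have "2 / 3 * (\<Sum>i\<in>I. exp (- K i)) * (LINT \<phi>|?M. gauss N \<kappa> \<phi>)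
      \<le> (LINT \<phi>|?M. (real_of_int (\<phi> 0))\<^sup>2 * gauss N \<kappa> \<phi>)"
    using \<open>0 < w\<close> by simp
  then show ?thesis by (simp add: K_def)
qed

end

section \<open>Stable weights as limits of Gaussian mixtures\<close>

text \<open>As a function of the squared increment \<open>s\<close>, a countable mixture of Gaussian edge factors. The rates are
  positive, so that each component has a finite resistance, and increasing, so that the components are
  ordered by their strength.\<close>
definition gauss_mixture :: "(real \<Rightarrow> real) \<Rightarrow> bool"
  where "gauss_mixture f \<longleftrightarrow> (\<exists>p \<mu>. (\<forall>k::nat. 0 \<le> p k \<and> 0 < \<mu> k) \<and> mono \<mu> \<and>
    (\<forall>s\<ge>0. (\<lambda>k. p k * exp (- \<mu> k * s)) sums f s))"

lemma gauss_mixture_scale: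
  assumes "gauss_mixture f" and "0 < b"
  shows "gauss_mixture (\<lambda>s. f (b * s))"
proof -
  obtain p \<mu> where *: "\<forall>k::nat. 0 \<le> p k \<and> 0 < \<mu> k" "mono \<mu>"
    "\<And>s. 0 \<le> s \<Longrightarrow> (\<lambda>k. p k * exp (- \<mu> k * s)) sums f s"
    using assms(1) unfolding gauss_mixture_def by blast
  have "(\<lambda>k. p k * exp (- (b * \<mu> k) * s)) sums f (b * s)" if "0 \<le> s" for s
    using *(3)[of "b * s"] that assms(2) by (simp add: mult_ac)
  moreover have "mono (\<lambda>k. b * \<mu> k)"
    using *(2) assms(2) by (simp add: mono_def)
  ultimately show ?thesis
    unfolding gauss_mixture_def using *(1) assms(2)
    by (intro exI[of _ p] exI[of _ "\<lambda>k. b * \<mu> k"]) auto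
qed

definition nonneg_series :: "(nat \<Rightarrow> real) \<Rightarrow> (real \<Rightarrow> real) \<Rightarrow> bool"
  where "nonneg_series c F \<longleftrightarrow> (\<forall>k. 0 \<le> c k) \<and> (\<forall>w. 0 \<le> w \<and> w < 1 \<longrightarrow> (\<lambda>k. c k * w ^ k) sums F w)"

lemma nonneg_series_mult:
  assumes "nonneg_series c F" and "nonneg_series d G"
  shows "nonneg_series (\<lambda>k. \<Sum>i\<le>k. c i * d (k - i)) (\<lambda>w. F w * G w)"
  unfolding nonneg_series_def
proof (intro conjI allI impI)
  show "0 \<le> (\<Sum>i\<le>k. c i * d (k - i))" for k
    using assms by (intro sum_nonneg mult_nonneg_nonneg) (auto simp: nonneg_series_def)
  fix w :: real assume w: "0 \<le> w \<and> w < 1"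
  have c: "(\<lambda>k. c k * w ^ k) sums F w" and d: "(\<lambda>k. d k * w ^ k) sums G w"
    using assms w by (auto simp: nonneg_series_def)
  have "(\<lambda>k. \<Sum>i\<le>k. (c i * w ^ i) * (d (k - i) * w ^ (k - i))) sums
      ((\<Sum>k. c k * w ^ k) * (\<Sum>k. d k * w ^ k))"
  proof (rule Cauchy_product_sums)
    show "summable (\<lambda>k. norm (c k * w ^ k))" "summable (\<lambda>k. norm (d k * w ^ k))"
      using c d assms w by (auto simp: nonneg_series_def abs_mult sums_iff)
  qed
  moreover have "(\<Sum>i\<le>k. (c i * w ^ i) * (d (k - i) * w ^ (k - i))) = (\<Sum>i\<le>k. c i * d (k - i)) * w ^ k" for k
    unfolding sum_distrib_right
  proof (intro sum.cong refl)
    fix i assume "i \<in> {..k}"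
    then have "w ^ k = w ^ i * w ^ (k - i)" by (simp add: power_add[symmetric])
    then show "(c i * w ^ i) * (d (k - i) * w ^ (k - i)) = c i * d (k - i) * w ^ k"
      by (simp add: mult_ac)
  qed
  ultimately show "(\<lambda>k. (\<Sum>i\<le>k. c i * d (k - i)) * w ^ k) sums (F w * G w)"
    using c d by (simp add: sums_iff)
qed

lemma nonneg_series_power: "nonneg_series c F \<Longrightarrow> \<exists>d. nonneg_series d (\<lambda>w. F w ^ n)"
proof (induction n)
  case 0
  have "(\<lambda>k. (if k = 0 then 1 else 0) * w ^ k) sums (1::real)" for w :: real
  proof -
    have "(\<lambda>k. (if k = 0 then 1 else 0) * w ^ k) = (\<lambda>k. if k = 0 then 1 else (0::real))" by auto
    then show ?thesis using sums_single[of 0 "\<lambda>_. 1::real"] by simp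
  qed
  then show ?case by (intro exI[of _ "\<lambda>k. if k = 0 then 1 else 0"]) (simp add: nonneg_series_def)
next
  case (Suc n)
  then show ?case using nonneg_series_mult by fastforce
qed

text \<open>The binomial coefficients of a power between \<open>0\<close> and \<open>1\<close> alternate in sign from the second one on,
  so \<open>1 - (1 - w) powr a\<close> has nonnegative Taylor coefficients. They are the Sibuya distribution, which lies
  in the domain of attraction of the one-sided stable law of index \<open>a\<close>. The factor \<open>w\<close> is split off because the constant
  coefficient vanishes.\<close>
lemma sibuya_series:
  fixes a :: real
  assumes "0 < a" and "a < 1"
  obtains c F where "nonneg_series c F" and "\<And>w. 0 \<le> w \<Longrightarrow> w < 1 \<Longrightarrow> w * F w = 1 - (1 - w) powr a"
proof -
  define c where "c = (\<lambda>k. (-1) ^ k * (a gchoose Suc k))"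
  have c_Suc: "c (Suc k) = c k * ((real (Suc k) - a) / real (Suc (Suc k)))" for k
  proof -
    have "real (Suc (Suc k)) * (a gchoose Suc (Suc k)) = (a - real (Suc k)) * (a gchoose Suc k)"
      using gbinomial_mult_1[of a "Suc k"] by (simp only: ring_distribs)
    then have "(a gchoose Suc (Suc k)) = (a - real (Suc k)) * (a gchoose Suc k) / real (Suc (Suc k))"
      by (simp only: eq_divide_eq) (simp add: mult.commute)
    moreover have "(-1) ^ Suc k * ((a - x) * y / z) = (-1) ^ k * y * ((x - a) / z)" for x y z :: real
      by (simp add: algebra_simps minus_divide_left[symmetric] diff_divide_distrib)
    ultimately show ?thesis by (simp only: c_def)
  qed
  have c0: "0 \<le> c k" for k
  proof (induction k)
    case (Suc k)
    then show ?case unfolding c_Suc using assms by (intro mult_nonneg_nonneg divide_nonneg_nonneg) auto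
  qed (use assms in \<open>simp add: c_def\<close>)
  have s: "(\<lambda>k. c k * w ^ Suc k) sums (1 - (1 - w) powr a)" if "0 \<le> w" "w < 1" for w
  proof -
    have "(\<lambda>k. (a gchoose k) * (- w) ^ k) sums (1 + (- w)) powr a"
      using that by (intro gen_binomial_real) auto
    then have "(\<lambda>k. (a gchoose Suc k) * (- w) ^ Suc k) sums ((1 - w) powr a - 1)"
      by (subst sums_Suc_iff) simp
    from sums_minus[OF this] show ?thesis
      by (simp add: c_def power_minus[of w] mult_ac)
  qed
  define F where "F = (\<lambda>w. \<Sum>k. c k * w ^ k)"
  have F: "(\<lambda>k. c k * w ^ k) sums F w" if "0 \<le> w" "w < 1" for w
  proof (cases "w = 0")
    case True
    then show ?thesis unfolding F_def by (intro summable_sums summable_finite[of "{0}"]) auto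
  next
    case False
    have "summable (\<lambda>k. w * (c k * w ^ k))"
      using sums_summable[OF s[OF that]] by (simp add: mult_ac)
    then show ?thesis using False unfolding F_def by (intro summable_sums) simp
  qed
  have "w * F w = 1 - (1 - w) powr a" if "0 \<le> w" "w < 1" for w
    using sums_unique2[OF sums_mult[OF F[OF that], of w]] s[OF that] by (simp add: mult_ac)
  moreover have "nonneg_series c F" using F c0 by (simp add: nonneg_series_def)
  ultimately show thesis using that by blast
qed

text \<open>The Laplace transform at \<open>s + 1 / n\<close> of a sum of \<open>n\<close> independent Sibuya variables divided by \<open>n powr (1 / a)\<close>,
  which tends to the transform \<open>exp (- (s powr a))\<close> of the stable law. The offset \<open>1 / n\<close> keeps the argument of the
  power series inside the open unit disc even for \<open>s = 0\<close>.\<close>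
definition stable_approx :: "real \<Rightarrow> nat \<Rightarrow> real \<Rightarrow> real"
  where "stable_approx a n s = (1 - (1 - exp (- (real n powr (- 1 / a)) * (s + 1 / real n))) powr a) ^ n"

lemma gauss_mixture_stable_approx:
  assumes a: "0 < a" "a < 1" and n: "0 < n"
  shows "gauss_mixture (stable_approx a n)"
proof -
  define \<delta> where "\<delta> = real n powr (- 1 / a)"
  have \<delta>: "0 < \<delta>" using n by (simp add: \<delta>_def)
  obtain c F where c: "nonneg_series c F"
    and F: "\<And>w. 0 \<le> w \<Longrightarrow> w < 1 \<Longrightarrow> w * F w = 1 - (1 - w) powr a"
    using sibuya_series[OF a] by blast
  obtain d where d: "nonneg_series d (\<lambda>w. F w ^ n)" using nonneg_series_power[OF c] by blast
  have "(\<lambda>k. (d k * exp (- (real (k + n) * \<delta> / real n))) * exp (- (real (k + n) * \<delta>) * s)) sums stable_approx a n s"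
    if s: "0 \<le> s" for s
  proof -
    define w where "w = exp (- \<delta> * (s + 1 / real n))"
    have w: "0 \<le> w" "w < 1" using \<delta> s n by (auto simp: w_def intro!: mult_pos_pos add_nonneg_pos)
    have "(\<lambda>k. w ^ n * (d k * w ^ k)) sums (w ^ n * F w ^ n)"
      using d w by (intro sums_mult) (auto simp: nonneg_series_def)
    also have "w ^ n * F w ^ n = stable_approx a n s"
      by (simp add: power_mult_distrib[symmetric] F[OF w] stable_approx_def) (simp add: w_def \<delta>_def)
    also have "(\<lambda>k. w ^ n * (d k * w ^ k)) = (\<lambda>k. (d k * exp (- (real (k + n) * \<delta> / real n))) * exp (- (real (k + n) * \<delta>) * s))"
    proof
      fix k
      have "w ^ n * w ^ k = exp (real (k + n) * (- \<delta> * (s + 1 / real n)))"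
        by (simp only: w_def exp_of_nat_mult power_add[symmetric] add.commute)
      also have "\<dots> = exp (- (real (k + n) * \<delta> / real n)) * exp (- (real (k + n) * \<delta>) * s)"
      proof -
        have "real (k + n) * (- \<delta> * (s + 1 / real n))
            = - (real (k + n) * \<delta> / real n) + - (real (k + n) * \<delta>) * s"
          by (simp only: ring_distribs mult_minus_left mult_minus_right) (simp add: algebra_simps add_divide_distrib)
        then show ?thesis by (simp only: exp_add)
      qed
      finally show "w ^ n * (d k * w ^ k) = (d k * exp (- (real (k + n) * \<delta> / real n))) * exp (- (real (k + n) * \<delta>) * s)"
        by (simp add: mult_ac)
    qed
    finally show ?thesis .
  qed
  moreover have "mono (\<lambda>k. real (k + n) * \<delta>)" using \<delta> by (simp add: mono_def)
  moreover have "\<forall>k. 0 \<le> d k * exp (- (real (k + n) * \<delta> / real n)) \<and> 0 < real (k + n) * \<delta>"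
    using d \<delta> n by (auto simp: nonneg_series_def)
  ultimately show ?thesis
    unfolding gauss_mixture_def
    by (intro exI[of _ "\<lambda>k. d k * exp (- (real (k + n) * \<delta> / real n))"]
        exI[of _ "\<lambda>k. real (k + n) * \<delta>"] conjI allI impI) auto
qed

text \<open>The upper bound is uniform in \<open>n\<close> and will dominate the approximating weights. For small arguments it
  follows from \<open>1 - y \<le> exp (- y)\<close>, for large ones from \<open>1 - (1 - w) powr a \<le> w\<close>.\<close>
lemma stable_approx_bounds:
  assumes a: "0 < a" "a < 1" and n: "0 < n" and s: "0 \<le> s"
  shows "0 \<le> stable_approx a n s" and "stable_approx a n s \<le> exp (- ((s / 2) powr a))"
proof -
  define \<delta> where "\<delta> = real n powr (- 1 / a)"
  define t where "t = s + 1 / real n"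
  define y where "y = 1 - exp (- \<delta> * t)"
  have \<delta>: "0 < \<delta>" and t: "0 < t" "s \<le> t" using n s by (auto simp: \<delta>_def t_def add_nonneg_pos)
  have y: "0 < y" "y < 1" using \<delta> t by (auto simp: y_def)
  have eq: "stable_approx a n s = (1 - y powr a) ^ n"
    by (simp add: stable_approx_def y_def \<delta>_def t_def)
  have ya: "y powr a \<le> 1" using y a by (simp add: powr_le1)
  then show "0 \<le> stable_approx a n s" by (simp add: eq)
  have n\<delta>: "real n * \<delta> powr a = 1"
  proof -
    have "\<delta> powr a = real n powr (- 1)" using a by (simp add: \<delta>_def powr_powr del: powr_minus)
    then show ?thesis using n by (simp add: powr_minus)
  qed
  show "stable_approx a n s \<le> exp (- ((s / 2) powr a))"
  proof (cases "\<delta> * t \<le> 1")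
    case True
    define x where "x = \<delta> * t"
    have x: "0 < x" "x \<le> 1" using True \<delta> t by (auto simp: x_def)
    have "exp (- x) \<le> 1 / (1 + x)"
      using exp_ge_add_one_self[of x] x by (simp add: exp_minus inverse_eq_divide frac_le)
    also have "\<dots> \<le> 1 - x / 2" using x mult_left_mono[of x 1 x] by (simp add: field_simps)
    finally have yx: "x / 2 \<le> y" by (simp add: y_def x_def)
    have "1 - y powr a \<le> exp (- (y powr a))" using exp_ge_add_one_self[of "- (y powr a)"] by simp
    then have "stable_approx a n s \<le> exp (- (y powr a)) ^ n"
      unfolding eq using ya by (intro power_mono) auto
    also have "\<dots> = exp (- (real n * y powr a))" by (simp add: exp_of_nat_mult[symmetric])
    also have "\<dots> \<le> exp (- ((t / 2) powr a))"
    proof -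
      have "(x / 2) powr a = \<delta> powr a * (t / 2) powr a"
        using \<delta> t by (simp add: x_def powr_mult[symmetric])
      then have "(t / 2) powr a = real n * (x / 2) powr a"
        using n\<delta> by (simp add: mult.assoc[symmetric])
      also have "\<dots> \<le> real n * y powr a"
        using yx x a by (intro mult_left_mono powr_mono2) auto
      finally show ?thesis by simp
    qed
    also have "\<dots> \<le> exp (- ((s / 2) powr a))" using t s a by (simp add: powr_mono2)
    finally show ?thesis .
  next
    case False
    have "y powr 1 \<le> y powr a" using y a by (intro powr_mono') auto
    then have "1 - y powr a \<le> exp (- \<delta> * t)" using y by (simp add: y_def)
    then have "stable_approx a n s \<le> exp (- \<delta> * t) ^ n"
      unfolding eq using ya by (intro power_mono) auto
    also have "\<dots> = exp (- (real n * (\<delta> * t)))" by (simp add: exp_of_nat_mult[symmetric])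
    also have "\<dots> \<le> exp (- (t powr a))"
    proof -
      have "t powr a = real n * (\<delta> * t) powr a"
        using n\<delta> \<delta> t by (simp add: powr_mult mult.assoc[symmetric])
      also have "\<dots> \<le> real n * (\<delta> * t) powr 1"
        using False a by (intro mult_left_mono powr_mono) auto
      finally show ?thesis using \<delta> t by simp
    qed
    also have "\<dots> \<le> exp (- ((s / 2) powr a))" using t s a by (simp add: powr_mono2)
    finally show ?thesis .
  qed
qed

lemma stable_approx_tendsto:
  assumes a: "0 < a" "a < 1" and s: "0 \<le> s"
  shows "(\<lambda>n. stable_approx a n s) \<longlonglongrightarrow> exp (- (s powr a))"
proof (cases "s = 0")
  case True
  have "(\<lambda>n. 1 - real n powr (- a)) \<longlonglongrightarrow> 1" using a by real_asymp
  moreover have "\<forall>\<^sub>F n in sequentially. 1 - real n powr (- a) \<le> stable_approx a n 0"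
    using eventually_gt_at_top[of 0]
  proof eventually_elim
    case (elim n)
    define x where "x = real n powr (- 1 / a) * (1 / real n)"
    have x: "0 < x" using elim by (simp add: x_def)
    have "x powr a = (real n powr (- 1 / a)) powr a * (1 / real n) powr a"
      using elim by (simp add: x_def powr_mult[symmetric])
    also have "\<dots> = real n powr (- 1) * real n powr (- a)"
      using elim a by (simp add: powr_powr powr_minus_divide[symmetric] powr_divide)
    finally have xa: "real n * x powr a = real n powr (- a)"
      using elim by (simp add: powr_minus field_simps)
    have "(1 - exp (- x)) powr a \<le> x powr a"
      using x exp_ge_add_one_self[of "- x"] a by (intro powr_mono2) auto
    then have "1 - real n powr (- a) \<le> 1 + real n * (- ((1 - exp (- x)) powr a))"
      using xa elim mult_left_mono[of "(1 - exp (- x)) powr a" "x powr a" "real n"] by simp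
    also have "\<dots> \<le> (1 + (- ((1 - exp (- x)) powr a))) ^ n"
      using x a by (intro Bernoulli_inequality) (auto simp: powr_le1)
    finally show ?case by (simp add: stable_approx_def x_def)
  qed
  moreover have "\<forall>\<^sub>F n in sequentially. stable_approx a n 0 \<le> 1"
    using eventually_gt_at_top[of 0] by eventually_elim (use stable_approx_bounds(2)[OF a _ order_refl] in simp)
  ultimately show ?thesis
    using True tendsto_sandwich[of "\<lambda>n. 1 - real n powr (- a)" "\<lambda>n. stable_approx a n 0" sequentially "\<lambda>_. 1" 1]
    by simp
next
  case False
  then have "0 < s" using s by simp
  then show ?thesis unfolding stable_approx_def using a by real_asymp
qed

section \<open>From Gaussian chains to mixtures\<close>

text \<open>A property of families of edge factors that holds for Gaussians and survives mixing in one edge at a time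
  holds for all families of mixtures. Both bounds are transferred from Gaussian chains in this way.\<close>
lemma mixing_principle:
  fixes P :: "('e \<Rightarrow> real \<Rightarrow> ennreal) \<Rightarrow> bool"
  assumes fin: "finite E"
    and cong: "\<And>f g. P f \<Longrightarrow> (\<And>e s. e \<in> E \<Longrightarrow> 0 \<le> s \<Longrightarrow> f e s = g e s) \<Longrightarrow> P g"
    and base: "\<And>\<kappa>. \<forall>e\<in>E. 0 < \<kappa> e \<Longrightarrow> P (\<lambda>e s. ennreal (exp (- \<kappa> e * s)))"
    and step: "\<And>f e p \<mu>. e \<in> E \<Longrightarrow> (\<forall>k. 0 < \<mu> k) \<Longrightarrow> mono \<mu> \<Longrightarrow> (\<Sum>k. p k) \<le> 1 \<Longrightarrow>
      (\<And>k::nat. P (f(e := \<lambda>s. ennreal (exp (- \<mu> k * s))))) \<Longrightarrow>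
      P (f(e := \<lambda>s. \<Sum>k. p k * ennreal (exp (- \<mu> k * s))))"
    and mix: "\<And>e. e \<in> E \<Longrightarrow> gauss_mixture (F e)" "\<And>e. e \<in> E \<Longrightarrow> F e 0 \<le> 1"
  shows "P (\<lambda>e s. ennreal (F e s))"
proof -
  have "P (\<lambda>e s. ennreal (if e \<in> S then F e s else exp (- \<kappa> e * s)))"
    if "finite S" "S \<subseteq> E" "\<forall>e\<in>E. 0 < \<kappa> e" for S \<kappa>
    using that
  proof (induction S arbitrary: \<kappa> rule: finite_induct)
    case empty
    then show ?case using base[of \<kappa>] by simp
  next
    case (insert e S)
    have e: "e \<in> E" using insert.prems by simp
    obtain p \<mu> where p: "\<forall>k::nat. 0 \<le> p k \<and> 0 < \<mu> k" "mono \<mu>"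
      "\<And>s. 0 \<le> s \<Longrightarrow> (\<lambda>k. p k * exp (- \<mu> k * s)) sums F e s"
      using mix(1)[OF e] unfolding gauss_mixture_def by blast
    have sum: "(\<Sum>k. ennreal (p k) * ennreal (exp (- \<mu> k * s))) = ennreal (F e s)" if "0 \<le> s" for s
      using suminf_ennreal_eq[OF _ p(3)[OF that]] p(1) by (simp add: ennreal_mult)
    define f where "f = (\<lambda>e' s. ennreal (if e' \<in> S then F e' s else exp (- \<kappa> e' * s)))"
    have "P (f(e := \<lambda>s. ennreal (exp (- \<mu> k * s))))" for k
    proof (rule cong)
      show "P (\<lambda>e' s. ennreal (if e' \<in> S then F e' s else exp (- (\<kappa>(e := \<mu> k)) e' * s)))"
        using insert.prems p(1) by (intro insert.IH) auto
    qed (use insert.hyps in \<open>auto simp: f_def\<close>)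
    moreover have "(\<Sum>k. ennreal (p k)) \<le> 1"
      using sum[of 0] mix(2)[OF e] by (simp add: ennreal_le_1)
    ultimately have "P (f(e := \<lambda>s. \<Sum>k. ennreal (p k) * ennreal (exp (- \<mu> k * s))))"
      using p e by (intro step) auto
    then show ?case
      by (rule cong) (auto simp: f_def sum[unfolded mult_minus_left])
  qed
  from this[OF fin order_refl, of "\<lambda>_. 1"] show ?thesis
    by (rule cong) auto
qed

lemma nn_integral_mixture:
  fixes p :: "nat \<Rightarrow> ennreal"
  shows "(\<integral>\<^sup>+x. A x * (\<Sum>k. p k * G k x) \<partial>count_space X) = (\<Sum>k. p k * (\<integral>\<^sup>+x. A x * G k x \<partial>count_space X))"
proof -
  have "(\<integral>\<^sup>+x. A x * (\<Sum>k. p k * G k x) \<partial>count_space X) = (\<integral>\<^sup>+x. (\<Sum>k. p k * (A x * G k x)) \<partial>count_space X)"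
    by (simp add: ennreal_suminf_cmult[symmetric] mult_ac
        del: ennreal_suminf_cmult ennreal_suminf_multc)
  also have "\<dots> = (\<Sum>k. \<integral>\<^sup>+x. p k * (A x * G k x) \<partial>count_space X)"
    by (rule nn_integral_suminf) simp
  finally show ?thesis by (simp add: nn_integral_cmult)
qed

text \<open>A Riemann sum with mesh \<open>h s\<close> for the integral of \<open>f\<close> over \<open>[s, \<infinity>)\<close>. On Gaussian factors that integral is
  division by the rate, since the integral of \<open>exp (- k * t)\<close> is \<open>exp (- k * s) / k\<close>; unlike division by a rate, the
  sum makes sense for every \<open>f\<close> and is linear in \<open>f\<close>.\<close>
definition tail_sum :: "(real \<Rightarrow> real) \<Rightarrow> (real \<Rightarrow> ennreal) \<Rightarrow> real \<Rightarrow> ennreal"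
  where "tail_sum h f s = ennreal (h s) * (\<Sum>m. f (s + real m * h s))"

lemma tail_sum_mixture:
  fixes p :: "nat \<Rightarrow> ennreal"
  shows "tail_sum h (\<lambda>s. \<Sum>k. p k * G k s) s = (\<Sum>k. p k * tail_sum h (G k) s)"
proof -
  have "(\<Sum>m. \<Sum>k. p k * G k (s + real m * h s)) = (\<Sum>k. p k * (\<Sum>m. G k (s + real m * h s)))"
    using nn_integral_mixture[where A = "\<lambda>_. 1" and p = p and G = "\<lambda>k m. G k (s + real m * h s)" and X = UNIV]
    by (simp add: nn_integral_count_space_nat)
  then show ?thesis
    by (simp add: tail_sum_def ennreal_suminf_cmult[symmetric] mult_ac
        del: ennreal_suminf_cmult ennreal_suminf_multc)
qed

lemma inverse_exp_le_tail_sum: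
  assumes "0 < k" and "0 < h s"
  shows "ennreal (exp (- k * s) / k) \<le> tail_sum h (\<lambda>s. ennreal (exp (- k * s))) s"
proof -
  \<comment> \<open>The tail sum is a geometric series with ratio \<open>r\<close>, and \<open>1 - r \<le> k * h s\<close>.\<close>
  define r where "r = exp (- k * h s)"
  have r: "0 < r" "r < 1" using assms by (auto simp: r_def)
  have "(\<lambda>m. exp (- k * s) * r ^ m) sums (exp (- k * s) * (1 / (1 - r)))"
    using r by (intro sums_mult geometric_sums) auto
  moreover have "exp (- k * s) * r ^ m = exp (- k * (s + real m * h s))" for m
    by (simp add: r_def exp_of_nat_mult[symmetric] exp_add[symmetric] algebra_simps)
  ultimately have "(\<Sum>m. ennreal (exp (- k * (s + real m * h s)))) = ennreal (exp (- k * s) * (1 / (1 - r)))"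
    by (intro suminf_ennreal_eq) auto
  then have "tail_sum h (\<lambda>s. ennreal (exp (- k * s))) s = ennreal (h s * (exp (- k * s) * (1 / (1 - r))))"
    using assms by (simp add: tail_sum_def ennreal_mult'[symmetric])
  moreover have "1 / k \<le> h s / (1 - r)"
    using exp_ge_add_one_self[of "- k * h s"] assms r by (simp add: r_def field_simps)
  then have "exp (- k * s) * (1 / k) \<le> exp (- k * s) * (h s / (1 - r))"
    by (intro mult_left_mono) auto
  ultimately show ?thesis by (simp add: ennreal_leI mult_ac)
qed

definition edge_prod :: "(int \<times> int) set \<Rightarrow> (int \<times> int \<Rightarrow> real \<Rightarrow> ennreal) \<Rightarrow> (int \<Rightarrow> int) \<Rightarrow> ennreal"
  where "edge_prod S f \<phi> = (\<Prod>e\<in>S. f e ((grad \<phi> e)\<^sup>2))"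

lemma edge_prod_cong:
  "(\<And>e s. e \<in> S \<Longrightarrow> 0 \<le> s \<Longrightarrow> f e s = g e s) \<Longrightarrow> edge_prod S f \<phi> = edge_prod S g \<phi>"
  unfolding edge_prod_def by (intro prod.cong) auto

lemma edge_prod_upd:
  assumes "finite S" and "e \<in> S"
  shows "edge_prod S (f(e := g)) \<phi> = edge_prod (S - {e}) f \<phi> * g ((grad \<phi> e)\<^sup>2)"
  unfolding edge_prod_def using assms
  by (subst prod.remove[of _ e]) (auto simp: mult.commute intro!: arg_cong2[where f = "(*)"] prod.cong)

lemma edge_prod_upd_other:
  assumes "e \<notin> S"
  shows "edge_prod S (f(e := g)) \<phi> = edge_prod S f \<phi>"
  unfolding edge_prod_def using assms by (intro prod.cong) auto

lemma edge_prod_ennreal: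
  assumes "\<And>e s. e \<in> S \<Longrightarrow> 0 \<le> s \<Longrightarrow> 0 \<le> f e s"
  shows "edge_prod S (\<lambda>e s. ennreal (f e s)) \<phi> = ennreal (\<Prod>e\<in>S. f e ((grad \<phi> e)\<^sup>2))"
  unfolding edge_prod_def using assms by (intro prod_ennreal) auto

lemma edge_prod_exp:
  "edge_prod (edges N) (\<lambda>e s. ennreal (exp (- \<kappa> e * s))) \<phi> = ennreal (gauss N \<kappa> \<phi>)"
  by (subst edge_prod_ennreal) (auto simp: shifted_gauss_def exp_sum sum_negf[symmetric])

text \<open>The bound of \<open>gauss_second_moment\<close> with the resistance \<open>1 / \<kappa> e\<close> absorbed into the edge factor. In this form
  both sides are linear in each edge factor separately.\<close>
definition upper_ineq :: "nat \<Rightarrow> (int \<times> int \<Rightarrow> real) \<Rightarrow> (int \<times> int \<Rightarrow> real \<Rightarrow> real) \<Rightarrow> (int \<times> int \<Rightarrow> real \<Rightarrow> ennreal) \<Rightarrow> bool"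
  where "upper_ineq N \<theta> h f \<longleftrightarrow>
    (\<integral>\<^sup>+\<phi>. ennreal ((\<Sum>e\<in>edges N. \<theta> e * grad \<phi> e)\<^sup>2) * edge_prod (edges N) f \<phi> \<partial>count_space (Omega N))
    \<le> (\<Sum>e\<in>edges N. ennreal ((\<theta> e)\<^sup>2 / 2) * (\<integral>\<^sup>+\<phi>. edge_prod (edges N - {e}) f \<phi>
        * tail_sum (h e) (f e) ((grad \<phi> e)\<^sup>2) \<partial>count_space (Omega N)))"

lemma upper_ineq_gauss:
  assumes h: "\<And>e s. e \<in> edges N \<Longrightarrow> 0 \<le> s \<Longrightarrow> 0 < h e s" and \<kappa>: "\<forall>e\<in>edges N. 0 < \<kappa> e"
  shows "upper_ineq N \<theta> h (\<lambda>e s. ennreal (exp (- \<kappa> e * s)))"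
proof -
  let ?M = "count_space (Omega N)" and ?f = "\<lambda>e s. ennreal (exp (- \<kappa> e * s))"
  define X where "X = (\<lambda>\<phi>. \<Sum>e\<in>edges N. \<theta> e * grad \<phi> e)"
  define Z where "Z = (LINT \<phi>|?M. gauss N \<kappa> \<phi>)"
  have intX: "integrable ?M (\<lambda>\<phi>. (X \<phi>)\<^sup>2 * gauss N \<kappa> \<phi>)"
    unfolding X_def using linear_grad_sq_le_moment_bound by (rule integrable_gauss_times[OF \<kappa>])
  have Z: "(\<integral>\<^sup>+\<phi>. ennreal (gauss N \<kappa> \<phi>) \<partial>?M) = ennreal Z"
    unfolding Z_def by (rule nn_integral_eq_integral[OF integrable_gauss[OF \<kappa>]]) (simp add: shifted_gauss_def)
  have Z0: "0 \<le> Z" unfolding Z_def using shifted_gauss_pos[OF \<kappa>] by simp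
  have "(\<integral>\<^sup>+\<phi>. ennreal ((X \<phi>)\<^sup>2) * edge_prod (edges N) ?f \<phi> \<partial>?M) = (\<integral>\<^sup>+\<phi>. ennreal ((X \<phi>)\<^sup>2 * gauss N \<kappa> \<phi>) \<partial>?M)"
    unfolding edge_prod_exp by (simp add: ennreal_mult')
  also have "\<dots> = ennreal (LINT \<phi>|?M. (X \<phi>)\<^sup>2 * gauss N \<kappa> \<phi>)"
    by (rule nn_integral_eq_integral[OF intX]) (simp add: shifted_gauss_def)
  also have "\<dots> \<le> ennreal ((\<Sum>e\<in>edges N. (\<theta> e)\<^sup>2 / \<kappa> e) / 2 * Z)"
    unfolding X_def Z_def by (rule ennreal_leI[OF gauss_second_moment[OF \<kappa>]])
  also have "\<dots> = (\<Sum>e\<in>edges N. ennreal ((\<theta> e)\<^sup>2 / 2) * ennreal (1 / \<kappa> e * Z))"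
  proof -
    have "(\<Sum>e\<in>edges N. ennreal ((\<theta> e)\<^sup>2 / 2) * ennreal (1 / \<kappa> e * Z)) = (\<Sum>e\<in>edges N. ennreal ((\<theta> e)\<^sup>2 / 2 * (1 / \<kappa> e * Z)))"
      by (intro sum.cong refl ennreal_mult'[symmetric]) simp
    also have "\<dots> = ennreal (\<Sum>e\<in>edges N. (\<theta> e)\<^sup>2 / 2 * (1 / \<kappa> e * Z))"
    proof (rule sum_ennreal)
      fix e assume "e \<in> edges N"
      then have "0 < \<kappa> e" using \<kappa> by blast
      then show "0 \<le> (\<theta> e)\<^sup>2 / 2 * (1 / \<kappa> e * Z)" using Z0 by simp
    qed
    also have "(\<Sum>e\<in>edges N. (\<theta> e)\<^sup>2 / 2 * (1 / \<kappa> e * Z)) = (\<Sum>e\<in>edges N. (\<theta> e)\<^sup>2 / \<kappa> e) / 2 * Z"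
      by (simp add: sum_divide_distrib sum_distrib_left mult_ac)
    finally show ?thesis by simp
  qed
  also have "\<dots> \<le> (\<Sum>e\<in>edges N. ennreal ((\<theta> e)\<^sup>2 / 2) * (\<integral>\<^sup>+\<phi>. edge_prod (edges N - {e}) ?f \<phi>
        * tail_sum (h e) (?f e) ((grad \<phi> e)\<^sup>2) \<partial>?M))"
  proof (intro sum_mono mult_left_mono)
    fix e assume e: "e \<in> edges N"
    have "ennreal (1 / \<kappa> e * Z) = (\<integral>\<^sup>+\<phi>. ennreal (1 / \<kappa> e) * ennreal (gauss N \<kappa> \<phi>) \<partial>?M)"
    proof -
      have "0 \<le> 1 / \<kappa> e" using \<kappa> e by (simp add: less_imp_le)
      from ennreal_mult'[OF this, of Z] show ?thesis
        by (subst nn_integral_cmult) (simp_all only: Z measurable_count_space_eq1 space_borel Pi_UNIV UNIV_I)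
    qed
    also have "\<dots> \<le> (\<integral>\<^sup>+\<phi>. edge_prod (edges N - {e}) ?f \<phi> * tail_sum (h e) (?f e) ((grad \<phi> e)\<^sup>2) \<partial>?M)"
    proof (rule nn_integral_mono)
      fix \<phi>
      let ?s = "(grad \<phi> e)\<^sup>2"
      have "ennreal (gauss N \<kappa> \<phi>) = edge_prod (edges N - {e}) ?f \<phi> * ?f e ?s"
        unfolding edge_prod_exp[symmetric] edge_prod_def using e by (subst prod.remove[of _ e]) (auto simp: mult.commute)
      then have "ennreal (1 / \<kappa> e) * ennreal (gauss N \<kappa> \<phi>) = edge_prod (edges N - {e}) ?f \<phi> * ennreal (exp (- \<kappa> e * ?s) / \<kappa> e)"
      proof -
        have "0 \<le> 1 / \<kappa> e" using \<kappa> e by (simp add: less_imp_le)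
        from ennreal_mult'[OF this, of "exp (- \<kappa> e * ?s)"]
        have "ennreal (exp (- \<kappa> e * ?s) / \<kappa> e) = ennreal (1 / \<kappa> e) * ennreal (exp (- \<kappa> e * ?s))" by simp
        then show ?thesis using \<open>ennreal (gauss N \<kappa> \<phi>) = _\<close> by (simp only: mult_ac)
      qed
      also have "\<dots> \<le> edge_prod (edges N - {e}) ?f \<phi> * tail_sum (h e) (?f e) ?s"
        using \<kappa> e h[OF e, of ?s] by (intro mult_left_mono inverse_exp_le_tail_sum) auto
      finally show "ennreal (1 / \<kappa> e) * ennreal (gauss N \<kappa> \<phi>)
          \<le> edge_prod (edges N - {e}) ?f \<phi> * tail_sum (h e) (?f e) ?s" .
    qed
    finally show "ennreal (1 / \<kappa> e * Z) \<le> (\<integral>\<^sup>+\<phi>. edge_prod (edges N - {e}) ?f \<phi>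
        * tail_sum (h e) (?f e) ((grad \<phi> e)\<^sup>2) \<partial>?M)" .
  qed simp
  finally show ?thesis unfolding upper_ineq_def X_def .
qed

lemma upper_ineq_mixture:
  assumes e0: "e0 \<in> edges N" and G: "\<And>k. upper_ineq N \<theta> h (f(e0 := G k))"
  shows "upper_ineq N \<theta> h (f(e0 := \<lambda>s. \<Sum>k. p k * G k s))"
proof -
  let ?M = "count_space (Omega N)"
  define L where "L = (\<lambda>g. \<integral>\<^sup>+\<phi>. ennreal ((\<Sum>e\<in>edges N. \<theta> e * grad \<phi> e)\<^sup>2) * edge_prod (edges N) (f(e0 := g)) \<phi> \<partial>?M)"
  define R where "R = (\<lambda>e g. \<integral>\<^sup>+\<phi>. edge_prod (edges N - {e}) (f(e0 := g)) \<phi>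
        * tail_sum (h e) ((f(e0 := g)) e) ((grad \<phi> e)\<^sup>2) \<partial>?M)"
  let ?g = "\<lambda>s. \<Sum>k. p k * G k s"
  have L: "L ?g = (\<Sum>k. p k * L (G k))"
    unfolding L_def edge_prod_upd[OF finite_edges e0] mult.assoc[symmetric] by (rule nn_integral_mixture)
  have R: "R e ?g = (\<Sum>k. p k * R e (G k))" for e
  proof (cases "e = e0")
    case True
    then show ?thesis unfolding R_def by (simp add: edge_prod_upd_other tail_sum_mixture nn_integral_mixture)
  next
    case False
    then have *: "edge_prod (edges N - {e}) (f(e0 := g)) \<phi> * tail_sum (h e) ((f(e0 := g)) e) ((grad \<phi> e)\<^sup>2)
        = edge_prod (edges N - {e} - {e0}) f \<phi> * tail_sum (h e) (f e) ((grad \<phi> e)\<^sup>2) * g ((grad \<phi> e0)\<^sup>2)" for g \<phi>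
      using e0 by (subst edge_prod_upd) (auto simp: mult_ac)
    show ?thesis unfolding R_def * by (rule nn_integral_mixture)
  qed
  have "L ?g \<le> (\<Sum>k. p k * (\<Sum>e\<in>edges N. ennreal ((\<theta> e)\<^sup>2 / 2) * R e (G k)))"
    unfolding L using G by (intro suminf_le mult_left_mono) (auto simp: upper_ineq_def L_def R_def)
  also have "\<dots> = (\<Sum>e\<in>edges N. ennreal ((\<theta> e)\<^sup>2 / 2) * (\<Sum>k. p k * R e (G k)))"
    unfolding ennreal_suminf_cmult[symmetric] by (subst suminf_sum[symmetric]) (auto simp: sum_distrib_left mult_ac)
  finally show ?thesis by (simp only: upper_ineq_def L_def R_def R[unfolded R_def, symmetric])
qed

lemma upper_ineq_gauss_mixture:
  assumes h: "\<And>e s. e \<in> edges N \<Longrightarrow> 0 \<le> s \<Longrightarrow> 0 < h e s"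
    and F: "\<And>e. e \<in> edges N \<Longrightarrow> gauss_mixture (F e)" "\<And>e. e \<in> edges N \<Longrightarrow> F e 0 \<le> 1"
  shows "upper_ineq N \<theta> h (\<lambda>e s. ennreal (F e s))"
proof (rule mixing_principle[where E = "edges N" and P = "upper_ineq N \<theta> h" and F = F])
  show "upper_ineq N \<theta> h (\<lambda>e s. ennreal (exp (- \<kappa> e * s)))" if "\<forall>e\<in>edges N. 0 < \<kappa> e" for \<kappa>
    by (rule upper_ineq_gauss[OF h that])
  show "upper_ineq N \<theta> h (f(e := \<lambda>s. \<Sum>k. p k * ennreal (exp (- \<mu> k * s))))"
    if "e \<in> edges N" "\<And>k::nat. upper_ineq N \<theta> h (f(e := \<lambda>s. ennreal (exp (- \<mu> k * s))))" for f e p \<mu>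
    by (rule upper_ineq_mixture[OF that])
  show "upper_ineq N \<theta> h g" if f: "upper_ineq N \<theta> h f" and eq: "\<And>e s. e \<in> edges N \<Longrightarrow> 0 \<le> s \<Longrightarrow> f e s = g e s" for f g
  proof -
    have 1: "edge_prod (edges N) g \<phi> = edge_prod (edges N) f \<phi>"
      "edge_prod (edges N - {e}) g \<phi> = edge_prod (edges N - {e}) f \<phi>" for \<phi> e
      using eq by (intro edge_prod_cong; simp)+
    have 2: "tail_sum (h e) (g e) ((grad \<phi> e)\<^sup>2) = tail_sum (h e) (f e) ((grad \<phi> e)\<^sup>2)" if "e \<in> edges N" for e \<phi>
      unfolding tail_sum_def using that eq h[OF that, of "(grad \<phi> e)\<^sup>2"]
      by (intro arg_cong2[where f = "(*)"] suminf_cong refl) (auto intro!: eq[symmetric] add_nonneg_nonneg)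
    show ?thesis using f unfolding upper_ineq_def by (simp add: 1 2 cong: sum.cong)
  qed
qed (use F in auto)

text \<open>Chebyshev's sum inequality: two decreasing functions of the same random variable are positively
  correlated. The weights may have total mass less than \<open>1\<close>.\<close>
lemma chebyshev_suminf:
  fixes p B C :: "nat \<Rightarrow> ennreal"
  assumes "antimono B" and "antimono C" and "(\<Sum>k. p k) \<le> 1"
  shows "(\<Sum>k. p k * B k) * (\<Sum>k. p k * C k) \<le> (\<Sum>k. p k * (B k * C k))"
proof -
  define b c S where "b = (\<Sum>k. p k * B k)" and "c = (\<Sum>k. p k * C k)" and "S = (\<Sum>k. p k * (B k * C k))"
  have key: "B k * C l + B l * C k \<le> B k * C k + B l * C l" for k l
  proof -
    have *: "B k * C l + B l * C k \<le> B k * C k + B l * C l" if kl: "k \<le> l" for k l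
    proof -
      obtain x where x: "B k = B l + x" using antimonoD[OF assms(1) kl] le_iff_add by blast
      obtain y where y: "C k = C l + y" using antimonoD[OF assms(2) kl] le_iff_add by blast
      have "B k * C l + B l * C k + x * y = B k * C k + B l * C l"
        unfolding x y by (simp add: algebra_simps)
      then show ?thesis by (metis le_iff_add)
    qed
    show ?thesis using *[of k l] *[of l k] by (cases "k \<le> l") (auto simp: add.commute)
  qed
  have prod: "(\<Sum>k. p k * (\<Sum>l. p l * (x k * y l))) = (\<Sum>k. p k * x k) * (\<Sum>l. p l * y l)" for x y :: "nat \<Rightarrow> ennreal"
  proof -
    have "(\<Sum>l. p l * (x k * y l)) = x k * (\<Sum>l. p l * y l)" for k
      unfolding ennreal_suminf_cmult[symmetric] by (simp only: mult.left_commute)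
    then show ?thesis by (simp add: mult.assoc[symmetric])
  qed
  have "2 * (b * c) = (\<Sum>k. p k * (\<Sum>l. p l * (B k * C l))) + (\<Sum>k. p k * (\<Sum>l. p l * (C k * B l)))"
    unfolding prod b_def c_def by (simp add: mult_2 mult.commute)
  also have "\<dots> = (\<Sum>k. p k * (\<Sum>l. p l * (B k * C l + B l * C k)))"
    by (simp add: suminf_add[symmetric] distrib_left mult_ac)
  also have "\<dots> \<le> (\<Sum>k. p k * (\<Sum>l. p l * (B k * C k + B l * C l)))"
    by (intro suminf_le mult_left_mono key) auto
  also have "\<dots> = (\<Sum>k. p k * (\<Sum>l. p l * ((B k * C k) * 1))) + (\<Sum>k. p k * (\<Sum>l. p l * (1 * (B l * C l))))"
    by (simp add: suminf_add[symmetric] distrib_left)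
  also have "\<dots> = 2 * (S * (\<Sum>k. p k))"
    unfolding prod S_def by (simp add: mult_2 mult.commute)
  also have "\<dots> \<le> 2 * (S * 1)"
    using assms(3) by (intro mult_left_mono) auto
  finally have "2 * (b * c) \<le> 2 * S" by simp
  then show ?thesis unfolding b_def[symmetric] c_def[symmetric] S_def[symmetric]
    by (subst (asm) ennreal_mult_le_mult_iff) auto
qed

context cut_system
begin

definition lower_ineq :: "(int \<times> int \<Rightarrow> real \<Rightarrow> ennreal) \<Rightarrow> bool"
  where "lower_ineq f \<longleftrightarrow>
    ennreal (2 / 3) * (\<Sum>i\<in>I. \<Prod>e\<in>edges N. f e (cut_cost e i)) * (\<integral>\<^sup>+\<phi>. edge_prod (edges N) f \<phi> \<partial>count_space (Omega N))
    \<le> (\<integral>\<^sup>+\<phi>. ennreal ((real_of_int (\<phi> 0))\<^sup>2) * edge_prod (edges N) f \<phi> \<partial>count_space (Omega N))"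

lemma lower_ineq_gauss:
  assumes \<kappa>: "\<forall>e\<in>edges N. 0 < \<kappa> e"
  shows "lower_ineq (\<lambda>e s. ennreal (exp (- \<kappa> e * s)))"
proof -
  let ?M = "count_space (Omega N)"
  define Z where "Z = (LINT \<phi>|?M. gauss N \<kappa> \<phi>)"
  have Z: "(\<integral>\<^sup>+\<phi>. ennreal (gauss N \<kappa> \<phi>) \<partial>?M) = ennreal Z"
    unfolding Z_def by (rule nn_integral_eq_integral[OF integrable_gauss[OF \<kappa>]]) (simp add: shifted_gauss_def)
  have int: "integrable ?M (\<lambda>\<phi>. (real_of_int (\<phi> 0))\<^sup>2 * gauss N \<kappa> \<phi>)"
    using integrable_pd_gauss(2)[OF \<kappa>, of "\<lambda>_. 1"] by simp
  have "(\<integral>\<^sup>+\<phi>. ennreal ((real_of_int (\<phi> 0))\<^sup>2 * gauss N \<kappa> \<phi>) \<partial>?M)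
      = ennreal (LINT \<phi>|?M. (real_of_int (\<phi> 0))\<^sup>2 * gauss N \<kappa> \<phi>)"
    by (rule nn_integral_eq_integral[OF int]) (simp add: shifted_gauss_def)
  also have "\<dots> \<ge> ennreal (2 / 3 * (\<Sum>i\<in>I. exp (- (\<Sum>e\<in>edges N. \<kappa> e * cut_cost e i))) * Z)"
    unfolding Z_def by (rule ennreal_leI[OF gauss_cut_bound[OF \<kappa>]])
  also have "ennreal (2 / 3 * (\<Sum>i\<in>I. exp (- (\<Sum>e\<in>edges N. \<kappa> e * cut_cost e i))) * Z)
      = ennreal (2 / 3) * (\<Sum>i\<in>I. \<Prod>e\<in>edges N. ennreal (exp (- \<kappa> e * cut_cost e i))) * ennreal Z"
  proof -
    have "(\<Sum>i\<in>I. \<Prod>e\<in>edges N. ennreal (exp (- \<kappa> e * cut_cost e i)))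
        = ennreal (\<Sum>i\<in>I. exp (- (\<Sum>e\<in>edges N. \<kappa> e * cut_cost e i)))"
      by (subst sum_ennreal[symmetric]) (auto simp: prod_ennreal prod_nonneg exp_sum sum_negf[symmetric])
    moreover define S where "S = (\<Sum>i\<in>I. exp (- (\<Sum>e\<in>edges N. \<kappa> e * cut_cost e i)))"
    moreover have "ennreal (2 / 3 * S * Z) = ennreal (2 / 3 * S) * ennreal Z"
      by (rule ennreal_mult') (simp add: S_def sum_nonneg)
    moreover have "ennreal (2 / 3 * S) = ennreal (2 / 3) * ennreal S"
      by (rule ennreal_mult') simp
    ultimately show ?thesis by simp
  qed
  finally show ?thesis
    unfolding lower_ineq_def edge_prod_exp by (simp add: Z ennreal_mult')
qed

text \<open>Here both factors on the left depend on the rate that is averaged. Both decrease with it, the cut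
  term explicitly and the partition function because the weight does, so by Chebyshev's inequality
  averaging the product dominates the product of the averages.\<close>
lemma lower_ineq_mixture:
  assumes e0: "e0 \<in> edges N" and mono: "mono \<mu>" and p: "(\<Sum>k. p k) \<le> 1"
    and G: "\<And>k. lower_ineq (f(e0 := \<lambda>s. ennreal (exp (- \<mu> k * s))))"
  shows "lower_ineq (f(e0 := \<lambda>s. \<Sum>k. p k * ennreal (exp (- \<mu> k * s))))"
proof -
  let ?M = "count_space (Omega N)" and ?G = "\<lambda>k s. ennreal (exp (- \<mu> k * s))"
  let ?g = "\<lambda>s. \<Sum>k. p k * ?G k s"
  define B where "B = (\<lambda>g. \<Sum>i\<in>I. \<Prod>e\<in>edges N. (f(e0 := g)) e (cut_cost e i))"
  define C where "C = (\<lambda>g. \<integral>\<^sup>+\<phi>. edge_prod (edges N) (f(e0 := g)) \<phi> \<partial>?M)"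
  define A where "A = (\<lambda>g. \<integral>\<^sup>+\<phi>. ennreal ((real_of_int (\<phi> 0))\<^sup>2) * edge_prod (edges N) (f(e0 := g)) \<phi> \<partial>?M)"
  have B_eq: "B g = (\<Sum>i\<in>I. (\<Prod>e\<in>edges N - {e0}. f e (cut_cost e i)) * g (cut_cost e0 i))" for g
    unfolding B_def using e0
    by (subst prod.remove[of _ e0]) (auto simp: mult.commute intro!: sum.cong arg_cong2[where f = "(*)"] prod.cong)
  have B: "B ?g = (\<Sum>k. p k * B (?G k))"
    unfolding B_eq sum_distrib_left
    by (subst suminf_sum) (auto simp: ennreal_suminf_cmult[symmetric] mult_ac
        del: ennreal_suminf_cmult ennreal_suminf_multc)
  have C: "C ?g = (\<Sum>k. p k * C (?G k))"
    unfolding C_def edge_prod_upd[OF finite_edges e0] by (rule nn_integral_mixture)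
  have A: "A ?g = (\<Sum>k. p k * A (?G k))"
    unfolding A_def edge_prod_upd[OF finite_edges e0] mult.assoc[symmetric] by (rule nn_integral_mixture)
  have G_anti: "?G l s \<le> ?G k s" if "k \<le> l" "0 \<le> s" for k l s
    using monoD[OF mono that(1)] that(2) by (intro ennreal_leI) (simp add: mult_right_mono)
  have "antimono (\<lambda>k. B (?G k))"
    unfolding B_eq by (intro antimonoI sum_mono mult_left_mono G_anti cut_cost_nonneg) auto
  moreover have "antimono (\<lambda>k. C (?G k))"
    unfolding C_def edge_prod_upd[OF finite_edges e0]
    by (intro antimonoI nn_integral_mono mult_left_mono G_anti) auto
  ultimately have "B ?g * C ?g \<le> (\<Sum>k. p k * (B (?G k) * C (?G k)))"
    unfolding B C using p by (rule chebyshev_suminf)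
  then have "ennreal (2 / 3) * (B ?g * C ?g) \<le> ennreal (2 / 3) * (\<Sum>k. p k * (B (?G k) * C (?G k)))"
    by (intro mult_left_mono) auto
  also have "\<dots> = (\<Sum>k. p k * (ennreal (2 / 3) * B (?G k) * C (?G k)))"
    by (simp add: ennreal_suminf_cmult[symmetric] mult_ac
        del: ennreal_suminf_cmult ennreal_suminf_multc)
  also have "\<dots> \<le> A ?g"
    unfolding A using G by (intro suminf_le mult_left_mono) (auto simp: lower_ineq_def A_def B_def C_def)
  finally show ?thesis by (simp add: lower_ineq_def A_def B_def C_def mult.assoc)
qed

lemma lower_ineq_gauss_mixture:
  assumes F: "\<And>e. e \<in> edges N \<Longrightarrow> gauss_mixture (F e)" "\<And>e. e \<in> edges N \<Longrightarrow> F e 0 \<le> 1"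
  shows "lower_ineq (\<lambda>e s. ennreal (F e s))"
proof (rule mixing_principle[where E = "edges N" and P = lower_ineq and F = F])
  show "lower_ineq g" if f: "lower_ineq f" and eq: "\<And>e s. e \<in> edges N \<Longrightarrow> 0 \<le> s \<Longrightarrow> f e s = g e s" for f g
  proof -
    have 1: "edge_prod (edges N) g \<phi> = edge_prod (edges N) f \<phi>" for \<phi>
      using eq by (intro edge_prod_cong) simp
    have "(\<Prod>e\<in>edges N. g e (cut_cost e i)) = (\<Prod>e\<in>edges N. f e (cut_cost e i))" for i
      using eq cut_cost_nonneg by (intro prod.cong) auto
    then show ?thesis using f by (simp add: lower_ineq_def 1)
  qed
qed (use F lower_ineq_gauss lower_ineq_mixture in auto)

end

section \<open>From mixtures to power weights\<close>

text \<open>For \<open>a = q / 2\<close> the weight of the \<open>q\<close>-chain with couplings \<open>b\<close>.\<close>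
definition power_weight :: "nat \<Rightarrow> (int \<times> int \<Rightarrow> real) \<Rightarrow> real \<Rightarrow> (int \<Rightarrow> int) \<Rightarrow> real"
  where "power_weight N b a \<phi> = exp (- (\<Sum>e\<in>edges N. b e * ((grad \<phi> e)\<^sup>2) powr a))"

lemma power_weight_pos: "0 < power_weight N b a \<phi>"
  by (simp add: power_weight_def)

lemma integrable_moment_power_weight:
  assumes a: "0 < a" and b: "\<forall>e\<in>edges N. 0 < b e"
  shows "integrable (count_space (Omega N)) (\<lambda>\<phi>. moment_bound N \<phi> * power_weight N b a \<phi>)"
proof -
  let ?B = "{- int N..int N}"
  define c where "c = Min ((\<lambda>i. b (i, int N + 1)) ` ?B)"
  have c0: "0 < c" unfolding c_def using b boundary_edge by (subst Min_gr_iff) auto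
  have c: "c \<le> b (i, int N + 1)" if "i \<in> ?B" for i
    unfolding c_def using that by (intro Min_le) auto
  have le: "power_weight N b a \<phi> \<le> exp (- c * (\<Sum>i\<in>?B. real_of_int \<bar>\<phi> i\<bar> powr (2 * a)))" if \<phi>: "\<phi> \<in> Omega N" for \<phi>
  proof -
    have sq: "real_of_int \<bar>x\<bar> powr (2 * a) = ((real_of_int x)\<^sup>2) powr a" for x :: int
      by (simp add: powr_powr[symmetric])
    have "c * (\<Sum>i\<in>?B. real_of_int \<bar>\<phi> i\<bar> powr (2 * a)) \<le> (\<Sum>i\<in>?B. b (i, int N + 1) * ((grad \<phi> (i, int N + 1))\<^sup>2) powr a)"
      unfolding sum_distrib_left grad_boundary[OF \<phi>] sq by (intro sum_mono mult_right_mono c) auto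
    also have "\<dots> \<le> (\<Sum>e\<in>edges N. b e * ((grad \<phi> e)\<^sup>2) powr a)"
      using b by (intro sum_boundary_le_sum_edges mult_nonneg_nonneg) (auto intro: less_imp_le)
    finally show ?thesis by (simp add: power_weight_def)
  qed
  show ?thesis
  proof (rule Bochner_Integration.integrable_bound[OF integrable_moment_bound_exp[of c "2 * a" N]])
    show "AE \<phi> in count_space (Omega N). norm (moment_bound N \<phi> * power_weight N b a \<phi>)
        \<le> norm (moment_bound N \<phi> * exp (- c * (\<Sum>i\<in>?B. real_of_int \<bar>\<phi> i\<bar> powr (2 * a))))"
    proof (rule AE_I2)
      fix \<phi> assume "\<phi> \<in> space (count_space (Omega N))"
      then have "moment_bound N \<phi> * power_weight N b a \<phi>
          \<le> moment_bound N \<phi> * exp (- c * (\<Sum>i\<in>?B. real_of_int \<bar>\<phi> i\<bar> powr (2 * a)))"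
        using le moment_bound_ge1[of N \<phi>] by (intro mult_left_mono) auto
      then show "norm (moment_bound N \<phi> * power_weight N b a \<phi>)
        \<le> norm (moment_bound N \<phi> * exp (- c * (\<Sum>i\<in>?B. real_of_int \<bar>\<phi> i\<bar> powr (2 * a))))"
        using moment_bound_ge1[of N \<phi>] power_weight_pos[of N b a \<phi>] by (simp add: abs_mult)
    qed
  qed (use c0 a in auto)
qed

lemma integrable_dominated_power_weight:
  assumes a: "0 < a" and b: "\<forall>e\<in>edges N. 0 < b e"
    and f: "\<And>\<phi>. \<phi> \<in> Omega N \<Longrightarrow> \<bar>f \<phi>\<bar> \<le> C * (moment_bound N \<phi> * power_weight N b a \<phi>)"
  shows "integrable (count_space (Omega N)) f"
proof (rule Bochner_Integration.integrable_bound)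
  show "integrable (count_space (Omega N)) (\<lambda>\<phi>. C * (moment_bound N \<phi> * power_weight N b a \<phi>))"
    using integrable_moment_power_weight[OF a b] by simp
  show "AE \<phi> in count_space (Omega N). norm (f \<phi>) \<le> norm (C * (moment_bound N \<phi> * power_weight N b a \<phi>))"
    using f by (intro AE_I2) (auto intro: order_trans[OF _ abs_ge_self])
qed simp

lemma dominated_convergence_power_weight:
  assumes a: "0 < a" and b: "\<forall>e\<in>edges N. 0 < b e"
    and f: "\<And>n \<phi>. \<phi> \<in> Omega N \<Longrightarrow> \<bar>f n \<phi>\<bar> \<le> C * (moment_bound N \<phi> * power_weight N b a \<phi>)"
    and lim: "\<And>\<phi>. \<phi> \<in> Omega N \<Longrightarrow> (\<lambda>n. f n \<phi>) \<longlonglongrightarrow> g \<phi>"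
  shows "(\<lambda>n. LINT \<phi>|count_space (Omega N). f n \<phi>) \<longlonglongrightarrow> (LINT \<phi>|count_space (Omega N). g \<phi>)"
proof (rule integral_dominated_convergence)
  show "integrable (count_space (Omega N)) (\<lambda>\<phi>. C * (moment_bound N \<phi> * power_weight N b a \<phi>))"
    using integrable_moment_power_weight[OF a b] by simp
  show "AE \<phi> in count_space (Omega N). norm (f n \<phi>) \<le> C * (moment_bound N \<phi> * power_weight N b a \<phi>)" for n
    using f by (intro AE_I2) auto
  show "AE \<phi> in count_space (Omega N). (\<lambda>n. f n \<phi>) \<longlonglongrightarrow> g \<phi>"
    using lim by (intro AE_I2) auto
qed auto

lemma powr_tangent:
  fixes a u v :: real
  assumes a: "0 < a" "a < 1" and u: "0 \<le> u" and v: "0 < v"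
  shows "u powr a \<le> v powr a - a * (v - u) * v powr (a - 1)"
proof (cases "u = 0")
  case True
  have "a * v powr a \<le> 1 * v powr a" using a by (intro mult_right_mono) auto
  then show ?thesis using True v a by (simp add: powr_diff)
next
  case False
  have "(u / v) powr a * 1 powr (1 - a) \<le> a * (u / v) + (1 - a) * 1"
    using False u v a by (intro Youngs_inequality_0) auto
  then have "u powr a / v powr a \<le> 1 - a * (v - u) / v"
    using v u by (simp add: powr_divide field_simps)
  then have "u powr a \<le> (1 - a * (v - u) / v) * v powr a"
    using v by (simp add: divide_le_eq)
  also have "\<dots> = v powr a - a * (v - u) * v powr (a - 1)"
    using v by (simp add: powr_diff left_diff_distrib)
  finally show ?thesis .
qed

text \<open>The mesh \<open>(1 + u) powr (1 - a)\<close> is the scale on which \<open>u powr a\<close> grows by a constant. This makes the Riemann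
  sums below comparable to their first term, uniformly in \<open>u\<close>.\<close>
lemma tail_exponent:
  fixes a u :: real
  assumes a: "0 < a" "a < 1" and u: "0 \<le> u"
  shows "u powr a + a / 2 * real m powr a \<le> (u + real m * (1 + u) powr (1 - a)) powr a"
proof (cases "m = 0")
  case False
  define v where "v = u + real m * (1 + u) powr (1 - a)"
  have m: "1 \<le> real m" using False by simp
  \<comment> \<open>Mean value argument at the right end \<open>v\<close>, where the derivative is smallest.\<close>
  have h: "0 < (1 + u) powr (1 - a)" using u by simp
  have v: "u < v" "0 < v" using h m u by (auto simp: v_def add_nonneg_pos)
  have tangent: "u powr a \<le> v powr a - a * (v - u) * v powr (a - 1)"
    by (rule powr_tangent[OF a u v(2)])
  have "v \<le> (1 + u) * (2 * real m)"
  proof -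
    have "(1 + u) powr (1 - a) \<le> (1 + u) powr 1" using u a by (intro powr_mono) auto
    then have "v \<le> u + real m * (1 + u)" unfolding v_def using u m by (intro add_left_mono mult_left_mono) auto
    also have "\<dots> \<le> (1 + u) * (2 * real m)"
      using u m mult_left_mono[of 1 "real m" u] by (simp add: algebra_simps)
    finally show ?thesis .
  qed
  then have "((1 + u) * (2 * real m)) powr (a - 1) \<le> v powr (a - 1)"
    using v a by (intro powr_mono2') auto
  then have "a * (v - u) * ((1 + u) * (2 * real m)) powr (a - 1) \<le> a * (v - u) * v powr (a - 1)"
    using v a by (intro mult_left_mono) auto
  moreover have "a * (v - u) * ((1 + u) * (2 * real m)) powr (a - 1) = a * (2 powr (a - 1) * real m powr a)"
  proof -
    have 1: "(1 + u) powr (1 - a) * (1 + u) powr (a - 1) = 1"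
      using u by (simp add: powr_add[symmetric])
    have 2: "real m * real m powr (a - 1) = real m powr a"
      using m by (simp add: powr_diff)
    have "((1 + u) * (2 * real m)) powr (a - 1) = (1 + u) powr (a - 1) * (2 powr (a - 1) * real m powr (a - 1))"
      using u m by (simp only: powr_mult)
    then have "a * (v - u) * ((1 + u) * (2 * real m)) powr (a - 1)
        = a * (2 powr (a - 1) * (real m * real m powr (a - 1))) * ((1 + u) powr (1 - a) * (1 + u) powr (a - 1))"
      by (simp add: v_def)
    then show ?thesis unfolding 1 2 by simp
  qed
  moreover have "a * (1 / 2 * real m powr a) \<le> a * (2 powr (a - 1) * real m powr a)"
    using a by (intro mult_left_mono mult_right_mono) (auto simp: powr_diff ge_one_powr_ge_zero)
  ultimately show ?thesis using tangent unfolding v_def[symmetric] by linarith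
qed simp

definition tail_const :: "real \<Rightarrow> real \<Rightarrow> real"
  where "tail_const a c = (\<Sum>m. exp (- c * (a / 2 * real m powr a)))"

lemma summable_exp_powr:
  assumes "0 < c" and "0 < a"
  shows "summable (\<lambda>m. exp (- c * (a / 2 * real m powr a)))"
proof -
  let ?g = "\<lambda>x::int. (1 + (real_of_int x)\<^sup>2) * exp (- (c * (a / 2)) * real_of_int \<bar>x\<bar> powr a)"
  have "?g summable_on range int"
    by (rule summable_on_subset[OF summable_on_int_exp_powr]) (use assms in auto)
  then have "(\<lambda>m. ?g (int m)) summable_on UNIV"
    by (subst (asm) summable_on_reindex) (auto simp: o_def)
  then have "summable (\<lambda>m. ?g (int m))"
    by (subst (asm) summable_on_UNIV_nonneg_real_iff) auto
  then show ?thesis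
  proof (rule summable_comparison_test'[where N = 0])
    fix m :: nat
    have "1 * exp (- c * (a / 2 * real m powr a)) \<le> (1 + (real m)\<^sup>2) * exp (- c * (a / 2 * real m powr a))"
      by (intro mult_right_mono) auto
    then show "norm (exp (- c * (a / 2 * real m powr a))) \<le> ?g (int m)" by (simp add: mult.assoc)
  qed
qed

lemma tail_const_pos:
  assumes "0 < c" and "0 < a"
  shows "0 < tail_const a c"
  unfolding tail_const_def using summable_exp_powr[OF assms] by (intro suminf_pos) auto

lemma tail_series_le:
  assumes a: "0 < a" "a < 1" and c: "0 < c" and u: "0 \<le> u"
  shows "summable (\<lambda>m. exp (- c * (u + real m * (1 + u) powr (1 - a)) powr a))"
    and "(\<Sum>m. exp (- c * (u + real m * (1 + u) powr (1 - a)) powr a)) \<le> tail_const a c * exp (- c * u powr a)"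
proof -
  have le: "exp (- c * (u + real m * (1 + u) powr (1 - a)) powr a)
      \<le> exp (- c * u powr a) * exp (- c * (a / 2 * real m powr a))" for m
    using mult_left_mono[OF tail_exponent[OF a u, of m], of c] c by (simp add: exp_add[symmetric] algebra_simps)
  have s: "summable (\<lambda>m. exp (- c * u powr a) * exp (- c * (a / 2 * real m powr a)))"
    by (intro summable_mult summable_exp_powr c a)
  show *: "summable (\<lambda>m. exp (- c * (u + real m * (1 + u) powr (1 - a)) powr a))"
    by (rule summable_comparison_test'[OF s, where N = 0]) (use le in simp)
  have "(\<Sum>m. exp (- c * (u + real m * (1 + u) powr (1 - a)) powr a))
      \<le> (\<Sum>m. exp (- c * u powr a) * exp (- c * (a / 2 * real m powr a)))"
    by (rule suminf_le[OF le * s])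
  also have "\<dots> = exp (- c * u powr a) * tail_const a c"
    unfolding tail_const_def by (rule suminf_mult[OF summable_exp_powr[OF c a(1)]])
  finally show "(\<Sum>m. exp (- c * (u + real m * (1 + u) powr (1 - a)) powr a)) \<le> tail_const a c * exp (- c * u powr a)"
    by (simp add: mult.commute)
qed

locale power_chain =
  fixes N :: nat and a :: real and b :: "int \<times> int \<Rightarrow> real"
  assumes a: "0 < a" "a < 1" and b: "\<forall>e\<in>edges N. 0 < b e"
begin

definition factor :: "nat \<Rightarrow> int \<times> int \<Rightarrow> real \<Rightarrow> real"
  where "factor n e s = stable_approx a (Suc n) (b e powr (1 / a) * s)"

text \<open>The loss in the exponent in the bound \<open>stable_approx_bounds\<close>.\<close>
definition c0 :: real where "c0 = (1 / 2) powr a"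

lemma c0: "0 < c0" by (simp add: c0_def)

lemma scale_powr: "e \<in> edges N \<Longrightarrow> 0 \<le> s \<Longrightarrow> (b e powr (1 / a) * s) powr a = b e * s powr a"
proof -
  assume "e \<in> edges N" "0 \<le> s"
  moreover then have "0 < b e" using b by blast
  ultimately show ?thesis using a by (simp add: powr_mult powr_powr)
qed

lemma factor_nonneg: "0 \<le> s \<Longrightarrow> 0 \<le> factor n e s"
  unfolding factor_def using a by (intro stable_approx_bounds) auto

lemma factor_le: "0 \<le> s \<Longrightarrow> factor n e s \<le> exp (- c0 * (b e powr (1 / a) * s) powr a)"
proof -
  assume s: "0 \<le> s"
  have "factor n e s \<le> exp (- ((b e powr (1 / a) * s / 2) powr a))"
    unfolding factor_def using a s by (intro stable_approx_bounds) auto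
  also have "(b e powr (1 / a) * s / 2) powr a = c0 * (b e powr (1 / a) * s) powr a"
    using powr_mult[of "1 / 2" "b e powr (1 / a) * s" a] s by (simp add: c0_def)
  finally show ?thesis by simp
qed

lemma factor_tendsto:
  assumes "0 \<le> s"
  shows "(\<lambda>n. factor n e s) \<longlonglongrightarrow> exp (- ((b e powr (1 / a) * s) powr a))"
  unfolding factor_def
  using LIMSEQ_Suc[OF stable_approx_tendsto[OF a, of "b e powr (1 / a) * s"]] assms by simp

lemma gauss_mixture_factor: "e \<in> edges N \<Longrightarrow> gauss_mixture (factor n e)"
  unfolding factor_def using a b by (intro gauss_mixture_scale gauss_mixture_stable_approx) auto

lemma factor_0_le_1: "factor n e 0 \<le> 1"
  using factor_le[of 0 n e] a by simp

abbreviation weight :: "(int \<Rightarrow> int) \<Rightarrow> real"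
  where "weight \<equiv> power_weight N b a"

abbreviation dominating :: "(int \<Rightarrow> int) \<Rightarrow> real"
  where "dominating \<equiv> power_weight N (\<lambda>e. c0 * b e) a"

lemma dominating_positive: "\<forall>e\<in>edges N. 0 < c0 * b e"
  using b c0 by simp

lemma weight_prod: "weight \<phi> = (\<Prod>e\<in>edges N. exp (- ((b e powr (1 / a) * (grad \<phi> e)\<^sup>2) powr a)))"
  by (simp add: power_weight_def exp_sum sum_negf[symmetric] scale_powr)

lemma dominating_prod: "dominating \<phi> = (\<Prod>e\<in>edges N. exp (- c0 * (b e powr (1 / a) * (grad \<phi> e)\<^sup>2) powr a))"
  by (simp add: power_weight_def exp_sum sum_negf[symmetric] scale_powr mult.assoc)

lemma factor_prod_le: "0 \<le> (\<Prod>e\<in>edges N. factor n e ((grad \<phi> e)\<^sup>2))"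
  "(\<Prod>e\<in>edges N. factor n e ((grad \<phi> e)\<^sup>2)) \<le> dominating \<phi>"
  unfolding dominating_prod by (intro prod_nonneg prod_mono conjI ballI factor_nonneg factor_le; simp)+

lemma factor_prod_tendsto: "(\<lambda>n. \<Prod>e\<in>edges N. factor n e ((grad \<phi> e)\<^sup>2)) \<longlonglongrightarrow> weight \<phi>"
  unfolding weight_prod by (intro tendsto_prod factor_tendsto) auto

lemma moment_limit:
  assumes f: "\<And>\<phi>. \<phi> \<in> Omega N \<Longrightarrow> \<bar>f \<phi>\<bar> \<le> C * moment_bound N \<phi>"
  shows "integrable (count_space (Omega N)) (\<lambda>\<phi>. f \<phi> * (\<Prod>e\<in>edges N. factor n e ((grad \<phi> e)\<^sup>2)))"
    and "(\<lambda>n. LINT \<phi>|count_space (Omega N). f \<phi> * (\<Prod>e\<in>edges N. factor n e ((grad \<phi> e)\<^sup>2)))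
      \<longlonglongrightarrow> (LINT \<phi>|count_space (Omega N). f \<phi> * weight \<phi>)"
proof -
  have *: "\<bar>f \<phi> * (\<Prod>e\<in>edges N. factor n e ((grad \<phi> e)\<^sup>2))\<bar> \<le> C * (moment_bound N \<phi> * dominating \<phi>)"
    if "\<phi> \<in> Omega N" for n \<phi>
  proof -
    have "\<bar>f \<phi>\<bar> * (\<Prod>e\<in>edges N. factor n e ((grad \<phi> e)\<^sup>2)) \<le> (C * moment_bound N \<phi>) * dominating \<phi>"
      using f[OF that] factor_prod_le[of n \<phi>] by (intro mult_mono) auto
    then show ?thesis using factor_prod_le(1)[of n \<phi>] by (simp add: abs_mult mult.assoc)
  qed
  show "integrable (count_space (Omega N)) (\<lambda>\<phi>. f \<phi> * (\<Prod>e\<in>edges N. factor n e ((grad \<phi> e)\<^sup>2)))"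
    by (rule integrable_dominated_power_weight[OF a(1) dominating_positive *])
  show "(\<lambda>n. LINT \<phi>|count_space (Omega N). f \<phi> * (\<Prod>e\<in>edges N. factor n e ((grad \<phi> e)\<^sup>2)))
      \<longlonglongrightarrow> (LINT \<phi>|count_space (Omega N). f \<phi> * weight \<phi>)"
    by (rule dominated_convergence_power_weight[OF a(1) dominating_positive *])
      (auto intro!: tendsto_mult tendsto_const factor_prod_tendsto)
qed

lemma integrable_weight_times:
  assumes f: "\<And>\<phi>. \<phi> \<in> Omega N \<Longrightarrow> \<bar>f \<phi>\<bar> \<le> C * moment_bound N \<phi>"
  shows "integrable (count_space (Omega N)) (\<lambda>\<phi>. f \<phi> * weight \<phi>)"
proof (rule integrable_dominated_power_weight[OF a(1) b])
  show "\<bar>f \<phi> * weight \<phi>\<bar> \<le> C * (moment_bound N \<phi> * weight \<phi>)" if "\<phi> \<in> Omega N" for \<phi>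
    using mult_right_mono[OF f[OF that], of "weight \<phi>"] power_weight_pos[of N b a \<phi>]
    by (simp add: abs_mult mult.assoc)
qed

text \<open>The mesh of \<open>tail_exponent\<close> in the units of edge \<open>e\<close>, where \<open>b e powr (1 / a) * s\<close> is dimensionless.\<close>
definition step_size :: "int \<times> int \<Rightarrow> real \<Rightarrow> real"
  where "step_size e s = b e powr (- 1 / a) * (1 + b e powr (1 / a) * s) powr (1 - a)"

lemma step_size_pos: "e \<in> edges N \<Longrightarrow> 0 \<le> s \<Longrightarrow> 0 < step_size e s"
proof -
  assume e: "e \<in> edges N" and s: "0 \<le> s"
  have "0 < b e" using b e by blast
  moreover have "0 < 1 + b e powr (1 / a) * s" using s by (intro add_pos_nonneg) auto
  ultimately show ?thesis by (simp add: step_size_def)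
qed

lemma scaled_step:
  assumes "e \<in> edges N"
  shows "b e powr (1 / a) * (s + real m * step_size e s)
    = b e powr (1 / a) * s + real m * (1 + b e powr (1 / a) * s) powr (1 - a)"
proof -
  have "0 < b e" using assms b by blast
  then have "b e powr (1 / a) * b e powr (- 1 / a) = 1" by (simp add: powr_add[symmetric] add_divide_distrib[symmetric])
  then show ?thesis by (simp add: step_size_def distrib_left)
qed

definition real_tail :: "(real \<Rightarrow> real) \<Rightarrow> int \<times> int \<Rightarrow> real \<Rightarrow> real"
  where "real_tail f e s = step_size e s * (\<Sum>m. f (s + real m * step_size e s))"

lemma factor_tail:
  assumes e: "e \<in> edges N" and s: "0 \<le> s"
  defines "u \<equiv> b e powr (1 / a) * s"
  shows "summable (\<lambda>m. factor n e (s + real m * step_size e s))"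
    and "real_tail (factor n e) e s \<le> step_size e s * (tail_const a c0 * exp (- c0 * u powr a))"
    and "0 \<le> real_tail (factor n e) e s"
    and "(\<lambda>n. real_tail (factor n e) e s) \<longlonglongrightarrow> real_tail (\<lambda>s. exp (- ((b e powr (1 / a) * s) powr a))) e s"
    and "real_tail (\<lambda>s. exp (- ((b e powr (1 / a) * s) powr a))) e s \<le> step_size e s * (tail_const a 1 * exp (- (u powr a)))"
proof -
  have u: "0 \<le> u" using s by (simp add: u_def)
  let ?v = "\<lambda>m. u + real m * (1 + u) powr (1 - a)"
  have arg: "0 \<le> s + real m * step_size e s" for m
    using step_size_pos[OF e s] s by simp
  have le: "factor n e (s + real m * step_size e s) \<le> exp (- c0 * ?v m powr a)" for n m
    using factor_le[OF arg, of n e m] unfolding scaled_step[OF e] u_def .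
  note t = tail_series_le[OF a c0 u]
  have nonneg: "0 \<le> factor n e (s + real m * step_size e s)" for n m by (rule factor_nonneg[OF arg])
  show sm: "summable (\<lambda>m. factor n e (s + real m * step_size e s))" for n
    by (rule summable_comparison_test'[OF t(1), where N = 0]) (use le nonneg in simp)
  have "(\<Sum>m. factor n e (s + real m * step_size e s)) \<le> tail_const a c0 * exp (- c0 * u powr a)"
    using suminf_le[OF le sm t(1)] t(2) by (rule order_trans)
  then show "real_tail (factor n e) e s \<le> step_size e s * (tail_const a c0 * exp (- c0 * u powr a))"
    unfolding real_tail_def using step_size_pos[OF e s] by (intro mult_left_mono) auto
  show "0 \<le> real_tail (factor n e) e s"
    unfolding real_tail_def using step_size_pos[OF e s] suminf_nonneg[OF sm nonneg] by simp
  have "(\<lambda>n. \<Sum>m. factor n e (s + real m * step_size e s))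
      \<longlonglongrightarrow> (\<Sum>m. exp (- ((b e powr (1 / a) * (s + real m * step_size e s)) powr a)))"
  proof (rule tannerys_theorem[THEN conjunct2, THEN conjunct2])
    show "(\<lambda>n. factor n e (s + real m * step_size e s)) \<longlonglongrightarrow> exp (- ((b e powr (1 / a) * (s + real m * step_size e s)) powr a))" for m
      by (rule factor_tendsto[OF arg])
    show "\<forall>\<^sub>F (m, n) in at_top \<times>\<^sub>F sequentially. norm (factor n e (s + real m * step_size e s)) \<le> exp (- c0 * ?v m powr a)"
      using le nonneg by (intro always_eventually) auto
  qed (use t(1) in auto)
  then show "(\<lambda>n. real_tail (factor n e) e s) \<longlonglongrightarrow> real_tail (\<lambda>s. exp (- ((b e powr (1 / a) * s) powr a))) e s"
    unfolding real_tail_def by (intro tendsto_intros)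
  show "real_tail (\<lambda>s. exp (- ((b e powr (1 / a) * s) powr a))) e s \<le> step_size e s * (tail_const a 1 * exp (- (u powr a)))"
    unfolding real_tail_def scaled_step[OF e] u_def[symmetric]
    using tail_series_le(2)[OF a, of 1 u] u step_size_pos[OF e s] by (intro mult_left_mono) auto
qed

lemma step_size_le:
  assumes "e \<in> edges N" and "\<phi> \<in> Omega N"
  shows "step_size e ((grad \<phi> e)\<^sup>2) \<le> (b e powr (- 1 / a) * (1 + 4 * b e powr (1 / a))) * moment_bound N \<phi>"
proof -
  let ?B = "b e powr (1 / a)"
  have "1 \<le> 1 + ?B * (grad \<phi> e)\<^sup>2" by simp
  then have "(1 + ?B * (grad \<phi> e)\<^sup>2) powr (1 - a) \<le> (1 + ?B * (grad \<phi> e)\<^sup>2) powr 1"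
    using a by (intro powr_mono) auto
  also have "\<dots> = 1 + ?B * (grad \<phi> e)\<^sup>2" by simp
  also have "\<dots> \<le> moment_bound N \<phi> + ?B * (4 * moment_bound N \<phi>)"
    using grad_sq_le_moment_bound[OF assms(2), of e] moment_bound_ge1[of N \<phi>] by (intro add_mono mult_left_mono) auto
  finally have "(1 + ?B * (grad \<phi> e)\<^sup>2) powr (1 - a) \<le> (1 + 4 * ?B) * moment_bound N \<phi>"
    by (simp add: algebra_simps)
  then have "b e powr (- 1 / a) * (1 + ?B * (grad \<phi> e)\<^sup>2) powr (1 - a) \<le> b e powr (- 1 / a) * ((1 + 4 * ?B) * moment_bound N \<phi>)"
    by (intro mult_left_mono) auto
  then show ?thesis by (simp add: step_size_def mult.assoc)
qed

definition tail_term :: "(int \<times> int \<Rightarrow> real \<Rightarrow> real) \<Rightarrow> int \<times> int \<Rightarrow> (int \<Rightarrow> int) \<Rightarrow> real"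
  where "tail_term f e \<phi> = (\<Prod>e'\<in>edges N - {e}. f e' ((grad \<phi> e')\<^sup>2)) * real_tail (f e) e ((grad \<phi> e)\<^sup>2)"

lemma tail_term_nonneg:
  assumes "e \<in> edges N"
  shows "0 \<le> tail_term (factor n) e \<phi>"
  unfolding tail_term_def using factor_tail(3)[OF assms, of "(grad \<phi> e)\<^sup>2" n]
  by (intro mult_nonneg_nonneg prod_nonneg) (auto intro: factor_nonneg)

lemma tail_term_bound:
  assumes e: "e \<in> edges N"
  obtains C where "\<And>n \<phi>. \<phi> \<in> Omega N \<Longrightarrow> \<bar>tail_term (factor n) e \<phi>\<bar> \<le> C * (moment_bound N \<phi> * dominating \<phi>)"
proof
  fix n \<phi> assume \<phi>: "\<phi> \<in> Omega N"
  let ?s = "(grad \<phi> e)\<^sup>2" and ?K = "b e powr (- 1 / a) * (1 + 4 * b e powr (1 / a))"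
  let ?D = "\<lambda>e'. exp (- c0 * (b e' powr (1 / a) * (grad \<phi> e')\<^sup>2) powr a)"
  have tc: "0 < tail_const a c0" by (rule tail_const_pos[OF c0 a(1)])
  have "real_tail (factor n e) e ?s \<le> step_size e ?s * (tail_const a c0 * ?D e)"
    by (rule factor_tail(2)[OF e]) simp
  also have "\<dots> \<le> (?K * moment_bound N \<phi>) * (tail_const a c0 * ?D e)"
    using step_size_le[OF e \<phi>] tc by (intro mult_right_mono) auto
  finally have 1: "real_tail (factor n e) e ?s \<le> (?K * moment_bound N \<phi>) * (tail_const a c0 * ?D e)" .
  have 2: "(\<Prod>e'\<in>edges N - {e}. factor n e' ((grad \<phi> e')\<^sup>2)) \<le> (\<Prod>e'\<in>edges N - {e}. ?D e')"
    by (intro prod_mono conjI factor_nonneg factor_le) auto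
  have 3: "0 \<le> (\<Prod>e'\<in>edges N - {e}. factor n e' ((grad \<phi> e')\<^sup>2))"
    by (intro prod_nonneg ballI factor_nonneg) auto
  have "tail_term (factor n) e \<phi> \<le> (\<Prod>e'\<in>edges N - {e}. ?D e') * ((?K * moment_bound N \<phi>) * (tail_const a c0 * ?D e))"
    unfolding tail_term_def using 1 2 3 factor_tail(3)[OF e, of ?s n] by (intro mult_mono prod_nonneg) auto
  also have "\<dots> = (?K * tail_const a c0) * (moment_bound N \<phi> * (?D e * (\<Prod>e'\<in>edges N - {e}. ?D e')))"
    by (simp only: mult_ac)
  also have "?D e * (\<Prod>e'\<in>edges N - {e}. ?D e') = dominating \<phi>"
    unfolding dominating_prod using e by (subst (2) prod.remove[of _ e]) auto
  finally show "\<bar>tail_term (factor n) e \<phi>\<bar> \<le> (?K * tail_const a c0) * (moment_bound N \<phi> * dominating \<phi>)"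
    using 3 factor_tail(3)[OF e, of ?s n] by (simp add: tail_term_def)
qed

lemma second_moment_factor:
  "(LINT \<phi>|count_space (Omega N). (\<Sum>e\<in>edges N. \<theta> e * grad \<phi> e)\<^sup>2 * (\<Prod>e\<in>edges N. factor n e ((grad \<phi> e)\<^sup>2)))
    \<le> (\<Sum>e\<in>edges N. (\<theta> e)\<^sup>2 / 2 * (LINT \<phi>|count_space (Omega N). tail_term (factor n) e \<phi>))"
proof -
  let ?M = "count_space (Omega N)"
  let ?F = "\<lambda>e s. ennreal (factor n e s)"
  define X where "X = (\<lambda>\<phi>. \<Sum>e\<in>edges N. \<theta> e * grad \<phi> e)"
  have *: "upper_ineq N \<theta> step_size ?F"
    by (rule upper_ineq_gauss_mixture) (auto intro: step_size_pos gauss_mixture_factor factor_0_le_1)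
  have intX: "integrable ?M (\<lambda>\<phi>. (X \<phi>)\<^sup>2 * (\<Prod>e\<in>edges N. factor n e ((grad \<phi> e)\<^sup>2)))"
    unfolding X_def by (rule moment_limit(1)[OF linear_grad_sq_le_moment_bound])
  have "ennreal (LINT \<phi>|?M. (X \<phi>)\<^sup>2 * (\<Prod>e\<in>edges N. factor n e ((grad \<phi> e)\<^sup>2)))
      = (\<integral>\<^sup>+\<phi>. ennreal ((X \<phi>)\<^sup>2 * (\<Prod>e\<in>edges N. factor n e ((grad \<phi> e)\<^sup>2))) \<partial>?M)"
    by (rule nn_integral_eq_integral[OF intX, symmetric]) (simp add: factor_prod_le)
  also have "\<dots> = (\<integral>\<^sup>+\<phi>. ennreal ((X \<phi>)\<^sup>2) * edge_prod (edges N) ?F \<phi> \<partial>?M)"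
    by (subst edge_prod_ennreal) (auto simp: factor_nonneg ennreal_mult')
  also have "\<dots> \<le> (\<Sum>e\<in>edges N. ennreal ((\<theta> e)\<^sup>2 / 2) * (\<integral>\<^sup>+\<phi>. edge_prod (edges N - {e}) ?F \<phi>
        * tail_sum (step_size e) (?F e) ((grad \<phi> e)\<^sup>2) \<partial>?M))"
    using * unfolding upper_ineq_def X_def .
  also have "\<dots> = (\<Sum>e\<in>edges N. ennreal ((\<theta> e)\<^sup>2 / 2 * (LINT \<phi>|?M. tail_term (factor n) e \<phi>)))"
  proof (rule sum.cong[OF refl])
    fix e assume e: "e \<in> edges N"
    have tail: "tail_sum (step_size e) (?F e) s = ennreal (real_tail (factor n e) e s)" if s: "0 \<le> s" for s
      unfolding tail_sum_def real_tail_def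
      using factor_tail(1)[OF e s, of n] step_size_pos[OF e s] s
      by (subst suminf_ennreal2) (auto intro!: factor_nonneg simp: ennreal_mult')
    obtain C where C: "\<And>n \<phi>. \<phi> \<in> Omega N \<Longrightarrow> \<bar>tail_term (factor n) e \<phi>\<bar> \<le> C * (moment_bound N \<phi> * dominating \<phi>)"
      using tail_term_bound[OF e] by blast
    have int: "integrable ?M (tail_term (factor n) e)"
      by (rule integrable_dominated_power_weight[OF a(1) dominating_positive C])
    have "(\<integral>\<^sup>+\<phi>. edge_prod (edges N - {e}) ?F \<phi> * tail_sum (step_size e) (?F e) ((grad \<phi> e)\<^sup>2) \<partial>?M)
        = (\<integral>\<^sup>+\<phi>. ennreal (tail_term (factor n) e \<phi>) \<partial>?M)"
    proof (rule nn_integral_cong)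
      fix \<phi>
      have "edge_prod (edges N - {e}) ?F \<phi> = ennreal (\<Prod>e'\<in>edges N - {e}. factor n e' ((grad \<phi> e')\<^sup>2))"
        by (rule edge_prod_ennreal) (rule factor_nonneg)
      moreover have "0 \<le> (\<Prod>e'\<in>edges N - {e}. factor n e' ((grad \<phi> e')\<^sup>2))"
        by (intro prod_nonneg ballI factor_nonneg) auto
      ultimately show "edge_prod (edges N - {e}) ?F \<phi> * tail_sum (step_size e) (?F e) ((grad \<phi> e)\<^sup>2) = ennreal (tail_term (factor n) e \<phi>)"
        using tail[of "(grad \<phi> e)\<^sup>2"] by (simp add: tail_term_def ennreal_mult')
    qed
    also have "\<dots> = ennreal (LINT \<phi>|?M. tail_term (factor n) e \<phi>)"
      by (rule nn_integral_eq_integral[OF int]) (simp add: tail_term_nonneg[OF e])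
    finally have eq: "(\<integral>\<^sup>+\<phi>. edge_prod (edges N - {e}) ?F \<phi> * tail_sum (step_size e) (?F e) ((grad \<phi> e)\<^sup>2) \<partial>?M)
        = ennreal (LINT \<phi>|?M. tail_term (factor n) e \<phi>)" .
    show "ennreal ((\<theta> e)\<^sup>2 / 2) * (\<integral>\<^sup>+\<phi>. edge_prod (edges N - {e}) ?F \<phi>
        * tail_sum (step_size e) (?F e) ((grad \<phi> e)\<^sup>2) \<partial>?M) = ennreal ((\<theta> e)\<^sup>2 / 2 * (LINT \<phi>|?M. tail_term (factor n) e \<phi>))"
      unfolding eq by (rule ennreal_mult'[symmetric]) simp
  qed
  also have "\<dots> = ennreal (\<Sum>e\<in>edges N. (\<theta> e)\<^sup>2 / 2 * (LINT \<phi>|?M. tail_term (factor n) e \<phi>))"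
    by (rule sum_ennreal) (auto intro!: mult_nonneg_nonneg integral_nonneg_AE tail_term_nonneg)
  finally show ?thesis
    unfolding X_def
    by (subst (asm) ennreal_le_iff) (auto intro!: sum_nonneg mult_nonneg_nonneg integral_nonneg_AE tail_term_nonneg)
qed

text \<open>The limit of the mixture bounds. Each resistance has become the mesh at the squared increment, of order
  \<open>b e powr (- 1 / a)\<close> for small increments and growing more slowly than the squared increment itself.\<close>
lemma second_moment_weight:
  "(LINT \<phi>|count_space (Omega N). (\<Sum>e\<in>edges N. \<theta> e * grad \<phi> e)\<^sup>2 * weight \<phi>)
    \<le> tail_const a 1 / 2 * (\<Sum>e\<in>edges N. (\<theta> e)\<^sup>2 * (LINT \<phi>|count_space (Omega N). step_size e ((grad \<phi> e)\<^sup>2) * weight \<phi>))"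
proof -
  let ?M = "count_space (Omega N)"
  define f where "f = (\<lambda>e s. exp (- ((b e powr (1 / a) * s) powr a)))"
  have tl: "(\<lambda>n. LINT \<phi>|?M. tail_term (factor n) e \<phi>) \<longlonglongrightarrow> (LINT \<phi>|?M. tail_term f e \<phi>)" if e: "e \<in> edges N" for e
  proof -
    obtain C where C: "\<And>n \<phi>. \<phi> \<in> Omega N \<Longrightarrow> \<bar>tail_term (factor n) e \<phi>\<bar> \<le> C * (moment_bound N \<phi> * dominating \<phi>)"
      using tail_term_bound[OF e] by blast
    show ?thesis
      by (rule dominated_convergence_power_weight[OF a(1) dominating_positive C])
        (auto simp: tail_term_def f_def intro!: tendsto_mult tendsto_prod factor_tendsto factor_tail(4)[OF e])
  qed
  have "(LINT \<phi>|?M. (\<Sum>e\<in>edges N. \<theta> e * grad \<phi> e)\<^sup>2 * weight \<phi>)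
      \<le> (\<Sum>e\<in>edges N. (\<theta> e)\<^sup>2 / 2 * (LINT \<phi>|?M. tail_term f e \<phi>))"
  proof (rule LIMSEQ_le)
    show "(\<lambda>n. LINT \<phi>|?M. (\<Sum>e\<in>edges N. \<theta> e * grad \<phi> e)\<^sup>2 * (\<Prod>e\<in>edges N. factor n e ((grad \<phi> e)\<^sup>2)))
        \<longlonglongrightarrow> (LINT \<phi>|?M. (\<Sum>e\<in>edges N. \<theta> e * grad \<phi> e)\<^sup>2 * weight \<phi>)"
      by (rule moment_limit(2)[OF linear_grad_sq_le_moment_bound])
    show "(\<lambda>n. \<Sum>e\<in>edges N. (\<theta> e)\<^sup>2 / 2 * (LINT \<phi>|?M. tail_term (factor n) e \<phi>))
        \<longlonglongrightarrow> (\<Sum>e\<in>edges N. (\<theta> e)\<^sup>2 / 2 * (LINT \<phi>|?M. tail_term f e \<phi>))"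
      by (intro tendsto_sum tendsto_mult tendsto_const tl)
  qed (use second_moment_factor in blast)
  also have "\<dots> \<le> (\<Sum>e\<in>edges N. (\<theta> e)\<^sup>2 / 2 * (tail_const a 1 * (LINT \<phi>|?M. step_size e ((grad \<phi> e)\<^sup>2) * weight \<phi>)))"
  proof (intro sum_mono mult_left_mono)
    fix e assume e: "e \<in> edges N"
    have int: "integrable ?M (\<lambda>\<phi>. step_size e ((grad \<phi> e)\<^sup>2) * weight \<phi>)"
      using step_size_le[OF e] step_size_pos[OF e] by (intro integrable_weight_times) (auto simp: abs_of_pos)
    have nonneg: "0 \<le> tail_term f e \<phi>" for \<phi>
    proof (rule LIMSEQ_le_const)
      show "(\<lambda>n. tail_term (factor n) e \<phi>) \<longlonglongrightarrow> tail_term f e \<phi>"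
        unfolding tail_term_def f_def by (intro tendsto_mult tendsto_prod factor_tendsto factor_tail(4)[OF e]) auto
      show "\<exists>k. \<forall>n\<ge>k. 0 \<le> tail_term (factor n) e \<phi>"
        using tail_term_nonneg[OF e] by blast
    qed
    have le: "tail_term f e \<phi> \<le> tail_const a 1 * (step_size e ((grad \<phi> e)\<^sup>2) * weight \<phi>)" for \<phi>
    proof -
      have "tail_term f e \<phi> \<le> (\<Prod>e'\<in>edges N - {e}. f e' ((grad \<phi> e')\<^sup>2)) * (step_size e ((grad \<phi> e)\<^sup>2) * (tail_const a 1 * f e ((grad \<phi> e)\<^sup>2)))"
        unfolding tail_term_def f_def by (intro mult_left_mono factor_tail(5)[OF e] prod_nonneg) auto
      also have "\<dots> = tail_const a 1 * (step_size e ((grad \<phi> e)\<^sup>2) * (f e ((grad \<phi> e)\<^sup>2) * (\<Prod>e'\<in>edges N - {e}. f e' ((grad \<phi> e')\<^sup>2))))"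
        by (simp only: mult_ac)
      also have "f e ((grad \<phi> e)\<^sup>2) * (\<Prod>e'\<in>edges N - {e}. f e' ((grad \<phi> e')\<^sup>2)) = weight \<phi>"
        unfolding weight_prod f_def using e by (subst (2) prod.remove[of _ e]) auto
      finally show ?thesis .
    qed
    have "(LINT \<phi>|?M. tail_term f e \<phi>) \<le> (LINT \<phi>|?M. tail_const a 1 * (step_size e ((grad \<phi> e)\<^sup>2) * weight \<phi>))"
    proof (rule integral_mono)
      show "integrable ?M (tail_term f e)"
        by (rule Bochner_Integration.integrable_bound[OF integrable_mult_right[OF int, of "tail_const a 1"]])
          (use le nonneg in \<open>auto intro!: AE_I2 order_trans[OF _ abs_ge_self]\<close>)
    qed (use le int in auto)
    then show "(LINT \<phi>|?M. tail_term f e \<phi>) \<le> tail_const a 1 * (LINT \<phi>|?M. step_size e ((grad \<phi> e)\<^sup>2) * weight \<phi>)"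
      by simp
  qed simp
  also have "\<dots> = tail_const a 1 / 2 * (\<Sum>e\<in>edges N. (\<theta> e)\<^sup>2 * (LINT \<phi>|?M. step_size e ((grad \<phi> e)\<^sup>2) * weight \<phi>))"
    by (simp add: sum_distrib_left mult_ac)
  finally show ?thesis .
qed

end

section \<open>Effective resistances\<close>

text \<open>Sublinearity with an arbitrarily small slope \<open>\<eta>\<close>.\<close>
lemma powr_le_affine:
  fixes a \<eta> t :: real
  assumes a: "0 < a" "a < 1" and \<eta>: "0 < \<eta>" and t: "0 \<le> t"
  shows "(1 + t) powr (1 - a) \<le> (\<eta> + (\<eta> powr (- 1 / a)) powr (1 - a)) + \<eta> * t"
proof (cases "1 + t \<le> \<eta> powr (- 1 / a)")
  case True
  then have "(1 + t) powr (1 - a) \<le> (\<eta> powr (- 1 / a)) powr (1 - a)"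
    using a t by (intro powr_mono2) auto
  then show ?thesis using \<eta> t by (smt (verit) mult_nonneg_nonneg)
next
  case False
  have "(1 + t) powr (- a) \<le> (\<eta> powr (- 1 / a)) powr (- a)"
    using False a t \<eta> by (intro powr_mono2') auto
  also have "\<dots> = \<eta>" using a \<eta> by (simp add: powr_powr)
  finally have "(1 + t) * (1 + t) powr (- a) \<le> (1 + t) * \<eta>" using t by (intro mult_left_mono) auto
  moreover have "(1 + t) powr (1 - a) = (1 + t) * (1 + t) powr (- a)"
    using t by (simp add: powr_diff powr_minus divide_inverse)
  moreover have "0 \<le> (\<eta> powr (- 1 / a)) powr (1 - a)" by simp
  ultimately show ?thesis by (simp only: ring_distribs mult.commute[of t \<eta>])
qed

text \<open>The constant of \<open>powr_le_affine\<close> for the slope that makes the self-consistent term equal to one half.\<close>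
definition resistance_const :: "real \<Rightarrow> real"
  where "resistance_const a = tail_const a 1 *
    (1 / tail_const a 1 + ((1 / tail_const a 1) powr (- 1 / a)) powr (1 - a))"

lemma resistance_const_pos:
  assumes "0 < a"
  shows "0 < resistance_const a"
  unfolding resistance_const_def using tail_const_pos[of 1 a] assms
  by (intro mult_pos_pos add_pos_nonneg) auto

context power_chain
begin

text \<open>The random resistance of an edge is bounded by its typical value plus half the second moment of its
  own increment, in the units of that edge.\<close>
lemma resistance_bootstrap:
  "(LINT \<phi>|count_space (Omega N). (\<Sum>e\<in>edges N. \<theta> e * grad \<phi> e)\<^sup>2 * weight \<phi>)
    \<le> (\<Sum>e\<in>edges N. (\<theta> e)\<^sup>2 * (resistance_const a / 2 * b e powr (- 1 / a) * (LINT \<phi>|count_space (Omega N). weight \<phi>)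
        + (LINT \<phi>|count_space (Omega N). (grad \<phi> e)\<^sup>2 * weight \<phi>) / 2))"
proof -
  let ?M = "count_space (Omega N)"
  define T where "T = tail_const a 1"
  define K where "K = 1 / T + ((1 / T) powr (- 1 / a)) powr (1 - a)"
  have T: "0 < T" unfolding T_def using a by (intro tail_const_pos) auto
  have R: "resistance_const a = T * K" by (simp add: resistance_const_def T_def K_def)
  have int1: "integrable ?M weight"
    using integrable_weight_times[of "\<lambda>_. 1" 1] moment_bound_ge1 by simp
  have int2: "integrable ?M (\<lambda>\<phi>. (grad \<phi> e)\<^sup>2 * weight \<phi>)" for e
    by (rule integrable_weight_times[where C = 4]) (simp add: grad_sq_le_moment_bound)
  have "T / 2 * (LINT \<phi>|?M. step_size e ((grad \<phi> e)\<^sup>2) * weight \<phi>)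
      \<le> resistance_const a / 2 * b e powr (- 1 / a) * (LINT \<phi>|?M. weight \<phi>) + (LINT \<phi>|?M. (grad \<phi> e)\<^sup>2 * weight \<phi>) / 2"
    if e: "e \<in> edges N" for e
  proof -
    have be: "0 < b e" using e b by blast
    then have inv: "b e powr (- 1 / a) * b e powr (1 / a) = 1"
      by (simp add: powr_add[symmetric] add_divide_distrib[symmetric])
    have le: "step_size e ((grad \<phi> e)\<^sup>2) \<le> b e powr (- 1 / a) * K + (grad \<phi> e)\<^sup>2 / T" for \<phi>
    proof -
      have "(1 + b e powr (1 / a) * (grad \<phi> e)\<^sup>2) powr (1 - a) \<le> K + 1 / T * (b e powr (1 / a) * (grad \<phi> e)\<^sup>2)"
        unfolding K_def using T by (intro powr_le_affine[OF a]) auto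
      then have "step_size e ((grad \<phi> e)\<^sup>2) \<le> b e powr (- 1 / a) * (K + 1 / T * (b e powr (1 / a) * (grad \<phi> e)\<^sup>2))"
        unfolding step_size_def by (intro mult_left_mono) auto
      also have "\<dots> = b e powr (- 1 / a) * K + (b e powr (- 1 / a) * b e powr (1 / a)) * ((grad \<phi> e)\<^sup>2 / T)"
        by (simp add: algebra_simps)
      finally show ?thesis by (simp only: inv mult_1)
    qed
    have "(LINT \<phi>|?M. step_size e ((grad \<phi> e)\<^sup>2) * weight \<phi>)
        \<le> (LINT \<phi>|?M. b e powr (- 1 / a) * K * weight \<phi> + 1 / T * ((grad \<phi> e)\<^sup>2 * weight \<phi>))"
    proof (rule integral_mono)
      show "integrable ?M (\<lambda>\<phi>. step_size e ((grad \<phi> e)\<^sup>2) * weight \<phi>)"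
        using step_size_le[OF e] step_size_pos[OF e] by (intro integrable_weight_times) (auto simp: abs_of_pos)
      show "step_size e ((grad \<phi> e)\<^sup>2) * weight \<phi> \<le> b e powr (- 1 / a) * K * weight \<phi> + 1 / T * ((grad \<phi> e)\<^sup>2 * weight \<phi>)" for \<phi>
        using mult_right_mono[OF le, of "weight \<phi>" \<phi>] power_weight_pos[of N b a \<phi>] by (simp add: distrib_right)
    qed (use int1 int2 in auto)
    also have "\<dots> = b e powr (- 1 / a) * K * (LINT \<phi>|?M. weight \<phi>) + 1 / T * (LINT \<phi>|?M. (grad \<phi> e)\<^sup>2 * weight \<phi>)"
      by (subst Bochner_Integration.integral_add) (use int1 int2 in auto)
    finally have "T / 2 * (LINT \<phi>|?M. step_size e ((grad \<phi> e)\<^sup>2) * weight \<phi>)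
        \<le> T / 2 * (b e powr (- 1 / a) * K * (LINT \<phi>|?M. weight \<phi>) + 1 / T * (LINT \<phi>|?M. (grad \<phi> e)\<^sup>2 * weight \<phi>))"
      using T by (intro mult_left_mono) auto
    also have "\<dots> = resistance_const a / 2 * b e powr (- 1 / a) * (LINT \<phi>|?M. weight \<phi>) + (LINT \<phi>|?M. (grad \<phi> e)\<^sup>2 * weight \<phi>) / 2"
      using T by (simp add: R field_simps)
    finally show ?thesis .
  qed
  then have "(\<Sum>e\<in>edges N. (\<theta> e)\<^sup>2 * (T / 2 * (LINT \<phi>|?M. step_size e ((grad \<phi> e)\<^sup>2) * weight \<phi>)))
      \<le> (\<Sum>e\<in>edges N. (\<theta> e)\<^sup>2 * (resistance_const a / 2 * b e powr (- 1 / a) * (LINT \<phi>|?M. weight \<phi>)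
        + (LINT \<phi>|?M. (grad \<phi> e)\<^sup>2 * weight \<phi>) / 2))"
    by (intro sum_mono mult_left_mono) auto
  moreover have "(\<Sum>e\<in>edges N. (\<theta> e)\<^sup>2 * (T / 2 * (LINT \<phi>|?M. step_size e ((grad \<phi> e)\<^sup>2) * weight \<phi>)))
      = tail_const a 1 / 2 * (\<Sum>e\<in>edges N. (\<theta> e)\<^sup>2 * (LINT \<phi>|?M. step_size e ((grad \<phi> e)\<^sup>2) * weight \<phi>))"
    by (simp add: sum_distrib_left T_def mult_ac)
  ultimately show ?thesis using second_moment_weight[of \<theta>] by linarith
qed

text \<open>The bootstrap applied to the single edge \<open>e\<close>, whose second moment can be absorbed because it is finite.\<close>
lemma edge_second_moment:
  assumes e: "e \<in> edges N"
  shows "(LINT \<phi>|count_space (Omega N). (grad \<phi> e)\<^sup>2 * weight \<phi>)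
    \<le> resistance_const a * b e powr (- 1 / a) * (LINT \<phi>|count_space (Omega N). weight \<phi>)"
proof -
  have "(\<Sum>e'\<in>edges N. of_bool (e' = e) * f e') = f e" for f :: "int \<times> int \<Rightarrow> real"
    using e by (simp add: of_bool_def if_distrib[of "\<lambda>x. x * _"] cong: if_cong)
  moreover have "(of_bool P)\<^sup>2 = (of_bool P :: real)" for P by simp
  ultimately show ?thesis
    using resistance_bootstrap[of "\<lambda>e'. of_bool (e' = e)"] by simp
qed

text \<open>The chain behaves as if edge \<open>e\<close> had the deterministic resistance \<open>b e powr (- 1 / a)\<close>.\<close>
theorem flow_bound:
  "(LINT \<phi>|count_space (Omega N). (\<Sum>e\<in>edges N. \<theta> e * grad \<phi> e)\<^sup>2 * weight \<phi>)
    \<le> resistance_const a * (\<Sum>e\<in>edges N. (\<theta> e)\<^sup>2 * b e powr (- 1 / a)) * (LINT \<phi>|count_space (Omega N). weight \<phi>)"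
proof -
  let ?Z = "LINT \<phi>|count_space (Omega N). weight \<phi>"
  have "(\<Sum>e\<in>edges N. (\<theta> e)\<^sup>2 * (resistance_const a / 2 * b e powr (- 1 / a) * ?Z
        + (LINT \<phi>|count_space (Omega N). (grad \<phi> e)\<^sup>2 * weight \<phi>) / 2))
      \<le> (\<Sum>e\<in>edges N. (\<theta> e)\<^sup>2 * (resistance_const a * b e powr (- 1 / a) * ?Z))"
  proof (intro sum_mono mult_left_mono)
    fix e assume "e \<in> edges N"
    from edge_second_moment[OF this]
    show "resistance_const a / 2 * b e powr (- 1 / a) * ?Z + (LINT \<phi>|count_space (Omega N). (grad \<phi> e)\<^sup>2 * weight \<phi>) / 2
        \<le> resistance_const a * b e powr (- 1 / a) * ?Z" by simp
  qed simp
  also have "\<dots> = resistance_const a * (\<Sum>e\<in>edges N. (\<theta> e)\<^sup>2 * b e powr (- 1 / a)) * ?Z"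
    by (simp add: sum_distrib_left sum_distrib_right mult_ac)
  finally show ?thesis using resistance_bootstrap[of \<theta>] by linarith
qed

end

context cut_system
begin

text \<open>Averaging \<open>exp (- \<kappa> e * c)\<close> over the mixture gives back the edge factor at the squared increment \<open>c\<close>. So the
  heavy-tailed sums of conductances enter only through their Laplace transforms, which are explicit.\<close>
theorem cut_bound:
  assumes "power_chain N a b"
  shows "2 / 3 * (\<Sum>i\<in>I. exp (- (\<Sum>e\<in>edges N. b e * cut_cost e i powr a)))
      * (LINT \<phi>|count_space (Omega N). power_weight N b a \<phi>)
    \<le> (LINT \<phi>|count_space (Omega N). (real_of_int (\<phi> 0))\<^sup>2 * power_weight N b a \<phi>)"
proof -
  interpret power_chain N a b by fact
  let ?M = "count_space (Omega N)"
  let ?p = "\<lambda>n \<phi>. \<Prod>e\<in>edges N. factor n e ((grad \<phi> e)\<^sup>2)"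
  have m1: "\<bar>1\<bar> \<le> 1 * moment_bound N \<phi>" for \<phi> using moment_bound_ge1[of N \<phi>] by simp
  have m2: "\<phi> \<in> Omega N \<Longrightarrow> \<bar>(real_of_int (\<phi> 0))\<^sup>2\<bar> \<le> 1 * moment_bound N \<phi>" for \<phi>
    using height_sq_le_moment_bound[of \<phi> N 0] by simp
  note l1 = moment_limit[of "\<lambda>_. 1" 1, OF m1, simplified]
  note l2 = moment_limit[of "\<lambda>\<phi>. (real_of_int (\<phi> 0))\<^sup>2" 1, OF m2]
  have ineq: "2 / 3 * (\<Sum>i\<in>I. \<Prod>e\<in>edges N. factor n e (cut_cost e i)) * (LINT \<phi>|?M. ?p n \<phi>)
      \<le> (LINT \<phi>|?M. (real_of_int (\<phi> 0))\<^sup>2 * ?p n \<phi>)" for n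
  proof -
    define S where "S = (\<Sum>i\<in>I. \<Prod>e\<in>edges N. factor n e (cut_cost e i))"
    have S0: "0 \<le> S" unfolding S_def by (intro sum_nonneg prod_nonneg ballI factor_nonneg cut_cost_nonneg)
    have S: "(\<Sum>i\<in>I. \<Prod>e\<in>edges N. ennreal (factor n e (cut_cost e i))) = ennreal S"
      unfolding S_def by (subst sum_ennreal[symmetric])
        (auto simp: prod_ennreal factor_nonneg cut_cost_nonneg intro!: prod_nonneg)
    have nn1: "(\<integral>\<^sup>+\<phi>. edge_prod (edges N) (\<lambda>e s. ennreal (factor n e s)) \<phi> \<partial>?M) = ennreal (LINT \<phi>|?M. ?p n \<phi>)"
      by (subst nn_integral_eq_integral[OF l1(1), symmetric]) (auto intro!: nn_integral_cong simp: factor_prod_le edge_prod_ennreal factor_nonneg)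
    have nn2: "(\<integral>\<^sup>+\<phi>. ennreal ((real_of_int (\<phi> 0))\<^sup>2) * edge_prod (edges N) (\<lambda>e s. ennreal (factor n e s)) \<phi> \<partial>?M)
        = ennreal (LINT \<phi>|?M. (real_of_int (\<phi> 0))\<^sup>2 * ?p n \<phi>)"
      by (subst nn_integral_eq_integral[OF l2(1), symmetric])
        (auto simp: factor_prod_le edge_prod_ennreal factor_nonneg ennreal_mult')
    have "lower_ineq (\<lambda>e s. ennreal (factor n e s))"
      by (rule lower_ineq_gauss_mixture) (auto intro: gauss_mixture_factor factor_0_le_1)
    then have "ennreal (2 / 3) * ennreal S * ennreal (LINT \<phi>|?M. ?p n \<phi>) \<le> ennreal (LINT \<phi>|?M. (real_of_int (\<phi> 0))\<^sup>2 * ?p n \<phi>)"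
      unfolding lower_ineq_def nn1 nn2 S .
    moreover have "ennreal (2 / 3) * ennreal S = ennreal (2 / 3 * S)"
      by (rule ennreal_mult'[symmetric]) simp
    moreover have "ennreal (2 / 3 * S) * ennreal (LINT \<phi>|?M. ?p n \<phi>) = ennreal (2 / 3 * S * (LINT \<phi>|?M. ?p n \<phi>))"
      by (rule ennreal_mult'[symmetric]) (use S0 in simp)
    moreover have "0 \<le> (LINT \<phi>|?M. (real_of_int (\<phi> 0))\<^sup>2 * ?p n \<phi>)"
      by (intro integral_nonneg_AE AE_I2 mult_nonneg_nonneg factor_prod_le) simp
    ultimately show ?thesis unfolding S_def by simp
  qed
  have exps: "exp (- (\<Sum>e\<in>edges N. b e * cut_cost e i powr a))
      = (\<Prod>e\<in>edges N. exp (- ((b e powr (1 / a) * cut_cost e i) powr a)))" for i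
    by (simp add: exp_sum sum_negf[symmetric] scale_powr cut_cost_nonneg)
  have "(\<lambda>n. 2 / 3 * (\<Sum>i\<in>I. \<Prod>e\<in>edges N. factor n e (cut_cost e i)) * (LINT \<phi>|?M. ?p n \<phi>))
      \<longlonglongrightarrow> 2 / 3 * (\<Sum>i\<in>I. exp (- (\<Sum>e\<in>edges N. b e * cut_cost e i powr a))) * (LINT \<phi>|?M. weight \<phi>)"
    unfolding exps by (intro tendsto_mult tendsto_const tendsto_sum tendsto_prod factor_tendsto cut_cost_nonneg l1(2))
  then show ?thesis
    by (rule LIMSEQ_le[OF _ l2(2)]) (assumption, intro exI allI impI, rule ineq)
qed

end

section \<open>The energy as a finite sum over edges\<close>

lemma summable_on_int_powr:
  assumes "1 < \<alpha>"
  shows "(\<lambda>j. real_of_int \<bar>i - j\<bar> powr (- \<alpha>)) summable_on A"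
proof -
  have "(\<lambda>k::int. real_of_int \<bar>k\<bar> powr (- \<alpha>)) summable_on UNIV"
    by (rule even_summable_on_int) (use assms in \<open>auto simp: summable_real_powr_iff\<close>)
  then have "(\<lambda>j. real_of_int \<bar>i - j\<bar> powr (- \<alpha>)) summable_on UNIV"
    by (subst summable_on_reindex_bij_witness[where i = "\<lambda>k. i - k" and j = "\<lambda>j. i - j"
          and T = UNIV and h = "\<lambda>k::int. real_of_int \<bar>k\<bar> powr (- \<alpha>)"]) auto
  then show ?thesis by (rule summable_on_subset) auto
qed

definition boundary_coupling :: "nat \<Rightarrow> real \<Rightarrow> int \<Rightarrow> real"
  where "boundary_coupling N \<alpha> i = (\<Sum>\<^sub>\<infinity>j\<in>- {- int N..int N}. real_of_int \<bar>i - j\<bar> powr (- \<alpha>))"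

text \<open>The factor \<open>2\<close> for the exterior accounts for both orders of a pair, which inside the box are separate
  edges.\<close>
definition coupling :: "nat \<Rightarrow> real \<Rightarrow> real \<Rightarrow> int \<times> int \<Rightarrow> real"
  where "coupling N \<beta> \<alpha> = (\<lambda>(i, j). if j \<le> int N then \<beta> * real_of_int \<bar>i - j\<bar> powr (- \<alpha>)
    else 2 * \<beta> * boundary_coupling N \<alpha> i)"

lemma boundary_coupling_ge:
  assumes "1 < \<alpha>" and "finite F" and "F \<subseteq> - {- int N..int N}"
  shows "(\<Sum>j\<in>F. real_of_int \<bar>i - j\<bar> powr (- \<alpha>)) \<le> boundary_coupling N \<alpha> i"
  unfolding boundary_coupling_def
  by (rule finite_sum_le_infsum[OF summable_on_int_powr[OF assms(1)]]) (use assms in auto)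

lemma coupling_pos:
  assumes "1 < \<alpha>" and "0 < \<beta>"
  shows "\<forall>e\<in>edges N. 0 < coupling N \<beta> \<alpha> e"
proof
  fix e assume "e \<in> edges N"
  then obtain i j where e: "e = (i, j)" "i \<noteq> j" "i \<in> {- int N..int N}" by (auto simp: edges_def)
  have "0 < real_of_int \<bar>i - (int N + 1)\<bar> powr (- \<alpha>)" using e by auto
  also have "\<dots> \<le> boundary_coupling N \<alpha> i"
    using boundary_coupling_ge[OF assms(1), of "{int N + 1}" N i] by simp
  finally show "0 < coupling N \<beta> \<alpha> e" using e assms by (simp add: coupling_def)
qed

lemma sum_edges:
  fixes f :: "int \<times> int \<Rightarrow> real"
  shows "(\<Sum>e\<in>edges N. f e) = (\<Sum>i\<in>{- int N..int N}. \<Sum>j\<in>{- int N..int N} - {i}. f (i, j))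
    + (\<Sum>i\<in>{- int N..int N}. f (i, int N + 1))"
proof -
  let ?B = "{- int N..int N}"
  have "edges N = (SIGMA i:?B. ?B - {i}) \<union> (\<lambda>i. (i, int N + 1)) ` ?B" by (auto simp: edges_def)
  moreover have "(\<Sum>e\<in>(SIGMA i:?B. ?B - {i}). f e) = (\<Sum>i\<in>?B. \<Sum>j\<in>?B - {i}. f (i, j))"
    by (subst sum.Sigma) auto
  moreover have "(\<Sum>e\<in>(\<lambda>i. (i, int N + 1)) ` ?B. f e) = (\<Sum>i\<in>?B. f (i, int N + 1))"
    by (subst sum.reindex) (auto simp: inj_on_def)
  moreover have "(SIGMA i:?B. ?B - {i}) \<inter> (\<lambda>i. (i, int N + 1)) ` ?B = {}" by auto
  ultimately show ?thesis by (simp add: sum.union_disjoint)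
qed

lemma sos_energy_eq_sum_edges:
  assumes \<alpha>: "1 < \<alpha>" and q: "0 < q" and \<phi>: "\<phi> \<in> Omega N"
  shows "\<beta> * sos_energy \<alpha> q \<phi> = (\<Sum>e\<in>edges N. coupling N \<beta> \<alpha> e * ((grad \<phi> e)\<^sup>2) powr (q / 2))"
proof -
  let ?B = "{- int N..int N}"
  let ?f = "\<lambda>(i, j). real_of_int \<bar>\<phi> i - \<phi> j\<bar> powr q / real_of_int \<bar>i - j\<bar> powr \<alpha>"
  let ?T = "{(i, j). i \<noteq> j} :: (int \<times> int) set"
  let ?in = "SIGMA i:?B. ?B - {i}" and ?out = "?B \<times> - ?B"
  note s = sos_energy_summable[OF \<alpha> q \<phi>]
  have sub: "?f summable_on A" if "A \<subseteq> ?T" for A by (rule summable_on_subset[OF s that])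
  have "sos_energy \<alpha> q \<phi> = infsum ?f (?in \<union> (?out \<union> prod.swap ` ?out))"
    unfolding sos_energy_def
  proof (rule infsum_cong_neutral)
    fix p assume p: "p \<in> ?T - (?in \<union> (?out \<union> prod.swap ` ?out))"
    obtain i j where ij: "p = (i, j)" by (cases p)
    have "i \<notin> ?B \<and> j \<notin> ?B" using p unfolding ij by (auto simp: image_iff)
    then show "?f p = 0" using Omega_outside[OF \<phi>] by (simp only: ij) simp
  qed auto
  also have "\<dots> = infsum ?f ?in + (infsum ?f ?out + infsum ?f (prod.swap ` ?out))"
  proof -
    have 1: "?in \<subseteq> ?T" "?out \<subseteq> ?T" "prod.swap ` ?out \<subseteq> ?T" "?out \<union> prod.swap ` ?out \<subseteq> ?T" by auto
    have 2: "?in \<inter> (?out \<union> prod.swap ` ?out) = {}" "?out \<inter> prod.swap ` ?out = {}" by auto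
    show ?thesis
      by (simp only: infsum_Un_disjoint[OF sub[OF 1(1)] sub[OF 1(4)] 2(1)]
          infsum_Un_disjoint[OF sub[OF 1(2)] sub[OF 1(3)] 2(2)])
  qed
  also have "infsum ?f (prod.swap ` ?out) = infsum ?f ?out"
    by (subst infsum_reindex) (auto simp: o_def case_prod_beta abs_minus_commute intro!: infsum_cong)
  also have "infsum ?f ?out = (\<Sum>i\<in>?B. real_of_int \<bar>\<phi> i\<bar> powr q * boundary_coupling N \<alpha> i)"
  proof -
    have "infsum ?f ?out = (\<Sum>\<^sub>\<infinity>i\<in>?B. \<Sum>\<^sub>\<infinity>j\<in>- ?B. ?f (i, j))"
    proof -
      have "?f summable_on ?out" by (rule sub) auto
      then have "(\<Sum>\<^sub>\<infinity>i\<in>?B. \<Sum>\<^sub>\<infinity>j\<in>- ?B. ?f (i, j)) = (\<Sum>\<^sub>\<infinity>(i, j)\<in>?out. ?f (i, j))"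
        by (intro infsum_Sigma'_banach) simp
      then show ?thesis by simp
    qed
    also have "\<dots> = (\<Sum>i\<in>?B. \<Sum>\<^sub>\<infinity>j\<in>- ?B. ?f (i, j))" by simp
    also have "\<dots> = (\<Sum>i\<in>?B. real_of_int \<bar>\<phi> i\<bar> powr q * boundary_coupling N \<alpha> i)"
      unfolding boundary_coupling_def
      by (intro sum.cong refl, subst infsum_cmult_right'[symmetric], intro infsum_cong)
        (use Omega_outside[OF \<phi>] in \<open>auto simp: powr_minus divide_inverse\<close>)
    finally show ?thesis .
  qed
  also have "infsum ?f ?in = (\<Sum>i\<in>?B. \<Sum>j\<in>?B - {i}. ?f (i, j))"
    by (subst infsum_finite) (auto simp: sum.Sigma)
  finally have E: "sos_energy \<alpha> q \<phi> = (\<Sum>i\<in>?B. \<Sum>j\<in>?B - {i}. ?f (i, j))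
      + (\<Sum>i\<in>?B. 2 * (real_of_int \<bar>\<phi> i\<bar> powr q * boundary_coupling N \<alpha> i))"
    by (simp add: sum_distrib_left[symmetric])
  have sq: "((real_of_int x)\<^sup>2) powr (q / 2) = real_of_int \<bar>x\<bar> powr q" for x
  proof -
    have "(real_of_int x)\<^sup>2 = real_of_int \<bar>x\<bar> powr 2" by simp
    then show ?thesis by (simp only: powr_powr) simp
  qed
  have inner: "\<beta> * ?f (i, j) = coupling N \<beta> \<alpha> (i, j) * ((grad \<phi> (i, j))\<^sup>2) powr (q / 2)"
    if "j \<in> ?B - {i}" for i j
  proof -
    have c: "coupling N \<beta> \<alpha> (i, j) = \<beta> * real_of_int \<bar>i - j\<bar> powr (- \<alpha>)"
      using that by (simp add: coupling_def)
    show ?thesis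
      unfolding c grad_def fst_conv snd_conv sq prod.case powr_minus by (simp only: divide_inverse mult_ac)
  qed
  have outer: "\<beta> * (2 * (real_of_int \<bar>\<phi> i\<bar> powr q * boundary_coupling N \<alpha> i))
      = coupling N \<beta> \<alpha> (i, int N + 1) * ((grad \<phi> (i, int N + 1))\<^sup>2) powr (q / 2)" for i
    unfolding grad_boundary[OF \<phi>] sq by (simp add: coupling_def)
  show ?thesis
    unfolding E sum_edges distrib_left sum_distrib_left
    by (intro arg_cong2[where f = "(+)"] sum.cong refl inner outer)
qed

lemma sos_weight_eq_power_weight:
  assumes "1 < \<alpha>" and "0 < q" and "\<phi> \<in> Omega N"
  shows "sos_weight \<beta> \<alpha> q \<phi> = power_weight N (coupling N \<beta> \<alpha>) (q / 2) \<phi>"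
  using sos_energy_eq_sum_edges[OF assms, of \<beta>] by (simp add: sos_weight_def power_weight_def)

text \<open>The mean height vanishes by the symmetry under a change of sign.\<close>
lemma sos_var_eq:
  fixes N :: nat
  assumes \<beta>: "0 < \<beta>" and \<alpha>: "1 < \<alpha>" and q: "0 < q"
  defines "w \<equiv> power_weight N (coupling N \<beta> \<alpha>) (q / 2)"
  shows "sos_var N \<beta> \<alpha> q (\<lambda>\<phi>. real_of_int (\<phi> 0))
    = (LINT \<phi>|count_space (Omega N). (real_of_int (\<phi> 0))\<^sup>2 * w \<phi>) / (LINT \<phi>|count_space (Omega N). w \<phi>)"
    and "0 < (LINT \<phi>|count_space (Omega N). w \<phi>)"
proof -
  let ?M = "count_space (Omega N)"
  let ?W = "sos_weight \<beta> \<alpha> q"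
  define Z where "Z = sos_partition N \<beta> \<alpha> q"
  note part = sos_partition_pos[OF assms(1-3), of N, folded Z_def]
  have Z0: "0 < Z" by (rule part(2))
  have W: "w \<phi> = ?W \<phi>" if "\<phi> \<in> Omega N" for \<phi>
    using sos_weight_eq_power_weight[OF \<alpha> q that, of \<beta>] by (simp add: w_def)
  have "Infinite_Set_Sum.abs_summable_on ?W (Omega N)"
  proof -
    have "norm (?W \<phi>) = ?W \<phi>" for \<phi> by (simp add: sos_weight_def)
    then show ?thesis using part(1) by (simp add: abs_summable_equivalent[symmetric])
  qed
  then have "Z = (LINT \<phi>|?M. ?W \<phi>)"
    unfolding Z_def sos_partition_def by (simp add: infsetsum_infsum[symmetric] infsetsum_def)
  also have "\<dots> = (LINT \<phi>|?M. w \<phi>)" by (intro Bochner_Integration.integral_cong) (auto simp: W)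
  finally have Zw: "Z = (LINT \<phi>|?M. w \<phi>)" .
  then show "0 < (LINT \<phi>|?M. w \<phi>)" using Z0 by simp
  have dens: "integral\<^sup>L (sos_measure N \<beta> \<alpha> q) f = (LINT \<phi>|?M. f \<phi> * w \<phi>) / Z" for f :: "_ \<Rightarrow> real"
  proof -
    have "integral\<^sup>L (sos_measure N \<beta> \<alpha> q) f = (LINT \<phi>|?M. (?W \<phi> / Z) *\<^sub>R f \<phi>)"
      unfolding sos_measure_def point_measure_def Z_def[symmetric]
      by (rule integral_density) (use Z0 in \<open>auto simp: sos_weight_def\<close>)
    also have "\<dots> = (LINT \<phi>|?M. f \<phi> * w \<phi> / Z)"
      by (intro Bochner_Integration.integral_cong) (auto simp: W)
    finally show ?thesis by simp
  qed
  have even: "w (\<lambda>k. - \<phi> k) = w \<phi>" for \<phi>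
    by (simp add: w_def power_weight_def grad_def power2_commute)
  have "(LINT \<phi>|?M. real_of_int (\<phi> 0) * w \<phi>) = (LINT \<phi>|?M. real_of_int (- \<phi> 0) * w (\<lambda>k. - \<phi> k))"
    using integral_bij_count_space[OF bij_betw_Omega_uminus[of N], of "\<lambda>\<phi>. real_of_int (\<phi> 0) * w \<phi>"] by simp
  also have "\<dots> = - (LINT \<phi>|?M. real_of_int (\<phi> 0) * w \<phi>)" by (simp add: even)
  finally have "(LINT \<phi>|?M. real_of_int (\<phi> 0) * w \<phi>) = 0" by simp
  then show "sos_var N \<beta> \<alpha> q (\<lambda>\<phi>. real_of_int (\<phi> 0))
    = (LINT \<phi>|?M. (real_of_int (\<phi> 0))\<^sup>2 * w \<phi>) / (LINT \<phi>|?M. w \<phi>)"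
    unfolding sos_var_def dens by (simp add: Zw[symmetric])
qed

lemma power_chain_coupling:
  assumes "0 < \<beta>" and "1 < \<alpha>" and "0 < q" and "q < 2"
  shows "power_chain N (q / 2) (coupling N \<beta> \<alpha>)"
  using coupling_pos[OF assms(2,1)] assms by unfold_locales auto

section \<open>The upper bound: a dyadic flow\<close>

text \<open>A flow that is constant on each of several disjoint classes of edges.\<close>
lemma disjoint_weights:
  fixes w r :: "'k \<Rightarrow> real" and g :: "'e \<Rightarrow> real"
  assumes F: "finite F" and E: "finite E" and A: "\<And>k. k \<in> F \<Longrightarrow> A k \<subseteq> E"
  defines "\<theta> \<equiv> \<lambda>e. \<Sum>k\<in>F. w k * of_bool (e \<in> A k)"
  shows "(\<Sum>e\<in>E. \<theta> e * g e) = (\<Sum>k\<in>F. w k * (\<Sum>e\<in>A k. g e))"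
    and "(\<And>k l. k \<in> F \<Longrightarrow> l \<in> F \<Longrightarrow> k \<noteq> l \<Longrightarrow> A k \<inter> A l = {}) \<Longrightarrow>
      (\<Sum>e\<in>E. (\<theta> e)\<^sup>2 * g e) = (\<Sum>k\<in>F. (w k)\<^sup>2 * (\<Sum>e\<in>A k. g e))"
proof -
  have lin: "(\<Sum>e\<in>E. (\<Sum>k\<in>F. v k * of_bool (e \<in> A k)) * g e) = (\<Sum>k\<in>F. v k * (\<Sum>e\<in>A k. g e))" for v
  proof -
    have "(\<Sum>e\<in>E. (\<Sum>k\<in>F. v k * of_bool (e \<in> A k)) * g e) = (\<Sum>k\<in>F. \<Sum>e\<in>E. v k * of_bool (e \<in> A k) * g e)"
      by (simp add: sum_distrib_right sum.swap[of _ F E])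
    also have "\<dots> = (\<Sum>k\<in>F. v k * (\<Sum>e\<in>A k. g e))"
    proof (intro sum.cong refl)
      fix k assume "k \<in> F"
      have "(\<Sum>e\<in>E. v k * of_bool (e \<in> A k) * g e) = (\<Sum>e\<in>A k. v k * g e)"
        using A[OF \<open>k \<in> F\<close>] E by (intro sum.mono_neutral_cong_right) auto
      then show "(\<Sum>e\<in>E. v k * of_bool (e \<in> A k) * g e) = v k * (\<Sum>e\<in>A k. g e)"
        by (simp add: sum_distrib_left)
    qed
    finally show ?thesis .
  qed
  show "(\<Sum>e\<in>E. \<theta> e * g e) = (\<Sum>k\<in>F. w k * (\<Sum>e\<in>A k. g e))"
    unfolding \<theta>_def by (rule lin)
  assume disj: "\<And>k l. k \<in> F \<Longrightarrow> l \<in> F \<Longrightarrow> k \<noteq> l \<Longrightarrow> A k \<inter> A l = {}"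
  have "(\<theta> e)\<^sup>2 = (\<Sum>k\<in>F. (w k)\<^sup>2 * of_bool (e \<in> A k))" for e
  proof (cases "\<exists>k\<in>F. e \<in> A k")
    case True
    then obtain k where k: "k \<in> F" "e \<in> A k" by blast
    have "(\<Sum>l\<in>F. v l * of_bool (e \<in> A l)) = v k" for v :: "'k \<Rightarrow> real"
    proof -
      have "(\<Sum>l\<in>F. v l * of_bool (e \<in> A l)) = (\<Sum>l\<in>F. if l = k then v l else 0)"
        using disj[OF _ k(1)] k(2) by (intro sum.cong refl) auto
      then show ?thesis using k(1) F by simp
    qed
    then show ?thesis by (simp add: \<theta>_def)
  qed (simp add: \<theta>_def)
  then show "(\<Sum>e\<in>E. (\<theta> e)\<^sup>2 * g e) = (\<Sum>k\<in>F. (w k)\<^sup>2 * (\<Sum>e\<in>A k. g e))"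
    using lin[of "\<lambda>k. (w k)\<^sup>2"] by simp
qed

text \<open>The dyadic intervals \<open>{0}\<close>, \<open>{1, 2}\<close>, \<open>{3, \<dots>, 6}\<close>, and so on.\<close>
definition block :: "nat \<Rightarrow> int set"
  where "block k = {2 ^ k - 1..<2 ^ Suc k - 1}"

lemma finite_block [simp]: "finite (block k)"
  by (simp add: block_def)

lemma card_block [simp]: "card (block k) = 2 ^ k"
proof -
  have "2 ^ Suc k - 1 - (2 ^ k - 1) = int (2 ^ k)" by simp
  then show ?thesis unfolding block_def card_atLeastLessThan_int by (simp only: nat_int)
qed

lemma block_disjoint: "k \<noteq> l \<Longrightarrow> block k \<inter> block l = {}"
proof -
  have "block k \<inter> block l = {}" if "k < l" for k l
  proof -
    have "(2::int) ^ Suc k \<le> 2 ^ l" using that by (intro power_increasing) auto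
    then show ?thesis by (auto simp: block_def)
  qed
  then show "k \<noteq> l \<Longrightarrow> ?thesis" by (metis inf_commute linorder_neqE_nat)
qed

lemma ex_last_block:
  fixes N :: nat
  assumes "2 \<le> N"
  obtains K where "2 ^ Suc K \<le> N + 2" and "N + 2 < 2 ^ Suc (Suc K)"
proof -
  obtain n where n: "(2::nat) ^ n \<le> N + 2" "N + 2 < 2 ^ Suc n"
    using ex_power_ivl1[of 2 "N + 2"] by auto
  have "n \<noteq> 0" using n assms by (intro notI) simp
  then show thesis using n that by (cases n) auto
qed

text \<open>The unit current from the origin is spread uniformly over the successive blocks, from every site of a
  block to every site of the next one; the last block that fits into the box is drained to the exterior.\<close>
definition flow_edges :: "nat \<Rightarrow> nat \<Rightarrow> nat \<Rightarrow> (int \<times> int) set"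
  where "flow_edges N K k = (if k = K then block K \<times> {int N + 1} else block k \<times> block (Suc k))"

definition flow_value :: "nat \<Rightarrow> nat \<Rightarrow> real"
  where "flow_value K k = (if k = K then 1 / 2 ^ K else 1 / (2 ^ k * 2 ^ Suc k))"

lemma block_subset_box:
  assumes "2 ^ Suc K \<le> N + 2" and "k \<le> K"
  shows "block k \<subseteq> {0..int N}"
proof -
  have "(2::int) ^ Suc k \<le> 2 ^ Suc K" using assms(2) by (intro power_increasing) auto
  also have "\<dots> \<le> int N + 2" using assms(1) by (metis of_nat_add of_nat_le_iff of_nat_numeral of_nat_power)
  finally show ?thesis by (auto simp: block_def)
qed

lemma flow_edges_subset:
  assumes "2 ^ Suc K \<le> N + 2" and "k \<le> K"
  shows "flow_edges N K k \<subseteq> edges N"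
proof (cases "k = K")
  case True
  then show ?thesis using block_subset_box[OF assms(1) order_refl]
    by (auto simp: flow_edges_def edges_def)
next
  case False
  then have "Suc k \<le> K" using assms(2) by simp
  then show ?thesis
    using block_subset_box[OF assms] block_subset_box[OF assms(1), of "Suc k"] block_disjoint[of k "Suc k"] False
    by (fastforce simp: flow_edges_def edges_def)
qed

lemma flow_edges_disjoint:
  assumes "2 ^ Suc K \<le> N + 2" and "k \<le> K" "l \<le> K" "k \<noteq> l"
  shows "flow_edges N K k \<inter> flow_edges N K l = {}"
  using block_disjoint[OF assms(4)] by (auto simp: flow_edges_def)

text \<open>Each stage telescopes into a difference of block averages.\<close>
lemma flow_divergence:
  assumes K: "2 ^ Suc K \<le> N + 2" and \<phi>: "\<phi> \<in> Omega N"
  shows "(\<Sum>k\<le>K. flow_value K k * (\<Sum>e\<in>flow_edges N K k. grad \<phi> e)) = real_of_int (\<phi> 0)"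
proof -
  define m where "m = (\<lambda>k. (\<Sum>i\<in>block k. real_of_int (\<phi> i)) / 2 ^ k)"
  have step: "flow_value K k * (\<Sum>e\<in>flow_edges N K k. grad \<phi> e) = m k - m (Suc k)" if "k < K" for k
  proof -
    have "(\<Sum>e\<in>flow_edges N K k. grad \<phi> e) = (\<Sum>i\<in>block k. \<Sum>j\<in>block (Suc k). real_of_int (\<phi> i) - real_of_int (\<phi> j))"
      using that by (simp add: flow_edges_def sum.cartesian_product grad_def case_prod_beta)
    also have "\<dots> = 2 ^ Suc k * (\<Sum>i\<in>block k. real_of_int (\<phi> i)) - 2 ^ k * (\<Sum>j\<in>block (Suc k). real_of_int (\<phi> j))"
      by (simp add: sum_subtractf sum_distrib_left)
    finally show ?thesis using that by (simp add: flow_value_def m_def field_simps)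
  qed
  have last: "flow_value K K * (\<Sum>e\<in>flow_edges N K K. grad \<phi> e) = m K"
  proof -
    have "flow_edges N K K = (\<lambda>i. (i, int N + 1)) ` block K" by (auto simp: flow_edges_def)
    then have "(\<Sum>e\<in>flow_edges N K K. grad \<phi> e) = (\<Sum>i\<in>block K. real_of_int (\<phi> i))"
      by (simp add: sum.reindex inj_on_def grad_boundary[OF \<phi>])
    then show ?thesis by (simp add: flow_value_def m_def)
  qed
  have "(\<Sum>k\<le>K. flow_value K k * (\<Sum>e\<in>flow_edges N K k. grad \<phi> e)) = (\<Sum>k<K. m k - m (Suc k)) + m K"
    using step last by (simp add: lessThan_Suc_atMost[symmetric])
  also have "\<dots> = m 0" by (simp add: sum_lessThan_telescope')
  also have "\<dots> = real_of_int (\<phi> 0)"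
  proof -
    have "block 0 = {0}" by (auto simp: block_def)
    then show ?thesis by (simp add: m_def)
  qed
  finally show ?thesis .
qed

definition block_resistance :: "real \<Rightarrow> real \<Rightarrow> real \<Rightarrow> real"
  where "block_resistance \<beta> \<alpha> q = (\<beta> * 3 powr (- \<alpha>)) powr (- 2 / q)"

definition boundary_resistance :: "real \<Rightarrow> real \<Rightarrow> real \<Rightarrow> real"
  where "boundary_resistance \<beta> \<alpha> q = 4 * (2 * \<beta> * 3 powr (- \<alpha>)) powr (- 2 / q)"

lemma block_edge_resistance:
  assumes \<beta>: "0 < \<beta>" and \<alpha>: "1 < \<alpha>" and q: "0 < q"
    and K: "2 ^ Suc K \<le> N + 2" and k: "k < K" and e: "e \<in> flow_edges N K k"
  shows "coupling N \<beta> \<alpha> e powr (- 2 / q) \<le> block_resistance \<beta> \<alpha> q * (2 ^ k) powr (2 * \<alpha> / q)"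
proof -
  obtain i j where e: "e = (i, j)" and i: "i \<in> block k" and j: "j \<in> block (Suc k)"
    using e k by (auto simp: flow_edges_def)
  have jN: "j \<le> int N" using block_subset_box[OF K, of "Suc k"] k j by auto
  have ij: "i < j" "j - i \<le> 3 * 2 ^ k" using i j by (auto simp: block_def)
  have d: "1 \<le> real_of_int \<bar>i - j\<bar>" "real_of_int \<bar>i - j\<bar> \<le> 3 * 2 ^ k"
  proof -
    show "1 \<le> real_of_int \<bar>i - j\<bar>" using ij by simp
    have "real_of_int (j - i) \<le> real_of_int (3 * 2 ^ k)" using ij(2) by (simp only: of_int_le_iff)
    then show "real_of_int \<bar>i - j\<bar> \<le> 3 * 2 ^ k" using ij(1) by simp
  qed
  have "\<beta> * (3 * 2 ^ k) powr (- \<alpha>) \<le> coupling N \<beta> \<alpha> e"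
    unfolding e coupling_def using jN d \<beta> \<alpha> by (auto intro!: mult_left_mono powr_mono2')
  then have "coupling N \<beta> \<alpha> e powr (- 2 / q) \<le> (\<beta> * (3 * 2 ^ k) powr (- \<alpha>)) powr (- 2 / q)"
    using \<beta> q by (intro powr_mono2') auto
  also have "\<beta> * (3 * 2 ^ k) powr (- \<alpha>) = (\<beta> * 3 powr (- \<alpha>)) * (2 ^ k) powr (- \<alpha>)"
    by (simp add: powr_mult)
  also have "\<dots> powr (- 2 / q) = block_resistance \<beta> \<alpha> q * ((2 ^ k) powr (- \<alpha>)) powr (- 2 / q)"
    using \<beta> unfolding block_resistance_def by (intro powr_mult)
  also have "((2 ^ k) powr (- \<alpha>)) powr (- 2 / q) = ((2::real) ^ k) powr (2 * \<alpha> / q)"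
    by (simp add: powr_powr mult.commute)
  finally show ?thesis .
qed

text \<open>A site of the box sees at least \<open>N\<close> exterior sites at distance of order \<open>N\<close>. The bound by a single exterior
  site would lose a factor of order \<open>N powr (2 / q)\<close>.\<close>
lemma boundary_edge_resistance:
  assumes \<beta>: "0 < \<beta>" and \<alpha>: "1 < \<alpha>" and q: "0 < q" "q < 2" and N: "1 \<le> N" and i: "0 \<le> i" "i \<le> int N"
  shows "4 * (coupling N \<beta> \<alpha> (i, int N + 1) powr (- 2 / q) / real N) \<le> boundary_resistance \<beta> \<alpha> q * real N powr (2 * \<alpha> / q - 2)"
proof -
  let ?F = "{int N + 1..2 * int N + 1}"
  have N0: "1 \<le> real N" using N by simp
  have "(\<Sum>j\<in>?F. (3 * real N) powr (- \<alpha>)) \<le> (\<Sum>j\<in>?F. real_of_int \<bar>i - j\<bar> powr (- \<alpha>))"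
  proof (rule sum_mono)
    fix j assume j: "j \<in> ?F"
    \<comment> \<open>The exterior sites used are at most \<open>2 N + 1 \<le> 3 N\<close> away.\<close>
    have "real_of_int \<bar>i - j\<bar> \<le> real_of_int (3 * int N)" using j i N by (simp only: of_int_le_iff) auto
    then show "(3 * real N) powr (- \<alpha>) \<le> real_of_int \<bar>i - j\<bar> powr (- \<alpha>)"
      using j i \<alpha> by (intro powr_mono2') auto
  qed
  also have "\<dots> \<le> boundary_coupling N \<alpha> i" using \<alpha> by (intro boundary_coupling_ge) auto
  finally have t: "real (N + 1) * (3 * real N) powr (- \<alpha>) \<le> boundary_coupling N \<alpha> i" by (simp add: nat_add_distrib)
  have "real N * (3 * real N) powr (- \<alpha>) \<le> real (N + 1) * (3 * real N) powr (- \<alpha>)"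
    by (intro mult_right_mono) auto
  with t have "real N * (3 * real N) powr (- \<alpha>) \<le> boundary_coupling N \<alpha> i" by linarith
  then have "2 * \<beta> * (real N * (3 * real N) powr (- \<alpha>)) \<le> coupling N \<beta> \<alpha> (i, int N + 1)"
    using \<beta> by (simp add: coupling_def)
  moreover have "2 * \<beta> * (real N * (3 * real N) powr (- \<alpha>)) = (2 * \<beta> * 3 powr (- \<alpha>)) * real N powr (1 - \<alpha>)"
    using N0 by (simp add: powr_mult powr_diff powr_minus divide_inverse)
  ultimately have "coupling N \<beta> \<alpha> (i, int N + 1) powr (- 2 / q) \<le> ((2 * \<beta> * 3 powr (- \<alpha>)) * real N powr (1 - \<alpha>)) powr (- 2 / q)"
    using \<beta> q N0 by (intro powr_mono2') auto
  also have "\<dots> = (2 * \<beta> * 3 powr (- \<alpha>)) powr (- 2 / q) * (real N powr (1 - \<alpha>)) powr (- 2 / q)"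
    using \<beta> by (intro powr_mult)
  also have "(real N powr (1 - \<alpha>)) powr (- 2 / q) = real N powr (2 * \<alpha> / q - 2 / q)"
    by (simp add: powr_powr diff_divide_distrib algebra_simps)
  finally have "coupling N \<beta> \<alpha> (i, int N + 1) powr (- 2 / q) / real N
      \<le> (2 * \<beta> * 3 powr (- \<alpha>)) powr (- 2 / q) * (real N powr (2 * \<alpha> / q - 2 / q) / real N)"
    using N0 by (simp add: divide_right_mono)
  also have "real N powr (2 * \<alpha> / q - 2 / q) / real N = real N powr (2 * \<alpha> / q - 2 / q - 1)"
    using N0 by (simp add: powr_diff)
  also have "\<dots> \<le> real N powr (2 * \<alpha> / q - 2)"
  proof (rule powr_mono)
    have "1 \<le> 2 / q" using q by simp
    then show "2 * \<alpha> / q - 2 / q - 1 \<le> 2 * \<alpha> / q - 2" by linarith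
  qed (use N0 in auto)
  finally show ?thesis by (simp add: boundary_resistance_def mult_left_mono)
qed

text \<open>Stage \<open>k\<close> of the flow uses \<open>2 * 4 ^ k\<close> edges of length at most \<open>3 * 2 ^ k\<close>, each with current \<open>1 / (2 * 4 ^ k)\<close>.
  It dissipates at most a constant times \<open>2 powr (k * (2 * \<alpha> / q - 2))\<close>.\<close>
lemma second_moment_upper:
  assumes \<beta>: "0 < \<beta>" and \<alpha>: "1 < \<alpha>" and q: "0 < q" "q < 2" and N: "2 \<le> N"
    and K: "2 ^ Suc K \<le> N + 2" "N + 2 < 2 ^ Suc (Suc K)"
  shows "sos_var N \<beta> \<alpha> q (\<lambda>\<phi>. real_of_int (\<phi> 0)) \<le> resistance_const (q / 2) *
    (block_resistance \<beta> \<alpha> q * (\<Sum>k<K. (2 powr (2 * \<alpha> / q - 2)) ^ k)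
      + boundary_resistance \<beta> \<alpha> q * real N powr (2 * \<alpha> / q - 2))"
proof -
  interpret power_chain N "q / 2" "coupling N \<beta> \<alpha>" by (rule power_chain_coupling[OF \<beta> \<alpha> q])
  let ?M = "count_space (Omega N)" and ?p = "2 * \<alpha> / q - 2"
  define \<theta> where "\<theta> = (\<lambda>e. \<Sum>k\<le>K. flow_value K k * of_bool (e \<in> flow_edges N K k))"
  define r where "r = (\<lambda>e. coupling N \<beta> \<alpha> e powr (- 1 / (q / 2)))"
  have r: "r e = coupling N \<beta> \<alpha> e powr (- 2 / q)" for e by (simp add: r_def)
  note Z = sos_var_eq[OF \<beta> \<alpha> q(1), of N]
  have "(LINT \<phi>|?M. (real_of_int (\<phi> 0))\<^sup>2 * weight \<phi>) = (LINT \<phi>|?M. (\<Sum>e\<in>edges N. \<theta> e * grad \<phi> e)\<^sup>2 * weight \<phi>)"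
  proof (intro Bochner_Integration.integral_cong refl)
    fix \<phi> assume "\<phi> \<in> space ?M"
    then have "(\<Sum>e\<in>edges N. \<theta> e * grad \<phi> e) = real_of_int (\<phi> 0)"
      unfolding \<theta>_def using flow_edges_subset[OF K(1)] flow_divergence[OF K(1)]
      by (subst disjoint_weights(1)) auto
    then show "(real_of_int (\<phi> 0))\<^sup>2 * weight \<phi> = (\<Sum>e\<in>edges N. \<theta> e * grad \<phi> e)\<^sup>2 * weight \<phi>" by simp
  qed
  also have "\<dots> \<le> resistance_const (q / 2) * (\<Sum>e\<in>edges N. (\<theta> e)\<^sup>2 * r e) * (LINT \<phi>|?M. weight \<phi>)"
    unfolding r_def by (rule flow_bound)
  finally have "sos_var N \<beta> \<alpha> q (\<lambda>\<phi>. real_of_int (\<phi> 0)) \<le> resistance_const (q / 2) * (\<Sum>e\<in>edges N. (\<theta> e)\<^sup>2 * r e)"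
    using Z(2) unfolding Z(1) by (simp add: divide_le_eq)
  moreover have "(\<Sum>e\<in>edges N. (\<theta> e)\<^sup>2 * r e)
      \<le> block_resistance \<beta> \<alpha> q * (\<Sum>k<K. (2 powr ?p) ^ k) + boundary_resistance \<beta> \<alpha> q * real N powr ?p"
  proof -
  have "(\<Sum>e\<in>edges N. (\<theta> e)\<^sup>2 * r e) = (\<Sum>k\<le>K. (flow_value K k)\<^sup>2 * (\<Sum>e\<in>flow_edges N K k. r e))"
    unfolding \<theta>_def using flow_edges_subset[OF K(1)] flow_edges_disjoint[OF K(1)]
    by (intro disjoint_weights(2)) auto
  also have "\<dots> = (\<Sum>k<K. (flow_value K k)\<^sup>2 * (\<Sum>e\<in>flow_edges N K k. r e)) + (flow_value K K)\<^sup>2 * (\<Sum>e\<in>flow_edges N K K. r e)"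
    by (simp add: lessThan_Suc_atMost[symmetric])
  also have "\<dots> \<le> block_resistance \<beta> \<alpha> q * (\<Sum>k<K. (2 powr ?p) ^ k) + boundary_resistance \<beta> \<alpha> q * real N powr ?p"
  proof (rule add_mono)
    show "(\<Sum>k<K. (flow_value K k)\<^sup>2 * (\<Sum>e\<in>flow_edges N K k. r e)) \<le> block_resistance \<beta> \<alpha> q * (\<Sum>k<K. (2 powr ?p) ^ k)"
      unfolding sum_distrib_left[of "block_resistance \<beta> \<alpha> q"]
    proof (rule sum_mono)
      fix k assume "k \<in> {..<K}"
      then have k: "k < K" by simp
      define P where "P = ((2::real) ^ k)"
      have P: "0 < P" by (simp add: P_def)
      let ?R = "block_resistance \<beta> \<alpha> q"
      have R: "0 \<le> ?R" by (simp add: block_resistance_def)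
      have "(\<Sum>e\<in>flow_edges N K k. r e) \<le> (\<Sum>e\<in>flow_edges N K k. ?R * P powr (2 * \<alpha> / q))"
        unfolding r P_def by (intro sum_mono block_edge_resistance[OF \<beta> \<alpha> q(1) K(1) k])
      also have "\<dots> = (2 * P\<^sup>2) * (?R * P powr (2 * \<alpha> / q))"
        using k by (simp add: flow_edges_def card_cartesian_product P_def power2_eq_square)
      finally have "(flow_value K k)\<^sup>2 * (\<Sum>e\<in>flow_edges N K k. r e) \<le> (flow_value K k)\<^sup>2 * ((2 * P\<^sup>2) * (?R * P powr (2 * \<alpha> / q)))"
        by (intro mult_left_mono) auto
      also have fv: "flow_value K k = 1 / (2 * P\<^sup>2)"
        using k by (simp add: flow_value_def P_def power2_eq_square)
      also have "(1 / (2 * P\<^sup>2))\<^sup>2 * ((2 * P\<^sup>2) * (?R * P powr (2 * \<alpha> / q))) = 1 / 2 * (?R * (P powr (2 * \<alpha> / q) / P\<^sup>2))"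
        using P by (simp add: field_simps power2_eq_square)
      also have "\<dots> \<le> 1 * (?R * (P powr (2 * \<alpha> / q) / P\<^sup>2))"
        using R P by (intro mult_right_mono) auto
      also have "P powr (2 * \<alpha> / q) / P\<^sup>2 = P powr ?p" using P by (simp add: powr_diff)
      also have "P powr ?p = (2 powr ?p) ^ k"
        unfolding P_def by (simp add: powr_realpow[symmetric] powr_powr mult.commute)
      finally show "(flow_value K k)\<^sup>2 * (\<Sum>e\<in>flow_edges N K k. r e) \<le> ?R * (2 powr ?p) ^ k" by (simp add: fv)
    qed
    show "(flow_value K K)\<^sup>2 * (\<Sum>e\<in>flow_edges N K K. r e) \<le> boundary_resistance \<beta> \<alpha> q * real N powr ?p"
    proof -
      let ?c = "boundary_resistance \<beta> \<alpha> q * real N powr ?p"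
      have N0: "0 < real N" using N by simp
      have "(\<Sum>e\<in>flow_edges N K K. r e) = (\<Sum>i\<in>block K. r (i, int N + 1))"
      proof -
        have "flow_edges N K K = (\<lambda>i. (i, int N + 1)) ` block K" by (auto simp: flow_edges_def)
        then show ?thesis by (simp add: sum.reindex inj_on_def)
      qed
      also have "\<dots> \<le> (\<Sum>i\<in>block K. real N / 4 * ?c)"
      proof (rule sum_mono)
        fix i assume "i \<in> block K"
        then have "0 \<le> i" "i \<le> int N" using block_subset_box[OF K(1) order_refl] by auto
        from boundary_edge_resistance[OF \<beta> \<alpha> q _ this] N
        show "r (i, int N + 1) \<le> real N / 4 * ?c" unfolding r using N0 by (simp add: field_simps)
      qed
      also have "\<dots> = 2 ^ K * (real N / 4 * ?c)" by simp
      finally have "(flow_value K K)\<^sup>2 * (\<Sum>e\<in>flow_edges N K K. r e) \<le> (1 / 2 ^ K)\<^sup>2 * (2 ^ K * (real N / 4 * ?c))"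
        unfolding flow_value_def by (simp add: mult_left_mono)
      also have "\<dots> = (real N / (4 * 2 ^ K)) * ?c" by (simp add: power2_eq_square)
      also have "\<dots> \<le> 1 * ?c"
      proof (rule mult_right_mono)
        have "real (N + 2) < real (2 ^ Suc (Suc K))" using K(2) by (simp only: of_nat_less_iff)
        then show "real N / (4 * 2 ^ K) \<le> 1" by simp
        show "0 \<le> ?c" by (simp add: boundary_resistance_def)
      qed
      finally show ?thesis by simp
    qed
  qed
  finally show ?thesis .
  qed
  ultimately show ?thesis
    using resistance_const_pos[of "q / 2"] q by (meson half_gt_zero less_imp_le mult_left_mono order_trans)
qed

text \<open>The three cases are the regimes of a geometric series.\<close>
theorem variance_upper:
  assumes \<beta>: "0 < \<beta>" and \<alpha>: "1 < \<alpha>" and q: "0 < q" "q < 2"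
  shows "\<exists>C. \<forall>N\<ge>2. (\<alpha> < q \<longrightarrow> sos_var N \<beta> \<alpha> q (\<lambda>\<phi>. real_of_int (\<phi> 0)) \<le> C) \<and>
    (\<alpha> = q \<longrightarrow> sos_var N \<beta> \<alpha> q (\<lambda>\<phi>. real_of_int (\<phi> 0)) \<le> C * ln (real N)) \<and>
    (q < \<alpha> \<longrightarrow> sos_var N \<beta> \<alpha> q (\<lambda>\<phi>. real_of_int (\<phi> 0)) \<le> C * real N powr (2 * \<alpha> / q - 2))"
proof -
  let ?p = "2 * \<alpha> / q - 2" and ?V = "\<lambda>N. sos_var N \<beta> \<alpha> q (\<lambda>\<phi>. real_of_int (\<phi> 0))"
  define x where "x = (2::real) powr ?p"
  define R where "R = resistance_const (q / 2)"
  define A where "A = block_resistance \<beta> \<alpha> q"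
  define B where "B = boundary_resistance \<beta> \<alpha> q"
  have nonneg: "0 \<le> R" "0 \<le> A" "0 \<le> B"
    using resistance_const_pos[of "q / 2"] q by (auto simp: R_def A_def B_def block_resistance_def boundary_resistance_def)
  \<comment> \<open>The number of full blocks is at most logarithmic in \<open>N\<close>.\<close>
  have bound: "\<exists>K. 2 ^ K \<le> N \<and> ?V N \<le> R * (A * (\<Sum>k<K. x ^ k) + B * real N powr ?p)" if N: "2 \<le> N" for N
  proof -
    obtain K where K: "2 ^ Suc K \<le> N + 2" "N + 2 < 2 ^ Suc (Suc K)" using ex_last_block[OF N] by blast
    then have "2 ^ K \<le> N" using N by simp
    then show ?thesis using second_moment_upper[OF \<beta> \<alpha> q N K] unfolding x_def R_def A_def B_def by blast
  qed
  consider "\<alpha> < q" | "\<alpha> = q" | "q < \<alpha>" by linarith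
  then show ?thesis
  proof cases
    case 1
    have p: "?p < 0" using 1 q by (simp add: field_simps)
    then have x: "0 < x" "x < 1" by (auto simp: x_def powr_less_one)
    have "?V N \<le> R * (A * (1 / (1 - x)) + B)" if N: "2 \<le> N" for N
    proof -
      obtain K where K: "?V N \<le> R * (A * (\<Sum>k<K. x ^ k) + B * real N powr ?p)" using bound[OF N] by blast
      have "(\<Sum>k<K. x ^ k) = (1 - x ^ K) / (1 - x)" using x by (simp add: sum_gp_strict)
      also have "\<dots> \<le> 1 / (1 - x)" using x by (intro divide_right_mono) auto
      finally have "(\<Sum>k<K. x ^ k) \<le> 1 / (1 - x)" .
      moreover have "real N powr ?p \<le> 1 powr ?p" using N p by (intro powr_mono2') auto
      then have "B * real N powr ?p \<le> B * 1" using nonneg by (intro mult_left_mono) auto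
      ultimately have "R * (A * (\<Sum>k<K. x ^ k) + B * real N powr ?p) \<le> R * (A * (1 / (1 - x)) + B)"
        using nonneg by (intro mult_left_mono add_mono) auto
      then show ?thesis using K by linarith
    qed
    then show ?thesis using 1 by (intro exI[of _ "R * (A * (1 / (1 - x)) + B)"]) auto
  next
    case 2
    have p: "?p = 0" using 2 q by simp
    have "?V N \<le> R * (A / ln 2 + B / ln 2) * ln (real N)" if N: "2 \<le> N" for N
    proof -
      obtain K where KN: "2 ^ K \<le> N" and K: "?V N \<le> R * (A * (\<Sum>k<K. x ^ k) + B * real N powr ?p)" using bound[OF N] by blast
      have "real (2 ^ K) \<le> real N" using KN by (simp only: of_nat_le_iff)
      then have "ln (2 ^ K) \<le> ln (real N)" using N by (subst ln_le_cancel_iff) auto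
      then have k: "real K \<le> ln (real N) / ln 2" by (simp add: ln_realpow field_simps)
      have "ln 2 \<le> ln (real N)" using N by (subst ln_le_cancel_iff) auto
      then have "1 \<le> ln (real N) / ln 2" by (simp add: field_simps)
      then have "A * real K + B * 1 \<le> A * (ln (real N) / ln 2) + B * (ln (real N) / ln 2)"
        using nonneg k by (intro add_mono mult_left_mono) auto
      then have "R * (A * real K + B * 1) \<le> R * (A * (ln (real N) / ln 2) + B * (ln (real N) / ln 2))"
        using nonneg by (intro mult_left_mono) auto
      moreover have "R * (A * (\<Sum>k<K. x ^ k) + B * real N powr ?p) = R * (A * real K + B * 1)"
        using N unfolding x_def p by simp
      moreover have "R * (A * (ln (real N) / ln 2) + B * (ln (real N) / ln 2)) = R * (A / ln 2 + B / ln 2) * ln (real N)"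
        by (simp add: algebra_simps)
      ultimately show ?thesis using K by linarith
    qed
    then show ?thesis using 2 by (intro exI[of _ "R * (A / ln 2 + B / ln 2)"]) auto
  next
    case 3
    have p: "0 < ?p" using 3 q by (simp add: field_simps)
    then have x: "1 < x" by (auto simp: x_def)
    have "?V N \<le> R * (A * (1 / (x - 1)) + B) * real N powr ?p" if N: "2 \<le> N" for N
    proof -
      obtain K where KN: "2 ^ K \<le> N" and K: "?V N \<le> R * (A * (\<Sum>k<K. x ^ k) + B * real N powr ?p)" using bound[OF N] by blast
      have "x ^ K = (2 ^ K) powr ?p"
        unfolding x_def by (simp add: powr_realpow[symmetric] powr_powr mult.commute)
      also have "\<dots> \<le> real N powr ?p"
      proof (rule powr_mono2)
        have "real (2 ^ K) \<le> real N" using KN by (simp only: of_nat_le_iff)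
        then show "2 ^ K \<le> real N" by simp
      qed (use p in auto)
      finally have xK: "x ^ K \<le> real N powr ?p" .
      have "(\<Sum>k<K. x ^ k) = (x ^ K - 1) / (x - 1)" using x geometric_sum[of x K] by simp
      also have "\<dots> \<le> real N powr ?p / (x - 1)" using x xK by (intro divide_right_mono) auto
      finally have "A * (\<Sum>k<K. x ^ k) + B * real N powr ?p \<le> A * (real N powr ?p / (x - 1)) + B * real N powr ?p"
        using nonneg by (intro add_mono mult_left_mono) auto
      then have "R * (A * (\<Sum>k<K. x ^ k) + B * real N powr ?p) \<le> R * (A * (real N powr ?p / (x - 1)) + B * real N powr ?p)"
        using nonneg by (intro mult_left_mono) auto
      also have "\<dots> = R * (A * (1 / (x - 1)) + B) * real N powr ?p" by (simp add: algebra_simps)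
      finally show ?thesis using K by linarith
    qed
    then show ?thesis using 3 by (intro exI[of _ "R * (A * (1 / (x - 1)) + B)"]) auto
  qed
qed

section \<open>The lower bound: equally spaced cuts\<close>

text \<open>The moves raise the intervals \<open>[- l * m, l * m]\<close>, so the cuts have spacing \<open>l\<close>, and placing them symmetrically about
  the origin makes every move end inside the box.\<close>
definition cut_height :: "nat \<Rightarrow> nat \<Rightarrow> int \<Rightarrow> int"
  where "cut_height l m k = of_bool (\<bar>k\<bar> \<le> int (l * m))"

definition cut_jump :: "nat \<Rightarrow> nat \<Rightarrow> (int \<Rightarrow> int) \<Rightarrow> int"
  where "cut_jump l m \<phi> = \<phi> (int (l * m)) - \<phi> (int (l * m) + 1)"

lemma cut_system_cuts:
  assumes l: "1 \<le> l"
  shows "cut_system N {..N div l} (cut_height l) (cut_jump l)"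
proof
  fix i j :: nat
  assume "i \<in> {..N div l}"
  then have "l * i \<le> l * (N div l)" by simp
  also have "\<dots> \<le> N" by simp
  finally have "int (l * i) \<le> int N" by (simp only: of_nat_le_iff)
  then show "cut_height l i \<in> Omega N" by (auto simp: cut_height_def Omega_def)
  show "cut_height l i 0 = 1" by (simp add: cut_height_def)
  have "int (l * i) \<le> int (l * j) \<longleftrightarrow> i \<le> j"
    using l by (simp only: of_nat_le_iff) simp
  moreover have "int (l * i) + 1 \<le> int (l * j) \<longleftrightarrow> i < j"
    using l by (simp only: zless_iff_Suc_zadd[symmetric] zadd_int_left add1_zle_eq of_nat_less_iff) simp
  ultimately show "cut_jump l i (cut_height l j) = of_bool (i = j)"
    unfolding cut_jump_def cut_height_def by (auto simp del: of_nat_mult)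
qed (auto simp: cut_jump_def algebra_simps)

lemma card_multiples:
  assumes l: "1 \<le> l" and "lo \<le> hi"
  shows "real (card {m. lo \<le> int (l * m) \<and> int (l * m) < hi}) \<le> real_of_int (hi - lo) / real l + 1"
proof -
  let ?A = "{m. lo \<le> int (l * m) \<and> int (l * m) < hi}"
  have L: "0 < real l" using l by simp
  have "int ` ?A \<subseteq> {\<lceil>real_of_int lo / real l\<rceil>..<\<lceil>real_of_int hi / real l\<rceil>}"
  proof safe
    fix m assume m: "lo \<le> int (l * m)" "int (l * m) < hi"
    have "real_of_int lo \<le> real_of_int (int (l * m))" "real_of_int (int (l * m)) < real_of_int hi"
      using m by (simp_all only: of_int_le_iff of_int_less_iff)
    then have "real_of_int lo / real l \<le> real m" "real m < real_of_int hi / real l"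
      using L by (simp_all add: field_simps)
    then show "int m \<in> {\<lceil>real_of_int lo / real l\<rceil>..<\<lceil>real_of_int hi / real l\<rceil>}"
      by (simp add: ceiling_le_iff less_ceiling_iff)
  qed
  then have "card (int ` ?A) \<le> card {\<lceil>real_of_int lo / real l\<rceil>..<\<lceil>real_of_int hi / real l\<rceil>}"
    by (intro card_mono) auto
  moreover have "card (int ` ?A) = card ?A" by (intro card_image) (auto simp: inj_on_def)
  ultimately have "card ?A \<le> nat (\<lceil>real_of_int hi / real l\<rceil> - \<lceil>real_of_int lo / real l\<rceil>)" by simp
  moreover have "\<lceil>real_of_int lo / real l\<rceil> \<le> \<lceil>real_of_int hi / real l\<rceil>"
    using assms L by (intro ceiling_mono divide_right_mono) auto
  ultimately have "real (card ?A) \<le> real_of_int (\<lceil>real_of_int hi / real l\<rceil> - \<lceil>real_of_int lo / real l\<rceil>)" by linarith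
  also have "\<dots> \<le> real_of_int hi / real l + 1 - real_of_int lo / real l"
    unfolding of_int_diff
    using ceiling_correct[of "real_of_int hi / real l"] le_of_int_ceiling[of "real_of_int lo / real l"] by linarith
  finally show ?thesis by (simp add: diff_divide_distrib)
qed

text \<open>A bound for \<open>n powr a\<close>, where \<open>n\<close> is the number of cuts that an edge of length \<open>r\<close> can cross. The minimum with \<open>N\<close> is essential
  for the long edges to the exterior.\<close>
definition crossing_factor :: "nat \<Rightarrow> nat \<Rightarrow> real \<Rightarrow> real \<Rightarrow> real"
  where "crossing_factor N l a r = 1 + (min r (real N) / real l) powr a"

lemma powr_add_le:
  fixes a x :: real
  assumes "0 < a" "a < 1" "0 \<le> x"
  shows "(1 + x) powr a \<le> 1 + x powr a"
proof (cases "x = 0")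
  case False
  then have x: "0 < x" using assms by simp
  have "(1 + x) powr (a - 1) \<le> 1 powr (a - 1)" using x assms by (intro powr_mono2') auto
  moreover have "x * (1 + x) powr (a - 1) \<le> x * x powr (a - 1)" using x assms by (intro mult_left_mono powr_mono2') auto
  moreover have "x * x powr (a - 1) = x powr a" using x by (simp add: powr_diff)
  moreover have "(1 + x) powr a = (1 + x) * (1 + x) powr (a - 1)" using x by (simp add: powr_diff)
  ultimately show ?thesis by (simp add: distrib_right)
qed simp

lemma abs_grad_cut_height:
  "\<bar>grad (cut_height l m) (i, j)\<bar> = of_bool (min \<bar>i\<bar> \<bar>j\<bar> \<le> int (l * m) \<and> int (l * m) < max \<bar>i\<bar> \<bar>j\<bar>)"
  by (cases "\<bar>i\<bar> \<le> int (l * m)"; cases "\<bar>j\<bar> \<le> int (l * m)")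
    (simp_all add: grad_def cut_height_def min_le_iff_disj less_max_iff_disj not_less not_le del: of_nat_mult)

lemma max_minus_min: "max x y - min x y = \<bar>x - y\<bar>" for x y :: int
  by (simp add: max_def min_def)

lemma cut_cost_powr_le:
  fixes a d :: real
  assumes a: "0 < a" "a < 1" and l: "1 \<le> l" and d: "real_of_int \<bar>\<bar>i\<bar> - \<bar>j\<bar>\<bar> \<le> d"
  shows "cut_system.cut_cost {..N div l} (cut_height l) (i, j) m powr a
    \<le> of_bool (min \<bar>i\<bar> \<bar>j\<bar> \<le> int (l * m) \<and> int (l * m) < max \<bar>i\<bar> \<bar>j\<bar>) * crossing_factor N l a d"
proof -
  interpret cut_system N "{..N div l}" "cut_height l" "cut_jump l" by (rule cut_system_cuts[OF l])
  let ?lo = "min \<bar>i\<bar> \<bar>j\<bar>" and ?hi = "max \<bar>i\<bar> \<bar>j\<bar>"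
  let ?P = "\<lambda>m. ?lo \<le> int (l * m) \<and> int (l * m) < ?hi"
  have d0: "0 \<le> d" using d by linarith
  define c where "c = (\<Sum>m\<in>{..N div l}. \<bar>grad (cut_height l m) (i, j)\<bar>)"
  have c: "c = real (card {m \<in> {..N div l}. ?P m})"
    unfolding c_def abs_grad_cut_height by (simp add: Int_def)
  have fin: "finite {m. ?P m}"
  proof (rule finite_subset)
    show "{m. ?P m} \<subseteq> {..nat ?hi}"
    proof (rule subsetI)
      fix m assume "m \<in> {m. ?P m}"
      then have "int (l * m) < ?hi" by (simp only: mem_Collect_eq)
      moreover have "int m \<le> int (l * m)" using l by (simp only: of_nat_le_iff) simp
      ultimately have "int m < ?hi" by linarith
      then have "m \<le> nat ?hi" by linarith
      then show "m \<in> {..nat ?hi}" by simp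
    qed
  qed simp
  have "card {m \<in> {..N div l}. ?P m} \<le> card {m. ?P m}" by (rule card_mono[OF fin]) auto
  then have "c \<le> real (card {m. ?P m})" unfolding c by (simp only: of_nat_le_iff)
  also have "\<dots> \<le> real_of_int (?hi - ?lo) / real l + 1"
    by (rule card_multiples[OF l order_trans[OF min.cobounded1 max.cobounded1]])
  finally have "c \<le> real_of_int \<bar>\<bar>i\<bar> - \<bar>j\<bar>\<bar> / real l + 1" unfolding max_minus_min .
  then have c1: "c \<le> d / real l + 1"
    by (rule order_trans[OF _ add_right_mono[OF divide_right_mono[OF d]]]) simp
  have "card {m \<in> {..N div l}. ?P m} \<le> card {..N div l}" by (rule card_mono) auto
  then have "c \<le> real (N div l) + 1" unfolding c by simp
  also have "real (N div l) \<le> real N / real l" by (rule of_nat_div_le_of_nat)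
  finally have c2: "c \<le> real N / real l + 1" by simp
  have "c \<le> 1 + min d (real N) / real l" using c1 c2 by (simp add: min_def)
  moreover have "0 \<le> c" unfolding c by simp
  ultimately have "c powr a \<le> (1 + min d (real N) / real l) powr a" using a by (intro powr_mono2) auto
  also have "\<dots> \<le> crossing_factor N l a d"
    unfolding crossing_factor_def using a d0 by (intro powr_add_le) auto
  finally have "c powr a \<le> crossing_factor N l a d" .
  then show ?thesis unfolding cut_cost_def c_def[symmetric] unfolding abs_grad_cut_height by simp
qed

text \<open>The coupling at distance \<open>r\<close> times the bound for the power of the number of crossed cuts.\<close>
definition range_term :: "nat \<Rightarrow> nat \<Rightarrow> real \<Rightarrow> real \<Rightarrow> nat \<Rightarrow> real"
  where "range_term N l \<alpha> a r = real r powr (- \<alpha>) * crossing_factor N l a (real r)"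

lemma crossing_factor_bounds:
  assumes "0 < a" and "0 \<le> r"
  shows "1 \<le> crossing_factor N l a r" and "crossing_factor N l a r \<le> 1 + (real N / real l) powr a"
  using assms by (auto simp: crossing_factor_def intro!: powr_mono2 divide_right_mono)

lemma crossing_factor_mono:
  assumes "0 < a" and "0 \<le> r" and "r \<le> s"
  shows "crossing_factor N l a r \<le> crossing_factor N l a s"
  using assms by (auto simp: crossing_factor_def intro!: powr_mono2 divide_right_mono)

lemma range_term_nonneg: "0 \<le> range_term N l \<alpha> a r"
  by (simp add: range_term_def crossing_factor_def)

lemma summable_range_term:
  assumes "1 < \<alpha>" and "0 < a"
  shows "summable (range_term N l \<alpha> a)"
proof (rule summable_comparison_test'[where N = 0])
  show "summable (\<lambda>r. real r powr (- \<alpha>) * (1 + (real N / real l) powr a))"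
    using assms by (intro summable_mult2) (simp add: summable_real_powr_iff)
  show "norm (range_term N l \<alpha> a r) \<le> real r powr (- \<alpha>) * (1 + (real N / real l) powr a)" for r
    using crossing_factor_bounds(2)[OF assms(2), of "real r" N l] range_term_nonneg[of N l \<alpha> a r]
    by (simp add: range_term_def mult_left_mono)
qed

lemma infsum_half_line:
  fixes f :: "nat \<Rightarrow> real" and i k :: int and s :: int
  assumes f: "summable f" "\<And>r. 0 \<le> f r" and k: "i \<le> k" and s: "s = 1 \<or> s = - 1"
  shows "(\<lambda>j. f (nat \<bar>i - j\<bar>)) summable_on ((\<lambda>r. i + s * int r) ` {r. k - i < int r})"
    and "(\<Sum>\<^sub>\<infinity>j\<in>(\<lambda>r. i + s * int r) ` {r. k - i < int r}. f (nat \<bar>i - j\<bar>)) = (\<Sum>r. of_bool (k - i < int r) * f r)"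
proof -
  have sm: "summable (\<lambda>r. norm (of_bool (k - i < int r) * f r))"
    by (rule summable_comparison_test'[OF f(1), where N = 0]) (use f(2) in auto)
  have hs: "((\<lambda>r. of_bool (k - i < int r) * f r) has_sum (\<Sum>r. of_bool (k - i < int r) * f r)) UNIV"
    by (rule norm_summable_imp_has_sum[OF sm summable_sums[OF summable_norm_cancel[OF sm]]])
  have hs2: "(f has_sum (\<Sum>r. of_bool (k - i < int r) * f r)) {r. k - i < int r}"
    using hs by (subst has_sum_cong_neutral[where T = UNIV and g = "\<lambda>r. of_bool (k - i < int r) * f r"]) auto
  have inj: "inj_on (\<lambda>r. i + s * int r) {r. k - i < int r}" using s by (auto simp: inj_on_def)
  have "((\<lambda>j. f (nat \<bar>i - j\<bar>)) has_sum (\<Sum>r. of_bool (k - i < int r) * f r)) ((\<lambda>r. i + s * int r) ` {r. k - i < int r})"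
    unfolding has_sum_reindex[OF inj] using hs2 s by (auto simp: o_def)
  then show "(\<lambda>j. f (nat \<bar>i - j\<bar>)) summable_on ((\<lambda>r. i + s * int r) ` {r. k - i < int r})"
    and "(\<Sum>\<^sub>\<infinity>j\<in>(\<lambda>r. i + s * int r) ` {r. k - i < int r}. f (nat \<bar>i - j\<bar>)) = (\<Sum>r. of_bool (k - i < int r) * f r)"
    by (auto simp: has_sum_imp_summable infsumI)
qed

lemma infsum_outside:
  fixes f :: "nat \<Rightarrow> real" and i k :: int
  assumes f: "summable f" "\<And>r. 0 \<le> f r" and i: "\<bar>i\<bar> \<le> k"
  shows "(\<lambda>j. f (nat \<bar>i - j\<bar>)) summable_on {j. k < \<bar>j\<bar>}"
    and "(\<Sum>\<^sub>\<infinity>j\<in>{j. k < \<bar>j\<bar>}. f (nat \<bar>i - j\<bar>))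
      = (\<Sum>r. of_bool (k - i < int r) * f r) + (\<Sum>r. of_bool (k + i < int r) * f r)"
proof -
  have right: "(\<lambda>r. i + 1 * int r) ` {r. k - i < int r} = {k<..}"
  proof (intro set_eqI iffI)
    fix j assume "j \<in> {k<..}"
    then show "j \<in> (\<lambda>r. i + 1 * int r) ` {r. k - i < int r}"
      using i by (intro image_eqI[of _ _ "nat (j - i)"]) auto
  qed auto
  have left: "(\<lambda>r. i + (- 1) * int r) ` {r. k + i < int r} = {..<- k}"
  proof (intro set_eqI iffI)
    fix j assume "j \<in> {..<- k}"
    then show "j \<in> (\<lambda>r. i + (- 1) * int r) ` {r. k + i < int r}"
      using i by (intro image_eqI[of _ _ "nat (i - j)"]) auto
  qed auto
  have U: "{j. k < \<bar>j\<bar>} = {k<..} \<union> {..<- k}" "{k<..} \<inter> {..<- k} = {}" using i by auto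
  note r = infsum_half_line[OF f, of i k 1, unfolded right]
  have l: "(\<lambda>j. f (nat \<bar>i - j\<bar>)) summable_on {..<- k}"
    "(\<Sum>\<^sub>\<infinity>j\<in>{..<- k}. f (nat \<bar>i - j\<bar>)) = (\<Sum>r. of_bool (k + i < int r) * f r)"
    using infsum_half_line[OF f, of i "k + 2 * i" "- 1"] left i
    by (simp_all add: algebra_simps) 
  show "(\<lambda>j. f (nat \<bar>i - j\<bar>)) summable_on {j. k < \<bar>j\<bar>}"
    unfolding U using r(1) l(1) i by (intro summable_on_union) auto
  show "(\<Sum>\<^sub>\<infinity>j\<in>{j. k < \<bar>j\<bar>}. f (nat \<bar>i - j\<bar>))
      = (\<Sum>r. of_bool (k - i < int r) * f r) + (\<Sum>r. of_bool (k + i < int r) * f r)"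
    unfolding U(1) using r l i U(2) by (subst infsum_Un_disjoint) auto
qed

text \<open>At most \<open>min r (2 k + 1)\<close> sites of the interval are at distance less than \<open>r\<close> from its right end,
  and likewise on the left.\<close>
lemma sum_outside_le:
  fixes f :: "nat \<Rightarrow> real" and k :: nat
  assumes f: "summable f" "\<And>r. 0 \<le> f r"
  shows "(\<Sum>i\<in>{- int k..int k}. \<Sum>\<^sub>\<infinity>j\<in>{j. int k < \<bar>j\<bar>}. f (nat \<bar>i - j\<bar>))
    \<le> 2 * (\<Sum>r. min (real r) (2 * real k + 1) * f r)"
proof -
  let ?B = "{- int k..int k}"
  have sm: "summable (\<lambda>r. of_bool (P r) * f r)" for P
    by (rule summable_comparison_test'[OF f(1), where N = 0]) (use f(2) in auto)
  have smin: "summable (\<lambda>r. min (real r) (2 * real k + 1) * f r)"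
  proof (rule summable_comparison_test'[where N = 0])
    show "summable (\<lambda>r. (2 * real k + 1) * f r)" by (intro summable_mult f)
    show "norm (min (real r) (2 * real k + 1) * f r) \<le> (2 * real k + 1) * f r" for r
      using f(2)[of r] by (auto simp: abs_mult intro!: mult_right_mono)
  qed
  have half: "(\<Sum>i\<in>?B. \<Sum>r. of_bool (int k - i < int r) * f r) \<le> (\<Sum>r. min (real r) (2 * real k + 1) * f r)"
  proof -
    have "(\<Sum>i\<in>?B. \<Sum>r. of_bool (int k - i < int r) * f r) = (\<Sum>r. \<Sum>i\<in>?B. of_bool (int k - i < int r) * f r)"
      by (rule suminf_sum[symmetric]) (rule sm)
    also have "\<dots> \<le> (\<Sum>r. min (real r) (2 * real k + 1) * f r)"
    proof (rule suminf_le[OF _ summable_sum[OF sm] smin])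
      fix r
      have "(\<Sum>i\<in>?B. of_bool (int k - i < int r) :: real) = real (card (?B \<inter> {i. int k - i < int r}))" by simp
      also have "\<dots> \<le> min (real r) (2 * real k + 1)"
      proof (rule min.boundedI)
        have "card (?B \<inter> {i. int k - i < int r}) \<le> card {int k - int r<..int k}" by (intro card_mono) auto
        then show "real (card (?B \<inter> {i. int k - i < int r})) \<le> real r" by simp
        have "card (?B \<inter> {i. int k - i < int r}) \<le> card ?B" by (intro card_mono) auto
        then show "real (card (?B \<inter> {i. int k - i < int r})) \<le> 2 * real k + 1" by simp
      qed
      finally show "(\<Sum>i\<in>?B. of_bool (int k - i < int r) * f r) \<le> min (real r) (2 * real k + 1) * f r"
        unfolding sum_distrib_right[symmetric] using f(2)[of r] by (rule mult_right_mono)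
    qed
    finally show ?thesis .
  qed
  have "(\<Sum>i\<in>?B. \<Sum>r. of_bool (int k + i < int r) * f r) = (\<Sum>i\<in>?B. \<Sum>r. of_bool (int k - i < int r) * f r)"
    by (rule sum.reindex_bij_witness[where i = uminus and j = uminus]) auto
  moreover have "(\<Sum>i\<in>?B. \<Sum>\<^sub>\<infinity>j\<in>{j. int k < \<bar>j\<bar>}. f (nat \<bar>i - j\<bar>))
      = (\<Sum>i\<in>?B. (\<Sum>r. of_bool (int k - i < int r) * f r) + (\<Sum>r. of_bool (int k + i < int r) * f r))"
    using f by (intro sum.cong refl infsum_outside) auto
  ultimately show ?thesis using half by (simp add: sum.distrib)
qed

text \<open>An edge contributes to the cut \<open>m\<close> only if it joins the interval \<open>[- l * m, l * m]\<close> to its complement. Both orders of a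
  pair, and both sides of the interval, contribute a factor \<open>2\<close>.\<close>
lemma cut_exponent_le:
  assumes \<beta>: "0 < \<beta>" and \<alpha>: "1 < \<alpha>" and a: "0 < a" "a < 1" and l: "1 \<le> l" and m: "m \<le> N div l"
  shows "(\<Sum>e\<in>edges N. coupling N \<beta> \<alpha> e * cut_system.cut_cost {..N div l} (cut_height l) e m powr a)
    \<le> 4 * \<beta> * (\<Sum>r. min (real r) (2 * real (l * m) + 1) * range_term N l \<alpha> a r)"
proof -
  define k where "k = l * m"
  define c where "c = (\<lambda>e. cut_system.cut_cost {..N div l} (cut_height l) e m powr a)"
  define \<psi> where "\<psi> = range_term N l \<alpha> a"
  let ?B = "{- int N..int N}" and ?I = "{- int k..int k}"
  let ?O = "\<lambda>i. \<Sum>\<^sub>\<infinity>j\<in>{j. int k < \<bar>j\<bar>}. \<psi> (nat \<bar>i - j\<bar>)"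
  have \<psi>: "summable \<psi>" "\<And>r. 0 \<le> \<psi> r" unfolding \<psi>_def by (rule summable_range_term[OF \<alpha> a(1)] range_term_nonneg)+
  have "l * m \<le> l * (N div l)" using m by simp
  with times_div_less_eq_dividend[of l N] have "k \<le> N" unfolding k_def by linarith
  then have kN: "int k \<le> int N" by simp
  have psi_eq: "\<psi> (nat \<bar>i - j\<bar>) = real_of_int \<bar>i - j\<bar> powr (- \<alpha>) * crossing_factor N l a (real_of_int \<bar>i - j\<bar>)" for i j
    by (simp add: \<psi>_def range_term_def)
  have c0: "0 \<le> c e" for e by (simp add: c_def)
  have in_edge: "coupling N \<beta> \<alpha> (i, j) * c (i, j) \<le> \<beta> * (of_bool (\<bar>i\<bar> \<le> int k \<and> int k < \<bar>j\<bar>) * \<psi> (nat \<bar>i - j\<bar>)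
      + of_bool (\<bar>j\<bar> \<le> int k \<and> int k < \<bar>i\<bar>) * \<psi> (nat \<bar>i - j\<bar>))" if "j \<in> ?B" for i j
  proof -
    have "c (i, j) \<le> of_bool (min \<bar>i\<bar> \<bar>j\<bar> \<le> int k \<and> int k < max \<bar>i\<bar> \<bar>j\<bar>) * crossing_factor N l a (real_of_int \<bar>i - j\<bar>)"
      unfolding c_def k_def by (rule cut_cost_powr_le[OF a l]) (simp only: of_int_le_iff abs_triangle_ineq3)
    then have "coupling N \<beta> \<alpha> (i, j) * c (i, j) \<le> (\<beta> * real_of_int \<bar>i - j\<bar> powr (- \<alpha>))
        * (of_bool (min \<bar>i\<bar> \<bar>j\<bar> \<le> int k \<and> int k < max \<bar>i\<bar> \<bar>j\<bar>) * crossing_factor N l a (real_of_int \<bar>i - j\<bar>))"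
      using that \<beta> by (simp add: coupling_def mult_left_mono)
    also have "\<dots> = \<beta> * (of_bool (min \<bar>i\<bar> \<bar>j\<bar> \<le> int k \<and> int k < max \<bar>i\<bar> \<bar>j\<bar>) * \<psi> (nat \<bar>i - j\<bar>))"
      unfolding psi_eq by simp
    also have "\<dots> = \<beta> * (of_bool (\<bar>i\<bar> \<le> int k \<and> int k < \<bar>j\<bar>) * \<psi> (nat \<bar>i - j\<bar>)
      + of_bool (\<bar>j\<bar> \<le> int k \<and> int k < \<bar>i\<bar>) * \<psi> (nat \<bar>i - j\<bar>))"
      by (auto simp: min_def max_def)
    finally show ?thesis .
  qed
  have out_edge: "coupling N \<beta> \<alpha> (i, int N + 1) * c (i, int N + 1)
      \<le> 2 * \<beta> * (of_bool (\<bar>i\<bar> \<le> int k) * (\<Sum>\<^sub>\<infinity>j\<in>- ?B. \<psi> (nat \<bar>i - j\<bar>)))" if i: "i \<in> ?B" for i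
  proof -
    let ?d = "real_of_int (int N + 1 - \<bar>i\<bar>)"
    have "\<bar>\<bar>i\<bar> - \<bar>int N + 1\<bar>\<bar> = int N + 1 - \<bar>i\<bar>" using i by auto
    then have "c (i, int N + 1) \<le> of_bool (min \<bar>i\<bar> \<bar>int N + 1\<bar> \<le> int k \<and> int k < max \<bar>i\<bar> \<bar>int N + 1\<bar>) * crossing_factor N l a ?d"
      unfolding c_def k_def by (intro cut_cost_powr_le[OF a l]) (simp only: order_refl)
    also have "of_bool (min \<bar>i\<bar> \<bar>int N + 1\<bar> \<le> int k \<and> int k < max \<bar>i\<bar> \<bar>int N + 1\<bar>) = (of_bool (\<bar>i\<bar> \<le> int k) :: real)"
      using i kN by (auto simp: min_def max_def)
    finally have c1: "c (i, int N + 1) \<le> of_bool (\<bar>i\<bar> \<le> int k) * crossing_factor N l a ?d" .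
    have bc: "0 \<le> boundary_coupling N \<alpha> i" unfolding boundary_coupling_def by (intro infsum_nonneg) auto
    have "boundary_coupling N \<alpha> i * crossing_factor N l a ?d \<le> (\<Sum>\<^sub>\<infinity>j\<in>- ?B. \<psi> (nat \<bar>i - j\<bar>))"
      unfolding boundary_coupling_def infsum_cmult_left'[symmetric]
    proof (rule infsum_mono)
      show "(\<lambda>j. real_of_int \<bar>i - j\<bar> powr (- \<alpha>) * crossing_factor N l a ?d) summable_on - ?B"
        by (intro summable_on_cmult_left summable_on_int_powr[OF \<alpha>])
      have "- ?B = {j. int N < \<bar>j\<bar>}" by auto
      then show "(\<lambda>j. \<psi> (nat \<bar>i - j\<bar>)) summable_on - ?B"
        using infsum_outside(1)[OF \<psi>, of i "int N"] i by auto
      fix j assume j: "j \<in> - ?B"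
      have "int N + 1 - \<bar>i\<bar> \<le> \<bar>i - j\<bar>" using i j by auto
      then have "?d \<le> real_of_int \<bar>i - j\<bar>" by (simp only: of_int_le_iff)
      moreover have "0 \<le> ?d" using i by auto
      ultimately show "real_of_int \<bar>i - j\<bar> powr (- \<alpha>) * crossing_factor N l a ?d \<le> \<psi> (nat \<bar>i - j\<bar>)"
        unfolding psi_eq using a by (intro mult_left_mono crossing_factor_mono) auto
    qed
    then have "of_bool (\<bar>i\<bar> \<le> int k) * (boundary_coupling N \<alpha> i * crossing_factor N l a ?d)
        \<le> of_bool (\<bar>i\<bar> \<le> int k) * (\<Sum>\<^sub>\<infinity>j\<in>- ?B. \<psi> (nat \<bar>i - j\<bar>))" by (intro mult_left_mono) auto
    moreover have "boundary_coupling N \<alpha> i * c (i, int N + 1) \<le> boundary_coupling N \<alpha> i * (of_bool (\<bar>i\<bar> \<le> int k) * crossing_factor N l a ?d)"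
      using bc c1 by (intro mult_left_mono)
    ultimately have "boundary_coupling N \<alpha> i * c (i, int N + 1) \<le> of_bool (\<bar>i\<bar> \<le> int k) * (\<Sum>\<^sub>\<infinity>j\<in>- ?B. \<psi> (nat \<bar>i - j\<bar>))"
      by (simp only: mult.left_commute)
    then have "2 * \<beta> * (boundary_coupling N \<alpha> i * c (i, int N + 1)) \<le> 2 * \<beta> * (of_bool (\<bar>i\<bar> \<le> int k) * (\<Sum>\<^sub>\<infinity>j\<in>- ?B. \<psi> (nat \<bar>i - j\<bar>)))"
      using \<beta> by (intro mult_left_mono) auto
    then show ?thesis by (simp add: coupling_def mult.assoc)
  qed
  have IB: "?I \<subseteq> ?B" using kN by auto
  define J where "J = {j \<in> ?B. int k < \<bar>j\<bar>}"
  have JB: "(\<Sum>i\<in>?B. \<Sum>j\<in>?B. of_bool (\<bar>i\<bar> \<le> int k \<and> int k < \<bar>j\<bar>) * \<psi> (nat \<bar>i - j\<bar>)) = (\<Sum>i\<in>?I. \<Sum>j\<in>J. \<psi> (nat \<bar>i - j\<bar>))"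
  proof -
    have "(\<Sum>j\<in>?B. of_bool (\<bar>i\<bar> \<le> int k \<and> int k < \<bar>j\<bar>) * \<psi> (nat \<bar>i - j\<bar>)) = of_bool (\<bar>i\<bar> \<le> int k) * (\<Sum>j\<in>J. \<psi> (nat \<bar>i - j\<bar>))" for i
      unfolding J_def sum_distrib_left by (intro sum.mono_neutral_cong_right) auto
    then show ?thesis
      using IB by (simp only:) (intro sum.mono_neutral_cong_right; auto)
  qed
  have "(\<Sum>e\<in>edges N. coupling N \<beta> \<alpha> e * c e)
      \<le> (\<Sum>i\<in>?B. \<Sum>j\<in>?B. \<beta> * (of_bool (\<bar>i\<bar> \<le> int k \<and> int k < \<bar>j\<bar>) * \<psi> (nat \<bar>i - j\<bar>)
          + of_bool (\<bar>j\<bar> \<le> int k \<and> int k < \<bar>i\<bar>) * \<psi> (nat \<bar>i - j\<bar>)))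
        + (\<Sum>i\<in>?B. 2 * \<beta> * (of_bool (\<bar>i\<bar> \<le> int k) * (\<Sum>\<^sub>\<infinity>j\<in>- ?B. \<psi> (nat \<bar>i - j\<bar>))))"
    unfolding sum_edges
  proof (intro add_mono sum_mono out_edge)
    fix i assume "i \<in> ?B"
    have "(\<Sum>j\<in>?B - {i}. coupling N \<beta> \<alpha> (i, j) * c (i, j)) \<le> (\<Sum>j\<in>?B - {i}. \<beta> * (of_bool (\<bar>i\<bar> \<le> int k \<and> int k < \<bar>j\<bar>) * \<psi> (nat \<bar>i - j\<bar>)
          + of_bool (\<bar>j\<bar> \<le> int k \<and> int k < \<bar>i\<bar>) * \<psi> (nat \<bar>i - j\<bar>)))"
      by (intro sum_mono in_edge) auto
    also have "\<dots> \<le> (\<Sum>j\<in>?B. \<beta> * (of_bool (\<bar>i\<bar> \<le> int k \<and> int k < \<bar>j\<bar>) * \<psi> (nat \<bar>i - j\<bar>)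
          + of_bool (\<bar>j\<bar> \<le> int k \<and> int k < \<bar>i\<bar>) * \<psi> (nat \<bar>i - j\<bar>)))"
      using \<beta> \<psi>(2) by (intro sum_mono2 mult_nonneg_nonneg add_nonneg_nonneg) auto
    finally show "(\<Sum>j\<in>?B - {i}. coupling N \<beta> \<alpha> (i, j) * c (i, j)) \<le> (\<Sum>j\<in>?B. \<beta> * (of_bool (\<bar>i\<bar> \<le> int k \<and> int k < \<bar>j\<bar>) * \<psi> (nat \<bar>i - j\<bar>)
          + of_bool (\<bar>j\<bar> \<le> int k \<and> int k < \<bar>i\<bar>) * \<psi> (nat \<bar>i - j\<bar>)))" .
  qed
  also have "\<dots> = 2 * \<beta> * (\<Sum>i\<in>?I. (\<Sum>j\<in>J. \<psi> (nat \<bar>i - j\<bar>)) + (\<Sum>\<^sub>\<infinity>j\<in>- ?B. \<psi> (nat \<bar>i - j\<bar>)))"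
  proof -
    have "(\<Sum>i\<in>?B. \<Sum>j\<in>?B. of_bool (\<bar>j\<bar> \<le> int k \<and> int k < \<bar>i\<bar>) * \<psi> (nat \<bar>i - j\<bar>)) = (\<Sum>i\<in>?I. \<Sum>j\<in>J. \<psi> (nat \<bar>i - j\<bar>))"
      by (subst sum.swap) (simp only: abs_minus_commute JB[symmetric])
    moreover have "(\<Sum>i\<in>?B. of_bool (\<bar>i\<bar> \<le> int k) * (\<Sum>\<^sub>\<infinity>j\<in>- ?B. \<psi> (nat \<bar>i - j\<bar>))) = (\<Sum>i\<in>?I. \<Sum>\<^sub>\<infinity>j\<in>- ?B. \<psi> (nat \<bar>i - j\<bar>))"
      using IB by (intro sum.mono_neutral_cong_right) auto
    ultimately show ?thesis
      using JB by (simp add: sum.distrib sum_distrib_left[symmetric] distrib_left)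
  qed
  also have "(\<Sum>i\<in>?I. (\<Sum>j\<in>J. \<psi> (nat \<bar>i - j\<bar>)) + (\<Sum>\<^sub>\<infinity>j\<in>- ?B. \<psi> (nat \<bar>i - j\<bar>))) = (\<Sum>i\<in>?I. ?O i)"
  proof (intro sum.cong refl)
    fix i assume i: "i \<in> ?I"
    have U: "{j. int k < \<bar>j\<bar>} = J \<union> - ?B" "J \<inter> - ?B = {}" using kN by (auto simp: J_def)
    have fin: "finite J" by (rule finite_subset[of _ ?B]) (auto simp: J_def)
    have "(\<lambda>j. \<psi> (nat \<bar>i - j\<bar>)) summable_on {j. int k < \<bar>j\<bar>}" using i by (intro infsum_outside(1)[OF \<psi>]) auto
    then have "(\<lambda>j. \<psi> (nat \<bar>i - j\<bar>)) summable_on - ?B" by (rule summable_on_subset) (auto simp: U)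
    then show "(\<Sum>j\<in>J. \<psi> (nat \<bar>i - j\<bar>)) + (\<Sum>\<^sub>\<infinity>j\<in>- ?B. \<psi> (nat \<bar>i - j\<bar>)) = ?O i"
      unfolding U(1) using fin U(2) by (subst infsum_Un_disjoint) auto
  qed
  also have "2 * \<beta> * (\<Sum>i\<in>?I. ?O i) \<le> 2 * \<beta> * (2 * (\<Sum>r. min (real r) (2 * real k + 1) * \<psi> r))"
    using \<beta> by (intro mult_left_mono sum_outside_le \<psi>) auto
  finally show ?thesis unfolding c_def k_def \<psi>_def by simp
qed

lemma variance_lower_cuts:
  assumes \<beta>: "0 < \<beta>" and \<alpha>: "1 < \<alpha>" and q: "0 < q" "q < 2" and l: "1 \<le> l"
    and S: "\<And>m. m \<le> N div l \<Longrightarrow> (\<Sum>r. min (real r) (2 * real (l * m) + 1) * range_term N l \<alpha> (q / 2) r) \<le> S"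
  shows "2 / 3 * exp (- 4 * \<beta> * S) * (1 + real (N div l)) \<le> sos_var N \<beta> \<alpha> q (\<lambda>\<phi>. real_of_int (\<phi> 0))"
proof -
  interpret cut_system N "{..N div l}" "cut_height l" "cut_jump l" by (rule cut_system_cuts[OF l])
  let ?w = "power_weight N (coupling N \<beta> \<alpha>) (q / 2)"
  note V = sos_var_eq[OF \<beta> \<alpha> q(1), of N]
  let ?E = "\<lambda>m. exp (- (\<Sum>e\<in>edges N. coupling N \<beta> \<alpha> e * cut_cost e m powr (q / 2)))"
  have "exp (- 4 * \<beta> * S) * (1 + real (N div l)) = (\<Sum>m\<in>{..N div l}. exp (- 4 * \<beta> * S))" by (simp add: algebra_simps)
  also have "\<dots> \<le> (\<Sum>m\<in>{..N div l}. ?E m)"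
  proof (rule sum_mono)
    fix m assume "m \<in> {..N div l}"
    then have m: "m \<le> N div l" by simp
    have "(\<Sum>e\<in>edges N. coupling N \<beta> \<alpha> e * cut_cost e m powr (q / 2)) \<le> 4 * \<beta> * S"
      by (rule order_trans[OF cut_exponent_le[OF \<beta> \<alpha> _ _ l m] mult_left_mono[OF S[OF m]]]) (use q \<beta> in auto)
    then show "exp (- 4 * \<beta> * S) \<le> ?E m" by simp
  qed
  finally have "2 / 3 * exp (- 4 * \<beta> * S) * (1 + real (N div l)) * (LINT \<phi>|count_space (Omega N). ?w \<phi>)
      \<le> 2 / 3 * (\<Sum>m\<in>{..N div l}. ?E m) * (LINT \<phi>|count_space (Omega N). ?w \<phi>)"
    using V(2) by (intro mult_right_mono) (auto simp: mult_ac)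
  also have "\<dots> \<le> (LINT \<phi>|count_space (Omega N). (real_of_int (\<phi> 0))\<^sup>2 * ?w \<phi>)"
    by (rule cut_bound[OF power_chain_coupling[OF \<beta> \<alpha> q]])
  finally show ?thesis unfolding V(1) using V(2) by (simp add: le_divide_eq)
qed

lemma sum_powr_le:
  fixes t :: real
  assumes t: "0 < t" "t < 1"
  shows "(\<Sum>r=1..n. real r powr (t - 1)) \<le> real n powr t / t"
proof (induction n)
  case (Suc n)
  have "real n powr t \<le> real (Suc n) powr t - t * (real (Suc n) - real n) * real (Suc n) powr (t - 1)"
    by (rule powr_tangent[OF t]) auto
  then have "real (Suc n) powr (t - 1) \<le> (real (Suc n) powr t - real n powr t) / t"
    using t by (simp add: field_simps)
  with Suc show ?case by (simp add: diff_divide_distrib)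
qed simp

lemma sum_inverse_le:
  assumes "1 \<le> n"
  shows "(\<Sum>r=1..n. real r powr (- 1)) \<le> 1 + ln (real n)"
  using assms
proof (induction n rule: dec_induct)
  case (step n)
  have "ln (real n / real (Suc n)) \<le> real n / real (Suc n) - 1"
    using step by (intro ln_le_minus_one) auto
  also have "\<dots> = - (1 / real (Suc n))" by (simp add: field_simps)
  finally have "1 / real (Suc n) \<le> ln (real (Suc n)) - ln (real n)"
    using step by (simp add: ln_div)
  with step.IH show ?case by (simp add: powr_minus divide_inverse)
qed simp

text \<open>The sum telescopes against the convex function \<open>y powr (- p)\<close>, by \<open>(1 - 1 / y) powr (- p) \<ge> 1 + p / y\<close>.\<close>
lemma sum_tail_powr_le:
  fixes p :: real
  assumes p: "0 < p" and N: "1 \<le> N"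
  shows "(\<Sum>r=Suc N..n. real r powr (- 1 - p)) \<le> real N powr (- p) / p"
proof (cases "N \<le> n")
  case True
  then have "(\<Sum>r=Suc N..n. real r powr (- 1 - p)) \<le> (real N powr (- p) - real n powr (- p)) / p"
  proof (induction n rule: dec_induct)
    case (step n)
    define y where "y = real (Suc n)"
    have y: "1 < y" "real n = y - 1" "0 < real n" using step N by (auto simp: y_def)
    have "ln (real n / y) \<le> real n / y - 1" using y by (intro ln_le_minus_one) auto
    also have "\<dots> = - (1 / y)" unfolding y(2) using y(1) by (simp add: diff_divide_distrib)
    finally have "1 / y \<le> - ln (real n / y)" by simp
    then have "p * (1 / y) \<le> p * (- ln (real n / y))" using p by (intro mult_left_mono) auto
    then have "1 + p / y \<le> 1 + p * (- ln (real n / y))" by simp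
    also have "\<dots> \<le> exp (p * (- ln (real n / y)))" by (rule exp_ge_add_one_self)
    also have "\<dots> = (real n / y) powr (- p)" using y by (simp add: powr_def)
    also have "\<dots> = real n powr (- p) / y powr (- p)" using y by (intro powr_divide)
    finally have "(1 + p / y) * y powr (- p) \<le> real n powr (- p)" using y(1) by (simp add: field_simps)
    moreover have "p * y powr (- 1 - p) = p / y * y powr (- p)"
      using y(1) by (simp add: powr_diff powr_minus divide_inverse)
    ultimately have "p * y powr (- 1 - p) \<le> real n powr (- p) - y powr (- p)"
      by (simp only: distrib_right mult_1)
    then have "y powr (- 1 - p) \<le> (real n powr (- p) - y powr (- p)) / p"
      using p by (simp add: pos_le_divide_eq mult.commute)
    with step show ?case by (simp add: y_def diff_divide_distrib)
  qed simp
  also have "\<dots> \<le> real N powr (- p) / p" using p by (intro divide_right_mono) auto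
  finally show ?thesis .
qed (use p in simp)

text \<open>The part of the cut exponent that grows with \<open>N\<close>, before division by the power \<open>l powr a\<close> of the cut spacing. Its
  growth distinguishes the regimes of the lower bound.\<close>
definition range_sum :: "nat \<Rightarrow> real \<Rightarrow> real \<Rightarrow> real"
  where "range_sum N \<alpha> a = (\<Sum>r. real r powr (1 - \<alpha>) * min (real r) (real N) powr a)"

lemma summable_range_sum:
  assumes "2 < \<alpha>" and "0 < a"
  shows "summable (\<lambda>r. real r powr (1 - \<alpha>) * min (real r) (real N) powr a)"
proof (rule summable_comparison_test'[where N = 0])
  show "summable (\<lambda>r. real r powr (1 - \<alpha>) * real N powr a)"
    using assms by (intro summable_mult2) (simp add: summable_real_powr_iff)
  show "norm (real r powr (1 - \<alpha>) * min (real r) (real N) powr a) \<le> real r powr (1 - \<alpha>) * real N powr a" for r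
    using assms by (auto simp: abs_mult intro!: mult_left_mono powr_mono2)
qed

lemma range_sum_ge_1:
  assumes "2 < \<alpha>" and "0 < a" and "1 \<le> N"
  shows "1 \<le> range_sum N \<alpha> a"
proof -
  have "(\<Sum>r\<in>{1::nat}. real r powr (1 - \<alpha>) * min (real r) (real N) powr a) \<le> range_sum N \<alpha> a"
    unfolding range_sum_def by (rule sum_le_suminf[OF summable_range_sum[OF assms(1,2)]]) auto
  then show ?thesis using assms by simp
qed

lemma range_sum_le:
  assumes \<alpha>: "2 < \<alpha>" and a: "0 < a" and N: "1 \<le> N"
  shows "range_sum N \<alpha> a \<le> (\<Sum>r=1..N. real r powr (1 - \<alpha> + a)) + real N powr (a + 2 - \<alpha>) / (\<alpha> - 2)"
  unfolding range_sum_def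
proof (rule suminf_le_const[OF summable_range_sum[OF \<alpha> a]])
  fix n
  let ?f = "\<lambda>r. real r powr (1 - \<alpha>) * min (real r) (real N) powr a"
  have "sum ?f {..<n} \<le> sum ?f ({0} \<union> ({1..N} \<union> {Suc N..n}))"
    by (rule sum_mono2) auto
  also have "\<dots> = sum ?f {1..N} + sum ?f {Suc N..n}"
    by (subst sum.union_disjoint; (subst sum.union_disjoint)?) auto
  also have "sum ?f {1..N} = (\<Sum>r=1..N. real r powr (1 - \<alpha> + a))"
    by (intro sum.cong refl) (auto simp: min_def powr_add)
  also have "sum ?f {Suc N..n} = real N powr a * (\<Sum>r=Suc N..n. real r powr (- 1 - (\<alpha> - 2)))"
    unfolding sum_distrib_left by (intro sum.cong refl) (auto simp: min_def algebra_simps)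
  also have "\<dots> \<le> real N powr a * (real N powr (- (\<alpha> - 2)) / (\<alpha> - 2))"
    using \<alpha> N by (intro mult_left_mono sum_tail_powr_le) auto
  also have "\<dots> = real N powr (a + 2 - \<alpha>) / (\<alpha> - 2)"
    by (simp add: powr_add[symmetric] algebra_simps)
  finally show "sum ?f {..<n} \<le> (\<Sum>r=1..N. real r powr (1 - \<alpha> + a)) + real N powr (a + 2 - \<alpha>) / (\<alpha> - 2)"
    by simp
qed

definition lower_const :: "real \<Rightarrow> real \<Rightarrow> real"
  where "lower_const \<beta> \<alpha> = exp (- 4 * \<beta> * ((\<Sum>r. real r powr (1 - \<alpha>)) + 1)) / 3"

text \<open>The spacing \<open>l\<close> is chosen as the power \<open>2 / q\<close> of the range sum, the smallest order for which the cut exponents stay bounded.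
  The number of remaining cuts is of order \<open>N / l\<close>.\<close>
lemma variance_lower_range_sum:
  assumes \<beta>: "0 < \<beta>" and \<alpha>: "2 < \<alpha>" and q: "0 < q" "q < 2" and N: "1 \<le> N"
    and Y: "range_sum N \<alpha> (q / 2) \<le> Y"
  shows "lower_const \<beta> \<alpha> * (real N * Y powr (- 2 / q)) \<le> sos_var N \<beta> \<alpha> q (\<lambda>\<phi>. real_of_int (\<phi> 0))"
proof -
  define a where "a = q / 2"
  have a: "0 < a" "a < 1" using q by (auto simp: a_def)
  have Y1: "1 \<le> Y" using range_sum_ge_1[OF \<alpha> a(1) N] Y by (simp add: a_def)
  define x where "x = Y powr (1 / a)"
  have x1: "1 \<le> x" unfolding x_def using Y1 a by (intro ge_one_powr_ge_zero) auto
  \<comment> \<open>Since \<open>Y\<close> is at least \<open>1\<close>, rounding up costs at most a factor \<open>2\<close>.\<close>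
  define l where "l = nat \<lceil>x\<rceil>"
  have lx: "x \<le> real l" "real l \<le> 2 * x" using x1 by (auto simp: l_def) linarith
  have l1: "1 \<le> l" using lx x1 by linarith
  define \<zeta> where "\<zeta> = (\<Sum>r. real r powr (1 - \<alpha>))"
  have s1: "summable (\<lambda>r. real r powr (1 - \<alpha>))" using \<alpha> by (simp add: summable_real_powr_iff)
  have "Y = x powr a" using Y1 a by (simp add: x_def powr_powr)
  also have "\<dots> \<le> real l powr a" using lx x1 a by (intro powr_mono2) auto
  finally have lY: "Y \<le> real l powr a" .
  have summand: "real r * range_term N l \<alpha> a r
      = real r powr (1 - \<alpha>) + 1 / real l powr a * (real r powr (1 - \<alpha>) * min (real r) (real N) powr a)" for r
  proof -
    have "real r * real r powr (- \<alpha>) = real r powr (1 - \<alpha>)"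
      by (cases "r = 0") (auto simp: powr_diff powr_minus divide_inverse)
    then have "real r * range_term N l \<alpha> a r = real r powr (1 - \<alpha>) * crossing_factor N l a (real r)"
      by (simp add: range_term_def)
    moreover have "(min (real r) (real N) / real l) powr a = min (real r) (real N) powr a / real l powr a"
      by (intro powr_divide)
    ultimately show ?thesis by (simp add: crossing_factor_def distrib_left)
  qed
  note s2 = summable_mult[OF summable_range_sum[OF \<alpha> a(1), of N], of "1 / real l powr a"]
  have sm: "summable (\<lambda>r. real r * range_term N l \<alpha> a r)" unfolding summand by (rule summable_add[OF s1 s2])
  have total: "(\<Sum>r. real r * range_term N l \<alpha> a r) \<le> \<zeta> + 1"
  proof -
    have "(\<Sum>r. real r * range_term N l \<alpha> a r) = \<zeta> + 1 / real l powr a * range_sum N \<alpha> a"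
      unfolding summand \<zeta>_def range_sum_def
      by (simp only: suminf_add[OF s1 s2, symmetric] suminf_mult[OF summable_range_sum[OF \<alpha> a(1), of N]])
    also have "1 / real l powr a * range_sum N \<alpha> a \<le> 1"
      using Y lY l1 by (simp add: a_def divide_le_eq)
    finally show ?thesis by simp
  qed
  have S: "(\<Sum>r. min (real r) (2 * real (l * m) + 1) * range_term N l \<alpha> (q / 2) r) \<le> \<zeta> + 1" for m
  proof -
    have le: "min (real r) (2 * real (l * m) + 1) * range_term N l \<alpha> a r \<le> real r * range_term N l \<alpha> a r" for r
      by (intro mult_right_mono range_term_nonneg) auto
    have "summable (\<lambda>r. min (real r) (2 * real (l * m) + 1) * range_term N l \<alpha> a r)"
      by (rule summable_comparison_test'[OF sm, where N = 0]) (use le range_term_nonneg[of N l \<alpha> a] in \<open>simp add: abs_mult\<close>)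
    from suminf_le[OF le this sm] total show ?thesis by (simp add: a_def)
  qed
  have "1 < \<alpha>" using \<alpha> by simp
  note lower = variance_lower_cuts[OF \<beta> this q l1 S]
  have "real N \<le> real l * (1 + real (N div l))"
  proof -
    have "N mod l < l" using l1 by simp
    then have "N \<le> l * (N div l) + l" using mult_div_mod_eq[of l N] by linarith
    then have "real N \<le> real (l * (N div l) + l)" by (simp only: of_nat_le_iff)
    then show ?thesis by (simp add: distrib_left)
  qed
  also have "\<dots> \<le> 2 * x * (1 + real (N div l))" using lx by (intro mult_right_mono) auto
  finally have "real N * (1 / x) \<le> 2 * (1 + real (N div l))" using x1 by (simp add: field_simps)
  moreover have "1 / x = Y powr (- 2 / q)"
  proof -
    have "1 / x = Y powr (- (1 / a))" unfolding x_def by (rule powr_minus_divide[symmetric])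
    also have "- (1 / a) = - 2 / q" by (simp add: a_def)
    finally show ?thesis .
  qed
  ultimately have "lower_const \<beta> \<alpha> * (real N * Y powr (- 2 / q)) \<le> lower_const \<beta> \<alpha> * (2 * (1 + real (N div l)))"
    by (intro mult_left_mono) (auto simp: lower_const_def)
  also have "\<dots> = 2 / 3 * exp (- 4 * \<beta> * (\<zeta> + 1)) * (1 + real (N div l))"
    by (simp add: lower_const_def \<zeta>_def)
  finally show ?thesis using lower by linarith
qed

text \<open>Only the move that raises the origin alone is used. Its cost is finite for every summable interaction.\<close>
lemma variance_lower_constant:
  assumes \<beta>: "0 < \<beta>" and \<alpha>: "1 < \<alpha>" and q: "0 < q" "q < 2"
  shows "2 / 3 * exp (- 4 * \<beta> * (\<Sum>r. 2 * real r powr (- \<alpha>))) \<le> sos_var N \<beta> \<alpha> q (\<lambda>\<phi>. real_of_int (\<phi> 0))"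
proof -
  define a where "a = q / 2"
  have a: "0 < a" "a < 1" using q by (auto simp: a_def)
  have s: "summable (\<lambda>r. 2 * real r powr (- \<alpha>))" using \<alpha> by (intro summable_mult) (simp add: summable_real_powr_iff)
  have le: "min (real r) 1 * range_term N (Suc N) \<alpha> a r \<le> 2 * real r powr (- \<alpha>)" for r
  proof -
    have "(min (real r) (real N) / real (Suc N)) powr a \<le> 1 powr a" using a by (intro powr_mono2) (auto simp: divide_le_eq)
    then have "range_term N (Suc N) \<alpha> a r \<le> real r powr (- \<alpha>) * 2"
      unfolding range_term_def crossing_factor_def by (intro mult_left_mono) auto
    moreover have "min (real r) 1 * range_term N (Suc N) \<alpha> a r \<le> 1 * range_term N (Suc N) \<alpha> a r"
      by (intro mult_right_mono range_term_nonneg) auto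
    ultimately show ?thesis by simp
  qed
  have "summable (\<lambda>r. min (real r) 1 * range_term N (Suc N) \<alpha> a r)"
    by (rule summable_comparison_test'[OF s, where N = 0]) (use le range_term_nonneg[of N "Suc N" \<alpha> a] in \<open>simp add: abs_mult\<close>)
  from suminf_le[OF le this s]
  have "(\<Sum>r. min (real r) (2 * real (Suc N * m) + 1) * range_term N (Suc N) \<alpha> (q / 2) r) \<le> (\<Sum>r. 2 * real r powr (- \<alpha>))"
    if "m \<le> N div Suc N" for m
    using that by (simp add: a_def)
  from variance_lower_cuts[OF \<beta> \<alpha> q _ this] show ?thesis by simp
qed

theorem variance_lower:
  assumes \<beta>: "0 < \<beta>" and \<alpha>: "1 < \<alpha>" and q: "0 < q" "q < 2"
  shows "\<exists>c>0. \<forall>N\<ge>2.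
    (\<alpha> \<le> 2 \<longrightarrow> c \<le> sos_var N \<beta> \<alpha> q (\<lambda>\<phi>. real_of_int (\<phi> 0))) \<and>
    (2 < \<alpha> \<and> \<alpha> < 2 + q / 2 \<longrightarrow>
      c * real N powr (2 / q * (\<alpha> - 2)) \<le> sos_var N \<beta> \<alpha> q (\<lambda>\<phi>. real_of_int (\<phi> 0))) \<and>
    (\<alpha> = 2 + q / 2 \<longrightarrow>
      c * (real N / ln (real N) powr (2 / q)) \<le> sos_var N \<beta> \<alpha> q (\<lambda>\<phi>. real_of_int (\<phi> 0))) \<and>
    (2 + q / 2 < \<alpha> \<longrightarrow>
      c * real N \<le> sos_var N \<beta> \<alpha> q (\<lambda>\<phi>. real_of_int (\<phi> 0)))"
proof -
  let ?V = "\<lambda>N. sos_var N \<beta> \<alpha> q (\<lambda>\<phi>. real_of_int (\<phi> 0))"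
  have lc: "0 < lower_const \<beta> \<alpha>" by (simp add: lower_const_def)
  \<comment> \<open>It suffices to know the range sum up to a constant, which only changes the prefactor.\<close>
  have reduce: "lower_const \<beta> \<alpha> * C powr (- 2 / q) * (real N * U powr (- 2 / q)) \<le> ?V N"
    if "2 < \<alpha>" "2 \<le> N" "0 < C" "0 < U" "range_sum N \<alpha> (q / 2) \<le> C * U" for N C U
  proof -
    have "(C * U) powr (- 2 / q) = C powr (- 2 / q) * U powr (- 2 / q)" using that by (intro powr_mult)
    then show ?thesis
      using variance_lower_range_sum[OF \<beta> that(1) q _ that(5)] that(2) by (simp add: mult_ac)
  qed
  consider "\<alpha> \<le> 2" | "2 < \<alpha>" "\<alpha> < 2 + q / 2" | "\<alpha> = 2 + q / 2" | "2 + q / 2 < \<alpha>" by linarith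
  then show ?thesis
  proof cases
    case 1
    then show ?thesis
      using variance_lower_constant[OF \<beta> \<alpha> q] q
      by (intro exI[of _ "2 / 3 * exp (- 4 * \<beta> * (\<Sum>r. 2 * real r powr (- \<alpha>)))"]) auto
  next
    case 2
    define t where "t = q / 2 + 2 - \<alpha>"
    have t: "0 < t" "t < 1" using 2 q by (auto simp: t_def)
    define C where "C = 1 / t + 1 / (\<alpha> - 2)"
    have C: "0 < C" unfolding C_def using t 2 by (intro add_pos_pos) auto
    have "lower_const \<beta> \<alpha> * C powr (- 2 / q) * real N powr (2 / q * (\<alpha> - 2)) \<le> ?V N" if N: "2 \<le> N" for N
    proof -
      have "(\<Sum>r=1..N. real r powr (1 - \<alpha> + q / 2)) \<le> real N powr t / t"
        using sum_powr_le[OF t, of N] by (simp add: t_def algebra_simps)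
      then have "range_sum N \<alpha> (q / 2) \<le> C * real N powr t"
        using range_sum_le[of \<alpha> "q / 2" N] 2 q N by (simp add: C_def t_def algebra_simps)
      from reduce[OF 2(1) N C _ this] N
      have "lower_const \<beta> \<alpha> * C powr (- 2 / q) * (real N * (real N powr t) powr (- 2 / q)) \<le> ?V N" by simp
      moreover have "real N * (real N powr t) powr (- 2 / q) = real N powr (2 / q * (\<alpha> - 2))"
      proof -
        have "t * (- 2 / q) = 2 / q * (\<alpha> - 2) - 1" using q by (simp add: t_def field_simps)
        then show ?thesis using N by (simp only: powr_powr) (simp add: powr_diff)
      qed
      ultimately show ?thesis by simp
    qed
    then show ?thesis using 2 lc C by (intro exI[of _ "lower_const \<beta> \<alpha> * C powr (- 2 / q)"]) auto
  next
    case 3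
    have \<alpha>2: "2 < \<alpha>" using 3 q by simp
    define C where "C = (1 + 2 / q) / ln 2 + 1"
    have C: "0 < C" unfolding C_def using q by (intro add_pos_pos divide_pos_pos) auto
    have "lower_const \<beta> \<alpha> * C powr (- 2 / q) * (real N / ln (real N) powr (2 / q)) \<le> ?V N" if N: "2 \<le> N" for N
    proof -
      have ln2: "ln 2 \<le> ln (real N)" using N by (subst ln_le_cancel_iff) auto
      then have ln0: "0 < ln (real N)" using ln_gt_zero[of 2] by linarith
      have "range_sum N \<alpha> (q / 2) \<le> (1 + ln (real N)) + 2 / q"
        using range_sum_le[of \<alpha> "q / 2" N] sum_inverse_le[of N] \<alpha>2 q N by (simp add: 3)
      also have "\<dots> \<le> C * ln (real N)"
      proof -
        have "(1 + 2 / q) / ln 2 * ln 2 \<le> (1 + 2 / q) / ln 2 * ln (real N)"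
          using q ln2 by (intro mult_left_mono) auto
        moreover have "(1 + 2 / q) / ln 2 * ln 2 = 1 + 2 / q" by simp
        ultimately show ?thesis unfolding C_def distrib_right by linarith
      qed
      finally have "range_sum N \<alpha> (q / 2) \<le> C * ln (real N)" .
      from reduce[OF \<alpha>2 N C ln0 this] show ?thesis by (simp add: powr_minus divide_inverse)
    qed
    then show ?thesis using 3 lc C q by (intro exI[of _ "lower_const \<beta> \<alpha> * C powr (- 2 / q)"]) auto
  next
    case 4
    have \<alpha>2: "2 < \<alpha>" using 4 q by simp
    have s: "summable (\<lambda>r. real r powr (1 - \<alpha> + q / 2))" using 4 by (simp add: summable_real_powr_iff)
    define C where "C = (\<Sum>r. real r powr (1 - \<alpha> + q / 2)) + 1 / (\<alpha> - 2)"
    have C: "0 < C" unfolding C_def using suminf_nonneg[OF s] \<alpha>2 by (intro add_nonneg_pos) auto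
    have "lower_const \<beta> \<alpha> * C powr (- 2 / q) * real N \<le> ?V N" if N: "2 \<le> N" for N
    proof -
      have "(\<Sum>r=1..N. real r powr (1 - \<alpha> + q / 2)) \<le> (\<Sum>r. real r powr (1 - \<alpha> + q / 2))"
        by (rule sum_le_suminf[OF s]) auto
      moreover have "real N powr (q / 2 + 2 - \<alpha>) \<le> 1 powr (q / 2 + 2 - \<alpha>)"
        using 4 N by (intro powr_mono2') auto
      then have "real N powr (q / 2 + 2 - \<alpha>) / (\<alpha> - 2) \<le> 1 / (\<alpha> - 2)"
        using \<alpha>2 by (intro divide_right_mono) auto
      ultimately have "range_sum N \<alpha> (q / 2) \<le> C * 1"
        using range_sum_le[of \<alpha> "q / 2" N] \<alpha>2 q N by (simp add: C_def)
      from reduce[OF \<alpha>2 N C _ this] show ?thesis by simp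
    qed
    then show ?thesis using 4 lc C q by (intro exI[of _ "lower_const \<beta> \<alpha> * C powr (- 2 / q)"]) auto
  qed
qed

theorem theorem1p5:
  fixes \<beta> \<alpha> q :: real
  assumes "0 < \<beta>" and "1 < \<alpha>" and "0 < q" and "q < 2"
  shows
    "(\<exists>c>0. \<forall>N\<ge>2.
        (\<alpha> \<le> 2 \<longrightarrow>
          c \<le> sos_var N \<beta> \<alpha> q (\<lambda>\<phi>. real_of_int (\<phi> 0))) \<and>
        (2 < \<alpha> \<and> \<alpha> < 2 + q / 2 \<longrightarrow>
          c * real N powr (2 / q * (\<alpha> - 2)) \<le> sos_var N \<beta> \<alpha> q (\<lambda>\<phi>. real_of_int (\<phi> 0))) \<and>
        (\<alpha> = 2 + q / 2 \<longrightarrow>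
          c * (real N / ln (real N) powr (2 / q)) \<le> sos_var N \<beta> \<alpha> q (\<lambda>\<phi>. real_of_int (\<phi> 0))) \<and>
        (2 + q / 2 < \<alpha> \<longrightarrow>
          c * real N \<le> sos_var N \<beta> \<alpha> q (\<lambda>\<phi>. real_of_int (\<phi> 0)))) \<and>
     (\<exists>C. \<forall>N\<ge>2.
        (\<alpha> < q \<longrightarrow>
          sos_var N \<beta> \<alpha> q (\<lambda>\<phi>. real_of_int (\<phi> 0)) \<le> C) \<and>
        (\<alpha> = q \<longrightarrow>
          sos_var N \<beta> \<alpha> q (\<lambda>\<phi>. real_of_int (\<phi> 0)) \<le> C * ln (real N)) \<and>
        (q < \<alpha> \<longrightarrow>
          sos_var N \<beta> \<alpha> q (\<lambda>\<phi>. real_of_int (\<phi> 0)) \<le> C * real N powr (2 * \<alpha> / q - 2)))"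
  by (rule conjI[OF variance_lower[OF assms] variance_upper[OF assms]])

end
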